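(* For any $\alpha\in\mathbb{R}$ and any smooth vector fields $\mathbf{U},\mathbf{V},\mathbf{W}\in\Gamma TN$, at every $P\in N$, $$\nabla_{\mathbf{U}}^\alpha\nabla_{\mathbf{V}}^\alpha\mathbf{W}-\nabla_{\mathbf{V}}^\alpha\nabla_{\mathbf{U}}^\alpha\mathbf{W}-\nabla_{[\mathbf{U},\mathbf{V}]}^\alpha\mathbf{W}=\tfrac{1-\alpha^2}{4}\left(\langle\mathbf{V},\mathbf{W}\rangle_P\,\mathbf{U}-\langle\mathbf{U},\mathbf{W}\rangle_P\,\mathbf{V}\right).$$ Consequently the curvature tensor $R^\alpha$ of $\nabla^\alpha$ (the covariant 4-tensor field obtained by pairing the left-hand side, in the metric, with a fourth tangent vector $X$) is $$R_P^\alpha(U,V,W,X)=\tfrac{1-\alpha^2}{4}\left(\langle V,W\rangle_P\langle U,X\rangle_P-\langle U,W\rangle_P\langle V,X\rangle_P\right),\qquad U,V,W,X\in T_PN.$$ It satisfies $R^\alpha=R^{-\alpha}$, and it is zero if and only if $\alpha=\pm1$.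
   Context: Let $B$ be an open subset of a (real) Banach space $\mathbb{X}\neq\{0\}$, let $\mathcal{X}_B$ be the Borel $\sigma$-algebra of $B$, and let $\mu$ be a probability measure on $(B,\mathcal{X}_B)$ such that $\mu(A)>0$ for every non-empty open $A\in\mathcal{X}_B$. Fix $k\in\mathbb{N}_0$. $\mathbb{G}:=C_b^k(B;\mathbb{R})$ is the Banach space of bounded continuous functions $a:B\to\mathbb{R}$ with bounded continuous Fréchet derivatives $a^{(i)}$ of all orders $1\le i\le k$, with norm $\|a\|_{\mathbb{G}}=\sup_{x\in B}|a(x)|+\sum_{i=1}^k\sup_{x\in B}\|a_x^{(i)}\|_{L(\mathbb{X}^i;\mathbb{R})}$. Products in $\mathbb{G}$ are pointwise, $\exp_{\mathbb{G}}(a)(x)=\exp(a(x))$; $\mathbf{E}_\mu a=\int_B a\,d\mu$. $\mathbb{G}_0:=\{a\in\mathbb{G}:\mathbf{E}_\mu a=0\}$. The manifold $M$: the set of finite measures $P$ on $(B,\mathcal{X}_B)$, mutually absolutely continuous with respect to $\mu$, with density $dP/d\mu=\exp_{\mathbb{G}}(a)$ for some $a\in\mathbb{G}$. Its charts (each global, with smooth transition maps) are $\phi_1(P)=\log(dP/d\mu)$ and, for $\alpha\ne1$, $\phi_\alpha(P)=\frac{2}{1-\alpha}\left(\exp_{\mathbb{G}}\left(\frac{1-\alpha}{2}\phi_1(P)\right)-1\right)$. The tangent space $T_PM$ consists of the signed measures $U$ with density $dU/dP=u\in\mathbb{G}$; for a differentiable Banach-space-valued map $f$ on $M$, $Uf:=(f\circ\phi_1^{-1})^{(1)}_{\phi_1(P)}u$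 is the derivative of $f$ at $P$ in direction $U$ (so $U\phi_1=dU/dP$). For each $\alpha$, $U\mapsto U\phi_\alpha$ is a linear bijection $T_PM\to\mathbb{G}$. The manifold $N:=\{P\in M:P(B)=1\}$ is a $C^\infty$-embedded submanifold of $M$, modelled on $\mathbb{G}_0$, with global charts $\phi_m,\phi_e:N\to\mathbb{G}_0$, $\phi_m(P)=dP/d\mu-1$ and $\phi_e(P)=\phi_1(P)-\mathbf{E}_\mu\phi_1(P)$. $T_PN$ is the set of $U\in T_PM$ with total mass zero. The Fisher-Rao metric on $N$ is $\langle U,V\rangle_P:=\int_B\frac{dU}{dP}\frac{dV}{dP}\,dP$ for $U,V\in T_PN$. $\imath:N\to M$ is inclusion; $\nu:M\to N$, $\nu(P)=P/P(B)$, is normalisation, whose tangent map $T\nu:T_PM\to T_{\nu(P)}N$ satisfies $(T\nu X)\phi_e=X\phi_1-\mathbf{E}_\mu X\phi_1$. $\Gamma TN$ is the space of smooth vector fields on $N$, $\mathbf{V}f$ is the map $P\mapsto\mathbf{V}_Pf$, $\mathbf{U}\mathbf{V}f:=\mathbf{U}(\mathbf{V}f)$, and $[\mathbf{U},\mathbf{V}]$ is the Lie bracket, $[\mathbf{U},\mathbf{V}]f=\mathbf{U}\mathbf{V}f-\mathbf{V}\mathbf{U}f$. The $\alpha$-covariant derivative $\nabla^\alpha$ on $N$ is defined, for $\mathbf{U},\mathbf{V}\in\Gamma TN$ and $P\in N$, by $(\nabla_{\mathbf{U}}^\alpha\mathbf{V})_P:=T\nu\,\mathbf{W}_P$, where $\mathbf{W}_P\in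 T_PM$ is the unique tangent vector with $\mathbf{W}_P\phi_\alpha=\mathbf{U}_P\mathbf{V}(\phi_\alpha\circ\imath)$. *)

theory Defs
  imports "HOL-Probability.Probability" "HOL-Library.Function_Algebras"
begin

instantiation "fun" :: (type, real_vector) real_vector
begin

definition scaleR_fun :: "real \<Rightarrow> ('a \<Rightarrow> 'b) \<Rightarrow> 'a \<Rightarrow> 'b"
  where "scaleR_fun c f = (\<lambda>x. c *\<^sub>R f x)"

instance
  by standard (auto simp: scaleR_fun_def fun_eq_iff scaleR_add_right scaleR_add_left)

end

section \<open>Calculus on normed spaces given by a carrier and a norm\<close>

text \<open>
  The function space \<open>C\<^sub>b\<^sup>k(B)\<close> depends on the variables \<open>B\<close> and \<open>k\<close>, and derivatives of order
  \<open>i\<close> live in \<open>L(X\<^sup>i;Y)\<close> with \<open>i\<close> a variable. Neither can be a type, so normed spaces are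
  linear subspaces of a real vector space type together with a norm on the subspace.
\<close>

record 'v nspace =
  vecs :: "'v set"
  nrm :: "'v \<Rightarrow> real"

definition type_space :: "'a::real_normed_vector nspace"
  where "type_space = \<lparr>vecs = UNIV, nrm = norm\<rparr>"

text \<open>
  Maps are normalised to be \<open>0\<close> outside the carrier (here and in \<open>multilin\<close>), so that equality
  of functions is equality of maps on the carrier.
\<close>

definition bounded_lin :: "'v::real_vector nspace \<Rightarrow> 'w::real_vector nspace \<Rightarrow> ('v \<Rightarrow> 'w) set"
  where "bounded_lin E F = {A.
    (\<forall>h\<in>vecs E. A h \<in> vecs F) \<and>
    (\<forall>h\<in>vecs E. \<forall>h'\<in>vecs E. A (h + h') = A h + A h') \<and>
    (\<forall>c. \<forall>h\<in>vecs E. A (c *\<^sub>R h) = c *\<^sub>R A h) \<and>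
    (\<exists>C. \<forall>h\<in>vecs E. nrm F (A h) \<le> C * nrm E h) \<and>
    (\<forall>h. h \<notin> vecs E \<longrightarrow> A h = 0)}"

text \<open>\<open>multilin i E F\<close> is \<open>L(E\<^sup>i;F)\<close> with the operator norm; the \<open>i\<close> arguments form a list.\<close>

definition multilin ::
  "nat \<Rightarrow> 'v::real_vector nspace \<Rightarrow> 'w::real_vector nspace \<Rightarrow> ('v list \<Rightarrow> 'w) nspace"
  where "multilin i E F = \<lparr>
    vecs = {T.
      (\<forall>hs. length hs = i \<and> set hs \<subseteq> vecs E \<longrightarrow> T hs \<in> vecs F) \<and>
      (\<forall>us vs. \<forall>h\<in>vecs E. \<forall>h'\<in>vecs E. \<forall>c.
        length us + 1 + length vs = i \<and> set us \<subseteq> vecs E \<and> set vs \<subseteq> vecs E \<longrightarrow>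
        T (us @ (h + h') # vs) = T (us @ h # vs) + T (us @ h' # vs) \<and>
        T (us @ (c *\<^sub>R h) # vs) = c *\<^sub>R T (us @ h # vs)) \<and>
      (\<exists>C. \<forall>hs. length hs = i \<and> set hs \<subseteq> vecs E \<longrightarrow>
        nrm F (T hs) \<le> C * prod_list (map (nrm E) hs)) \<and>
      (\<forall>hs. \<not> (length hs = i \<and> set hs \<subseteq> vecs E) \<longrightarrow> T hs = 0)},
    nrm = (\<lambda>T. SUP hs\<in>{hs. length hs = i \<and> set hs \<subseteq> {h\<in>vecs E. nrm E h \<le> 1}}. nrm F (T hs))\<rparr>"

definition has_fderiv :: "'v::real_vector nspace \<Rightarrow> 'w::real_vector nspace \<Rightarrow> 'v set \<Rightarrow>
    ('v \<Rightarrow> 'w) \<Rightarrow> ('v \<Rightarrow> 'w) \<Rightarrow> 'v \<Rightarrow> bool"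
  where "has_fderiv E F S f A x \<longleftrightarrow> A \<in> bounded_lin E F \<and>
    (\<forall>e>0. \<exists>d>0. \<forall>y\<in>S. nrm E (y - x) < d \<longrightarrow>
      nrm F (f y - f x - A (y - x)) \<le> e * nrm E (y - x))"

lemma has_fderiv_type_space:
  "has_fderiv type_space type_space S f A x \<longleftrightarrow> (f has_derivative A) (at x within S)"
proof -
  have "A \<in> bounded_lin type_space type_space \<longleftrightarrow> bounded_linear A"
    unfolding bounded_linear_def bounded_linear_axioms_def linear_iff bounded_lin_def
    by (auto simp: type_space_def mult.commute)
  then show ?thesis
    unfolding has_fderiv_def has_derivative_within_alt by (simp add: type_space_def)
qed

definition fderiv :: "'v::real_vector nspace \<Rightarrow> 'w::real_vector nspace \<Rightarrow> 'v set \<Rightarrow>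
    ('v \<Rightarrow> 'w) \<Rightarrow> 'v \<Rightarrow> 'v \<Rightarrow> 'w"
  where "fderiv E F S f x = (THE A. has_fderiv E F S f A x)"

primrec nth_fderiv :: "nat \<Rightarrow> 'v::real_vector nspace \<Rightarrow> 'w::real_vector nspace \<Rightarrow> 'v set \<Rightarrow>
    ('v \<Rightarrow> 'w) \<Rightarrow> 'v \<Rightarrow> 'v list \<Rightarrow> 'w"
  where
    "nth_fderiv 0 E F S f = (\<lambda>x hs. if hs = [] then f x else 0)"
  | "nth_fderiv (Suc i) E F S f = (\<lambda>x hs. case hs of [] \<Rightarrow> 0
       | h # t \<Rightarrow> fderiv E (multilin i E F) S (nth_fderiv i E F S f) x h t)"

definition ncontinuous_on :: "'v::real_vector nspace \<Rightarrow> 'w::real_vector nspace \<Rightarrow> 'v set \<Rightarrow>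
    ('v \<Rightarrow> 'w) \<Rightarrow> bool"
  where "ncontinuous_on E F S f \<longleftrightarrow>
    (\<forall>x\<in>S. \<forall>e>0. \<exists>d>0. \<forall>y\<in>S. nrm E (y - x) < d \<longrightarrow> nrm F (f y - f x) < e)"

text \<open>\<open>S\<close> is meant to be an open subset of \<open>E\<close>.\<close>

definition Ck_on :: "nat \<Rightarrow> 'v::real_vector nspace \<Rightarrow> 'w::real_vector nspace \<Rightarrow> 'v set \<Rightarrow>
    ('v \<Rightarrow> 'w) \<Rightarrow> bool"
  where "Ck_on k E F S f \<longleftrightarrow>
    (\<forall>x\<in>S. f x \<in> vecs F) \<and>
    (\<forall>i<k. \<forall>x\<in>S. \<exists>A. has_fderiv E (multilin i E F) S (nth_fderiv i E F S f) A x) \<and>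
    (\<forall>i\<le>k. ncontinuous_on E (multilin i E F) S (nth_fderiv i E F S f))"

definition smooth_nspace :: "'v::real_vector nspace \<Rightarrow> 'w::real_vector nspace \<Rightarrow> 'v set \<Rightarrow>
    ('v \<Rightarrow> 'w) \<Rightarrow> bool"
  where "smooth_nspace E F S f \<longleftrightarrow> (\<forall>k. Ck_on k E F S f)"

section \<open>The Banach space \<open>C\<^sub>b\<^sup>k(B)\<close>\<close>

text \<open>Functions on \<open>B\<close> are represented by their extension by \<open>0\<close>.\<close>

definition Cbk :: "nat \<Rightarrow> 'a::banach set \<Rightarrow> ('a \<Rightarrow> real) nspace"
  where "Cbk k B = \<lparr>
    vecs = {a. (\<forall>x. x \<notin> B \<longrightarrow> a x = 0) \<and>
      Ck_on k type_space type_space B a \<and>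
      (\<forall>i\<le>k. bdd_above ((\<lambda>x. nrm (multilin i type_space type_space)
        (nth_fderiv i type_space type_space B a x)) ` B))},
    nrm = (\<lambda>a. \<Sum>i\<le>k. SUP x\<in>B. nrm (multilin i type_space type_space)
      (nth_fderiv i type_space type_space B a x))\<rparr>"

definition exp_on :: "'a set \<Rightarrow> ('a \<Rightarrow> real) \<Rightarrow> 'a \<Rightarrow> real"
  where "exp_on B a = (\<lambda>x. if x \<in> B then exp (a x) else 0)"

section \<open>The manifolds \<open>M\<close> and \<open>N\<close>\<close>

text \<open>Throughout, \<open>B\<close> is \<open>space \<mu>\<close>, and \<open>indicator (space \<mu>)\<close> is the constant function \<open>1\<close>.\<close>

context
  fixes k :: nat and \<mu> :: "'a::banach measure"
begin

definition GG :: "('a \<Rightarrow> real) nspace"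
  where "GG = Cbk k (space \<mu>)"

definition GG0 :: "('a \<Rightarrow> real) nspace"
  where "GG0 = GG\<lparr>vecs := {a \<in> vecs GG. integral\<^sup>L \<mu> a = 0}\<rparr>"

definition exp_measure :: "('a \<Rightarrow> real) \<Rightarrow> 'a measure"
  where "exp_measure a = density \<mu> (\<lambda>x. ennreal (exp_on (space \<mu>) a x))"

definition manifold_M :: "'a measure set"
  where "manifold_M = {P. finite_measure P \<and> sets P = sets \<mu> \<and>
    absolutely_continuous \<mu> P \<and> absolutely_continuous P \<mu> \<and>
    (\<exists>a\<in>vecs GG. P = exp_measure a)}"

definition manifold_N :: "'a measure set"
  where "manifold_N = {P \<in> manifold_M. emeasure P (space \<mu>) = 1}"

definition normalise :: "'a measure \<Rightarrow> 'a measure"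
  where "normalise P = scale_measure (1 / emeasure P (space \<mu>)) P"

text \<open>
  \<open>chart_1 P = log (dP/d\<mu>)\<close>: since \<open>\<mu>\<close> charges every non-empty open set, the density has a unique
  continuous version.
\<close>

definition chart_1 :: "'a measure \<Rightarrow> 'a \<Rightarrow> real"
  where "chart_1 P = (THE a. a \<in> vecs GG \<and> P = exp_measure a)"

definition chart :: "real \<Rightarrow> 'a measure \<Rightarrow> 'a \<Rightarrow> real"
  where "chart \<alpha> P = (if \<alpha> = 1 then chart_1 P
    else (2 / (1 - \<alpha>)) *\<^sub>R
      (exp_on (space \<mu>) (((1 - \<alpha>) / 2) *\<^sub>R chart_1 P) - indicator (space \<mu>)))"

text \<open>The chart \<open>\<phi>\<^sub>e\<close> of \<open>N\<close>.\<close>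

definition chart_e :: "'a measure \<Rightarrow> 'a \<Rightarrow> real"
  where "chart_e P = chart_1 P - integral\<^sup>L \<mu> (chart_1 P) *\<^sub>R indicator (space \<mu>)"

text \<open>
  A signed measure is a set function. \<open>signed_density P u\<close> is the signed measure with density
  \<open>u\<close> with respect to \<open>P\<close>.
\<close>

definition signed_density :: "'a measure \<Rightarrow> ('a \<Rightarrow> real) \<Rightarrow> 'a set \<Rightarrow> real"
  where "signed_density P u = (\<lambda>A. if A \<in> sets P then set_lebesgue_integral P A u else 0)"

definition tangent_M :: "'a measure \<Rightarrow> ('a set \<Rightarrow> real) set"
  where "tangent_M P = {U. \<exists>u\<in>vecs GG. U = signed_density P u}"

definition tangent_N :: "'a measure \<Rightarrow> ('a set \<Rightarrow> real) set"
  where "tangent_N P = {U \<in> tangent_M P. U (space \<mu>) = 0}"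

text \<open>The continuous version of \<open>dU/dP\<close>.\<close>

definition tangent_density :: "'a measure \<Rightarrow> ('a set \<Rightarrow> real) \<Rightarrow> 'a \<Rightarrow> real"
  where "tangent_density P U = (THE u. u \<in> vecs GG \<and> U = signed_density P u)"

text \<open>\<open>deriv_M F f P U\<close> is \<open>Uf\<close> for \<open>f : M \<rightarrow> F\<close> and \<open>U \<in> T\<^sub>PM\<close>.\<close>

definition deriv_M :: "'w::real_vector nspace \<Rightarrow> ('a measure \<Rightarrow> 'w) \<Rightarrow> 'a measure \<Rightarrow>
    ('a set \<Rightarrow> real) \<Rightarrow> 'w"
  where "deriv_M F f P U =
    fderiv GG F (vecs GG) (f \<circ> inv_into manifold_M chart_1) (chart_1 P) (tangent_density P U)"

text \<open>
  \<open>coord_e P X\<close> is \<open>X(\<phi>\<^sub>e \<circ> \<nu>)\<close> for \<open>X \<in> T\<^sub>PM\<close>. If \<open>P \<in> N\<close> and \<open>X \<in> T\<^sub>PN\<close> then this is \<open>X\<phi>\<^sub>e\<close>,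
  the coordinate of \<open>X\<close> in the chart \<open>\<phi>\<^sub>e\<close>, because \<open>\<nu>\<close> is the identity on \<open>N\<close>.
\<close>

definition coord_e :: "'a measure \<Rightarrow> ('a set \<Rightarrow> real) \<Rightarrow> 'a \<Rightarrow> real"
  where "coord_e P X = deriv_M GG0 (chart_e \<circ> normalise) P X"

text \<open>
  \<open>deriv_N F f P U\<close> is \<open>Uf\<close> for \<open>f : N \<rightarrow> F\<close> and \<open>U \<in> T\<^sub>PN\<close>, computed in the chart \<open>\<phi>\<^sub>e\<close>; when \<open>f\<close>
  is defined on \<open>M\<close>, it is \<open>U(f \<circ> \<imath>)\<close>.
\<close>

definition deriv_N :: "'w::real_vector nspace \<Rightarrow> ('a measure \<Rightarrow> 'w) \<Rightarrow> 'a measure \<Rightarrow>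
    ('a set \<Rightarrow> real) \<Rightarrow> 'w"
  where "deriv_N F f P U =
    fderiv GG0 F (vecs GG0) (f \<circ> inv_into manifold_N chart_e) (chart_e P) (coord_e P U)"

definition smooth_N :: "'w::real_vector nspace \<Rightarrow> ('a measure \<Rightarrow> 'w) \<Rightarrow> bool"
  where "smooth_N F f \<longleftrightarrow> smooth_nspace GG0 F (vecs GG0) (f \<circ> inv_into manifold_N chart_e)"

text \<open>The tangent map \<open>T\<nu>\<close>, in the chart \<open>\<phi>\<^sub>e\<close>.\<close>

definition T_normalise :: "'a measure \<Rightarrow> ('a set \<Rightarrow> real) \<Rightarrow> 'a set \<Rightarrow> real"
  where "T_normalise P X = (THE Y. Y \<in> tangent_N (normalise P) \<and>
    coord_e (normalise P) Y = coord_e P X)"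

text \<open>\<open>\<Gamma>TN\<close>; the values of a vector field outside \<open>N\<close> are irrelevant.\<close>

definition vector_fields :: "('a measure \<Rightarrow> 'a set \<Rightarrow> real) set"
  where "vector_fields = {V. (\<forall>P\<in>manifold_N. V P \<in> tangent_N P) \<and>
    smooth_N GG0 (\<lambda>P. coord_e P (V P))}"

text \<open>
  The maps \<open>f\<close> on which the bracket is tested are the smooth \<open>f : N \<rightarrow> G\<close>. They contain the
  chart \<open>\<phi>\<^sub>e\<close> and, as multiples of the constant function \<open>1\<close>, the real-valued smooth maps.
\<close>

definition lie_bracket :: "('a measure \<Rightarrow> 'a set \<Rightarrow> real) \<Rightarrow> ('a measure \<Rightarrow> 'a set \<Rightarrow> real) \<Rightarrow>
    'a measure \<Rightarrow> 'a set \<Rightarrow> real"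
  where "lie_bracket U V P = (THE Z. Z \<in> tangent_N P \<and>
    (\<forall>f. smooth_N GG f \<longrightarrow> deriv_N GG f P Z =
      deriv_N GG (\<lambda>Q. deriv_N GG f Q (V Q)) P (U P) -
      deriv_N GG (\<lambda>Q. deriv_N GG f Q (U Q)) P (V P)))"

definition fisher_rao :: "'a measure \<Rightarrow> ('a set \<Rightarrow> real) \<Rightarrow> ('a set \<Rightarrow> real) \<Rightarrow> real"
  where "fisher_rao P U V = (\<integral>x. tangent_density P U x * tangent_density P V x \<partial>P)"

definition nabla :: "real \<Rightarrow> ('a measure \<Rightarrow> 'a set \<Rightarrow> real) \<Rightarrow> ('a measure \<Rightarrow> 'a set \<Rightarrow> real) \<Rightarrow>
    'a measure \<Rightarrow> 'a set \<Rightarrow> real"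
  where "nabla \<alpha> U V P = T_normalise P (THE W. W \<in> tangent_M P \<and>
    deriv_M GG (chart \<alpha>) P W = deriv_N GG (\<lambda>Q. deriv_N GG (chart \<alpha>) Q (V Q)) P (U P))"

definition curvature_op :: "real \<Rightarrow> ('a measure \<Rightarrow> 'a set \<Rightarrow> real) \<Rightarrow>
    ('a measure \<Rightarrow> 'a set \<Rightarrow> real) \<Rightarrow> ('a measure \<Rightarrow> 'a set \<Rightarrow> real) \<Rightarrow>
    'a measure \<Rightarrow> 'a set \<Rightarrow> real"
  where "curvature_op \<alpha> U V W P =
    nabla \<alpha> U (nabla \<alpha> V W) P - nabla \<alpha> V (nabla \<alpha> U W) P - nabla \<alpha> (lie_bracket U V) W P"

text \<open>
  The value of \<open>R\<^sup>\<alpha>\<close> at tangent vectors is the common value over all extensions of the first three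
  of them to smooth vector fields.
\<close>

definition curvature_tensor :: "real \<Rightarrow> 'a measure \<Rightarrow> ('a set \<Rightarrow> real) \<Rightarrow> ('a set \<Rightarrow> real) \<Rightarrow>
    ('a set \<Rightarrow> real) \<Rightarrow> ('a set \<Rightarrow> real) \<Rightarrow> real"
  where "curvature_tensor \<alpha> P U V W X = (THE r.
    \<forall>U'\<in>vector_fields. \<forall>V'\<in>vector_fields. \<forall>W'\<in>vector_fields.
      U' P = U \<and> V' P = V \<and> W' P = W \<longrightarrow> r = fisher_rao P (curvature_op \<alpha> U' V' W' P) X)"

end

end

theory Submission
  imports Defs
begin

text \<open>
  Each \<open>P \<in> N\<close> has a density \<open>exp (\<theta> a)\<close>, \<open>\<theta> a = a - ln (\<integral> exp a d\<mu>)\<close>, for a unique coordinate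
  \<open>a = \<phi>\<^sub>e P\<close> in \<open>G\<^sub>0\<close>. The tangent vector at \<open>P\<close> with coordinate \<open>h \<in> G\<^sub>0\<close> has density
  \<open>L h = h - E\<^sub>P h\<close> with respect to \<open>P\<close>, so that the metric is \<open>g(u, v) = E\<^sub>P (L u * L v)\<close>.
  Put \<open>c = (1 - \<alpha>) / 2\<close>, and let \<open>u\<close>, \<open>v\<close>, \<open>w\<close> be the coordinates of vector fields. The derivative of
  \<open>\<phi>\<^sub>\<alpha>\<close> along \<open>v\<close> is \<open>exp (c \<theta>) * L v\<close>. Differentiating this along \<open>u\<close> and cancelling the exponential, which
  is also the derivative of \<open>\<phi>\<^sub>\<alpha>\<close> as a map on \<open>M\<close>, leaves the coordinate
  \<open>D v u + \<Gamma>(u, v)\<close> with \<open>\<Gamma>(u, v) = c \<Pi> (L u * L v)\<close> for the covariant derivative of \<open>v\<close> along \<open>u\<close>, where \<open>\<Pi>\<close>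
  subtracts the mean under \<open>\<mu>\<close> (\<open>nabla_tangent\<close>).

  Everything else follows from \<open>D (L v) u = L (D v u) - g(u, v)\<close> (\<open>hasD_score\<close>). The terms with
  \<open>D\<^sup>2 w\<close> cancel because second derivatives are symmetric (\<open>d2_symmetric\<close>), which also gives the coordinate
  \<open>D v u - D u v\<close> of the Lie bracket (\<open>lie_bracket_Pt\<close>). Of the remaining terms, the derivative of \<open>\<Gamma>\<close>
  contributes \<open>c (g(v, w) u - g(u, w) v)\<close> and the products of two \<open>\<Gamma>\<close> contribute \<open>- c\<^sup>2\<close> times the same vector;
  and \<open>c - c\<^sup>2 = (1 - \<alpha>\<^sup>2) / 4\<close> (\<open>curvature_Pt\<close>). This is invariant under \<open>\<alpha> \<mapsto> - \<alpha>\<close>.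

  The curvature does not vanish for other \<open>\<alpha>\<close> because \<open>C\<^sub>b\<^sup>k(B)\<close> contains two functions that are linearly
  independent modulo constants, so that some tangent plane has non-zero Gram determinant. They are
  the sine and the cosine of a bounded functional, which is supplied by the Hahn-Banach theorem
  (\<open>norming_functional\<close>, \<open>ex_independent_mod_constants\<close>).

  The analysis behind the chart computations is that \<open>C\<^sub>b\<^sup>k(B)\<close> is closed under products, with a
  norm that is submultiplicative up to a constant, and that \<open>exp\<close> acts on it differentiably
  (\<open>has_fderiv_exp_on\<close>). Membership is shown by exhibiting all derivatives at once, as functions of a
  list of directions (\<open>jet_mem\<close>). In this form the Leibniz rule is a recursion over the list
  (\<open>leib\<close>), and the derivatives of \<open>exp a\<close> satisfy a recursion that splits off the innermost direction
  (\<open>expj\<close>); the latter also shows that \<open>exp h - 1 - h\<close> is quadratically small in the norm of \<open>C\<^sub>b\<^sup>k(B)\<close>.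
\<close>

section \<open>Differential calculus on normed carriers\<close>

locale normed_carrier =
  fixes E :: "'v::real_vector nspace"
  assumes zero_mem [simp, intro]: "0 \<in> vecs E"
    and add_mem [simp, intro]: "x \<in> vecs E \<Longrightarrow> y \<in> vecs E \<Longrightarrow> x + y \<in> vecs E"
    and scale_mem [simp, intro]: "x \<in> vecs E \<Longrightarrow> c *\<^sub>R x \<in> vecs E"
    and nrm_triangle: "x \<in> vecs E \<Longrightarrow> y \<in> vecs E \<Longrightarrow> nrm E (x + y) \<le> nrm E x + nrm E y"
    and nrm_scale: "x \<in> vecs E \<Longrightarrow> nrm E (c *\<^sub>R x) = \<bar>c\<bar> * nrm E x"
    and nrm_definite: "x \<in> vecs E \<Longrightarrow> nrm E x = 0 \<Longrightarrow> x = 0"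
begin

lemma uminus_mem [simp, intro]: "x \<in> vecs E \<Longrightarrow> - x \<in> vecs E"
  using scale_mem[of x "-1"] by simp

lemma diff_mem [simp, intro]: "x \<in> vecs E \<Longrightarrow> y \<in> vecs E \<Longrightarrow> x - y \<in> vecs E"
  using add_mem[of x "- y"] by simp

lemma nrm_zero [simp]: "nrm E 0 = 0"
  using nrm_scale[of 0 0] by simp

lemma nrm_minus: "x \<in> vecs E \<Longrightarrow> nrm E (- x) = nrm E x"
  using nrm_scale[of x "-1"] by simp

lemma nrm_nonneg [simp]: "x \<in> vecs E \<Longrightarrow> 0 \<le> nrm E x"
  using nrm_triangle[of x "- x"] nrm_minus[of x] by simp

lemma prod_nrm_nonneg [simp]: "set hs \<subseteq> vecs E \<Longrightarrow> 0 \<le> prod_list (map (nrm E) hs)"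
  by (induction hs) auto

lemma prod_nrm_le_1:
  "set hs \<subseteq> vecs E \<Longrightarrow> (\<And>h. h \<in> set hs \<Longrightarrow> nrm E h \<le> 1) \<Longrightarrow> prod_list (map (nrm E) hs) \<le> 1"
  by (induction hs) (auto intro!: mult_le_one)

lemma nrm_triangle_diff: "x \<in> vecs E \<Longrightarrow> y \<in> vecs E \<Longrightarrow> nrm E (x - y) \<le> nrm E x + nrm E y"
  using nrm_triangle[of x "- y"] nrm_minus[of y] by simp

end

text \<open>
  One inequality suffices for homogeneity: it can be applied to \<open>c\<close> and to \<open>1 / c\<close>.
\<close>

lemma normed_carrierI:
  fixes E :: "'v::real_vector nspace"
  assumes "0 \<in> vecs E" "\<And>x y. x \<in> vecs E \<Longrightarrow> y \<in> vecs E \<Longrightarrow> x + y \<in> vecs E"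
    and scale: "\<And>x c. x \<in> vecs E \<Longrightarrow> c *\<^sub>R x \<in> vecs E"
    and tri: "\<And>x y. x \<in> vecs E \<Longrightarrow> y \<in> vecs E \<Longrightarrow> nrm E (x + y) \<le> nrm E x + nrm E y"
    and le: "\<And>x c. x \<in> vecs E \<Longrightarrow> nrm E (c *\<^sub>R x) \<le> \<bar>c\<bar> * nrm E x"
    and "\<And>x. x \<in> vecs E \<Longrightarrow> nrm E x = 0 \<Longrightarrow> x = 0"
  shows "normed_carrier E"
proof
  have zero: "nrm E 0 = 0" using le[of 0 0] tri[of 0 0] assms(1) by simp
  show "nrm E (c *\<^sub>R x) = \<bar>c\<bar> * nrm E x" if x: "x \<in> vecs E" for x c
  proof (cases "c = 0")
    case False
    have "nrm E x \<le> \<bar>1 / c\<bar> * nrm E (c *\<^sub>R x)"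
      using le[OF scale[OF x], of "1 / c" c] False by simp
    then have "\<bar>c\<bar> * nrm E x \<le> nrm E (c *\<^sub>R x)" using False by (simp add: field_simps)
    then show ?thesis using le[OF x] by (simp add: order_antisym)
  qed (simp add: zero)
qed (use assms in auto)

lemma type_space_simps [simp]: "vecs type_space = UNIV" "nrm type_space = norm"
  by (simp_all add: type_space_def)

lemma normed_carrier_type_space: "normed_carrier type_space"
  by unfold_locales (auto simp: norm_triangle_ineq)

subsection \<open>Bounded linear and multilinear maps\<close>

lemma bounded_linI:
  assumes "\<And>h. h \<in> vecs E \<Longrightarrow> A h \<in> vecs F"
    and "\<And>h h'. h \<in> vecs E \<Longrightarrow> h' \<in> vecs E \<Longrightarrow> A (h + h') = A h + A h'"
    and "\<And>c h. h \<in> vecs E \<Longrightarrow> A (c *\<^sub>R h) = c *\<^sub>R A h"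
    and "\<And>h. h \<in> vecs E \<Longrightarrow> nrm F (A h) \<le> C * nrm E h"
    and "\<And>h. h \<notin> vecs E \<Longrightarrow> A h = 0"
  shows "A \<in> bounded_lin E F"
  using assms unfolding bounded_lin_def by blast

lemma bounded_linD:
  assumes "A \<in> bounded_lin E F"
  shows "h \<in> vecs E \<Longrightarrow> A h \<in> vecs F"
    and "h \<in> vecs E \<Longrightarrow> h' \<in> vecs E \<Longrightarrow> A (h + h') = A h + A h'"
    and "h \<in> vecs E \<Longrightarrow> A (c *\<^sub>R h) = c *\<^sub>R A h"
    and "h \<notin> vecs E \<Longrightarrow> A h = 0"
  using assms unfolding bounded_lin_def by blast+

lemma bounded_lin_diff:
  assumes "normed_carrier E" "A \<in> bounded_lin E F" "h \<in> vecs E" "h' \<in> vecs E"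
  shows "A (h - h') = A h - A h'"
proof -
  interpret normed_carrier E by fact
  have "A (h + (-1) *\<^sub>R h') = A h + (-1) *\<^sub>R A h'"
    using bounded_linD[OF assms(2)] assms(3,4) scale_mem by metis
  then show ?thesis by simp
qed

lemma bounded_lin_bound:
  assumes "normed_carrier E" "A \<in> bounded_lin E F"
  obtains C where "C > 0" "\<And>h. h \<in> vecs E \<Longrightarrow> nrm F (A h) \<le> C * nrm E h"
proof -
  interpret normed_carrier E by fact
  obtain C where C: "\<And>h. h \<in> vecs E \<Longrightarrow> nrm F (A h) \<le> C * nrm E h"
    using assms(2) unfolding bounded_lin_def by blast
  have "nrm F (A h) \<le> (\<bar>C\<bar> + 1) * nrm E h" if "h \<in> vecs E" for h
    using C[OF that] mult_right_mono[of C "\<bar>C\<bar> + 1" "nrm E h"] nrm_nonneg[OF that] by linarith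
  then show thesis using that[of "\<bar>C\<bar> + 1"] by simp
qed

lemma bounded_lin_comp:
  assumes "normed_carrier E" "normed_carrier F" "normed_carrier G"
    and A: "A \<in> bounded_lin E F" and A': "A' \<in> bounded_lin F G"
  shows "(\<lambda>h. A' (A h)) \<in> bounded_lin E G"
proof -
  interpret E: normed_carrier E by fact
  interpret F: normed_carrier F by fact
  interpret G: normed_carrier G by fact
  obtain C where C: "C > 0" "\<And>h. h \<in> vecs E \<Longrightarrow> nrm F (A h) \<le> C * nrm E h"
    using bounded_lin_bound assms by blast
  obtain C' where C': "C' > 0" "\<And>h. h \<in> vecs F \<Longrightarrow> nrm G (A' h) \<le> C' * nrm F h"
    using bounded_lin_bound assms by blast
  note d = bounded_linD[OF A] bounded_linD[OF A']
  show ?thesis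
  proof (rule bounded_linI[where C = "C' * C"])
    fix h assume h: "h \<in> vecs E"
    have "nrm G (A' (A h)) \<le> C' * nrm F (A h)" using C' d h by blast
    also have "\<dots> \<le> C' * (C * nrm E h)" using C C' h by (intro mult_left_mono) auto
    finally show "nrm G (A' (A h)) \<le> C' * C * nrm E h" by simp
  next
    fix h assume "h \<notin> vecs E"
    then have "A h = 0" using d by blast
    then show "A' (A h) = 0" using d(7)[of 0 0] F.zero_mem by simp
  qed (use d in auto)
qed

lemma multilin_memI:
  assumes "\<And>hs. length hs = i \<Longrightarrow> set hs \<subseteq> vecs E \<Longrightarrow> T hs \<in> vecs F"
    and "\<And>us vs h h'. h \<in> vecs E \<Longrightarrow> h' \<in> vecs E \<Longrightarrow> length us + 1 + length vs = i \<Longrightarrow>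
      set us \<subseteq> vecs E \<Longrightarrow> set vs \<subseteq> vecs E \<Longrightarrow>
      T (us @ (h + h') # vs) = T (us @ h # vs) + T (us @ h' # vs)"
    and "\<And>us vs h c. h \<in> vecs E \<Longrightarrow> length us + 1 + length vs = i \<Longrightarrow>
      set us \<subseteq> vecs E \<Longrightarrow> set vs \<subseteq> vecs E \<Longrightarrow> T (us @ (c *\<^sub>R h) # vs) = c *\<^sub>R T (us @ h # vs)"
    and "\<And>hs. length hs = i \<Longrightarrow> set hs \<subseteq> vecs E \<Longrightarrow> nrm F (T hs) \<le> C * prod_list (map (nrm E) hs)"
    and "\<And>hs. \<not> (length hs = i \<and> set hs \<subseteq> vecs E) \<Longrightarrow> T hs = 0"
  shows "T \<in> vecs (multilin i E F)"
  using assms unfolding multilin_def by simp blast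

lemma multilin_memD:
  assumes "T \<in> vecs (multilin i E F)"
  shows "length hs = i \<Longrightarrow> set hs \<subseteq> vecs E \<Longrightarrow> T hs \<in> vecs F"
    and "h \<in> vecs E \<Longrightarrow> h' \<in> vecs E \<Longrightarrow> length us + 1 + length vs = i \<Longrightarrow>
      set us \<subseteq> vecs E \<Longrightarrow> set vs \<subseteq> vecs E \<Longrightarrow>
      T (us @ (h + h') # vs) = T (us @ h # vs) + T (us @ h' # vs)"
    and "h \<in> vecs E \<Longrightarrow> length us + 1 + length vs = i \<Longrightarrow>
      set us \<subseteq> vecs E \<Longrightarrow> set vs \<subseteq> vecs E \<Longrightarrow> T (us @ (c *\<^sub>R h) # vs) = c *\<^sub>R T (us @ h # vs)"
    and "\<exists>C. \<forall>hs. length hs = i \<and> set hs \<subseteq> vecs E \<longrightarrow> nrm F (T hs) \<le> C * prod_list (map (nrm E) hs)"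
    and "\<not> (length hs = i \<and> set hs \<subseteq> vecs E) \<Longrightarrow> T hs = 0"
  using assms unfolding multilin_def by simp_all

lemma multilin_bdd:
  assumes "normed_carrier E" "T \<in> vecs (multilin i E F)"
  shows "bdd_above ((\<lambda>hs. nrm F (T hs)) ` {hs. length hs = i \<and> set hs \<subseteq> {h \<in> vecs E. nrm E h \<le> 1}})"
proof -
  interpret normed_carrier E by fact
  obtain C where C: "\<And>hs. length hs = i \<Longrightarrow> set hs \<subseteq> vecs E \<Longrightarrow> nrm F (T hs) \<le> C * prod_list (map (nrm E) hs)"
    using multilin_memD(4)[OF assms(2)] by blast
  have "nrm F (T hs) \<le> \<bar>C\<bar>" if "length hs = i" "set hs \<subseteq> {h \<in> vecs E. nrm E h \<le> 1}" for hs
  proof -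
    have p: "0 \<le> prod_list (map (nrm E) hs)" "prod_list (map (nrm E) hs) \<le> 1"
      using that by (auto intro!: prod_nrm_nonneg prod_nrm_le_1)
    have "nrm F (T hs) \<le> C * prod_list (map (nrm E) hs)" using C that by blast
    also have "\<dots> \<le> \<bar>C\<bar> * 1" using p by (intro mult_mono) auto
    finally show ?thesis by simp
  qed
  then show ?thesis by (intro bdd_aboveI2[where M = "\<bar>C\<bar>"]) auto
qed

lemma multilin_nrm_le:
  assumes "normed_carrier E"
    and "\<And>hs. length hs = i \<Longrightarrow> set hs \<subseteq> vecs E \<Longrightarrow> (\<And>h. h \<in> set hs \<Longrightarrow> nrm E h \<le> 1) \<Longrightarrow> nrm F (T hs) \<le> C"
  shows "nrm (multilin i E F) T \<le> C"
proof -
  interpret normed_carrier E by fact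
  have "replicate i 0 \<in> {hs. length hs = i \<and> set hs \<subseteq> {h \<in> vecs E. nrm E h \<le> 1}}" by auto
  then have "{hs. length hs = i \<and> set hs \<subseteq> {h \<in> vecs E. nrm E h \<le> 1}} \<noteq> {}" by blast
  then have "(SUP hs\<in>{hs. length hs = i \<and> set hs \<subseteq> {h \<in> vecs E. nrm E h \<le> 1}}. nrm F (T hs)) \<le> C"
    by (rule cSUP_least) (auto intro!: assms(2))
  then show ?thesis unfolding multilin_def by simp
qed

lemma multilin_nrm_ge:
  assumes "normed_carrier E" "T \<in> vecs (multilin i E F)" "length hs = i" "set hs \<subseteq> vecs E"
    "\<And>h. h \<in> set hs \<Longrightarrow> nrm E h \<le> 1"
  shows "nrm F (T hs) \<le> nrm (multilin i E F) T"
  using multilin_bdd[OF assms(1,2)] assms(3-5) unfolding multilin_def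
  by simp (rule cSUP_upper, auto)

text \<open>
  The prefix \<open>us\<close> collects the arguments that the induction has already treated.
\<close>

lemma multilin_scale_map:
  assumes "T \<in> vecs (multilin i E F)" "normed_carrier E"
  shows "length us + length hs = i \<Longrightarrow> set us \<subseteq> vecs E \<Longrightarrow> u ` set hs \<subseteq> vecs E \<Longrightarrow>
    T (us @ map (\<lambda>h. c h *\<^sub>R u h) hs) = prod_list (map c hs) *\<^sub>R T (us @ map u hs)"
proof (induction hs arbitrary: us)
  case (Cons h hs)
  interpret normed_carrier E by fact
  have "T (us @ map (\<lambda>h. c h *\<^sub>R u h) (h # hs)) = T ((us @ [c h *\<^sub>R u h]) @ map (\<lambda>h. c h *\<^sub>R u h) hs)" by simp
  also have "\<dots> = prod_list (map c hs) *\<^sub>R T ((us @ [c h *\<^sub>R u h]) @ map u hs)"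
    using Cons.prems by (intro Cons.IH) auto
  also have "T ((us @ [c h *\<^sub>R u h]) @ map u hs) = T (us @ (c h *\<^sub>R u h) # map u hs)" by simp
  also have "\<dots> = c h *\<^sub>R T (us @ u h # map u hs)"
    using Cons.prems by (intro multilin_memD(3)[OF assms(1)]) auto
  finally show ?case by (simp add: mult.commute)
qed simp

text \<open>Scaling every argument to the unit ball turns the supremum into the multiplicative bound.\<close>

lemma multilin_apply_le:
  assumes "normed_carrier E" "normed_carrier F" "T \<in> vecs (multilin i E F)"
    "length hs = i" "set hs \<subseteq> vecs E"
  shows "nrm F (T hs) \<le> nrm (multilin i E F) T * prod_list (map (nrm E) hs)"
proof -
  interpret E: normed_carrier E by fact
  interpret F: normed_carrier F by fact
  define u where "u h = (1 / nrm E h) *\<^sub>R h" for h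
  have hu: "h = nrm E h *\<^sub>R u h" if "h \<in> vecs E" for h
    using E.nrm_definite[OF that] by (cases "nrm E h = 0") (auto simp: u_def)
  have u1: "nrm E (u h) \<le> 1" if "h \<in> vecs E" for h
    using E.nrm_nonneg[OF that] E.nrm_scale[OF that] by (auto simp: u_def)
  have mem: "u ` set hs \<subseteq> vecs E" using assms(5) by (auto simp: u_def)
  have "T hs = T (map (\<lambda>h. nrm E h *\<^sub>R u h) hs)"
    using hu assms(5) by (metis (no_types, lifting) map_idI subsetD)
  also have "\<dots> = prod_list (map (nrm E) hs) *\<^sub>R T (map u hs)"
    using multilin_scale_map[OF assms(3,1), of "[]" hs u "nrm E"] assms(4) mem by simp
  finally have e: "T hs = prod_list (map (nrm E) hs) *\<^sub>R T (map u hs)" .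
  have m: "T (map u hs) \<in> vecs F" using multilin_memD(1)[OF assms(3)] assms(4) mem by simp
  have p: "0 \<le> prod_list (map (nrm E) hs)"
    using assms(5) by (induction hs) auto
  have "nrm F (T (map u hs)) \<le> nrm (multilin i E F) T"
    using multilin_nrm_ge[OF assms(1,3), of "map u hs"] assms(4,5) mem u1 by auto
  then show ?thesis using F.nrm_scale[OF m] p unfolding e by (simp add: mult.commute mult_left_mono)
qed

lemma normed_carrier_multilin:
  assumes "normed_carrier E" "normed_carrier F"
  shows "normed_carrier (multilin i E F)"
proof -
  interpret E: normed_carrier E by fact
  interpret F: normed_carrier F by fact
  let ?M = "multilin i E F"
  have add: "x + y \<in> vecs ?M" if x: "x \<in> vecs ?M" and y: "y \<in> vecs ?M" for x y
  proof (rule multilin_memI[where C = "nrm ?M x + nrm ?M y"])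
    fix hs assume hs: "length hs = i" "set hs \<subseteq> vecs E"
    show "nrm F ((x + y) hs) \<le> (nrm ?M x + nrm ?M y) * prod_list (map (nrm E) hs)"
      using multilin_apply_le[OF assms x hs] multilin_apply_le[OF assms y hs]
        F.nrm_triangle[OF multilin_memD(1)[OF x hs] multilin_memD(1)[OF y hs]]
      by (simp add: distrib_right)
  qed (simp_all add: multilin_memD(1-3,5)[OF x] multilin_memD(1-3,5)[OF y] scaleR_add_right)
  have scale: "c *\<^sub>R x \<in> vecs ?M" if x: "x \<in> vecs ?M" for x c
  proof (rule multilin_memI[where C = "\<bar>c\<bar> * nrm ?M x"])
    fix hs assume hs: "length hs = i" "set hs \<subseteq> vecs E"
    show "nrm F ((c *\<^sub>R x) hs) \<le> (\<bar>c\<bar> * nrm ?M x) * prod_list (map (nrm E) hs)"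
      using multilin_apply_le[OF assms x hs] F.nrm_scale[OF multilin_memD(1)[OF x hs]]
      by (simp add: scaleR_fun_def mult.assoc mult_left_mono)
  qed (simp_all add: multilin_memD(1-3,5)[OF x] scaleR_fun_def scaleR_add_right)
  have zero: "0 \<in> vecs ?M" by (rule multilin_memI[where C = 0]) auto
  have tri: "nrm ?M (x + y) \<le> nrm ?M x + nrm ?M y" if x: "x \<in> vecs ?M" and y: "y \<in> vecs ?M" for x y
  proof (rule multilin_nrm_le[OF assms(1)])
    fix hs assume hs: "length hs = i" "set hs \<subseteq> vecs E" "\<And>h. h \<in> set hs \<Longrightarrow> nrm E h \<le> 1"
    show "nrm F ((x + y) hs) \<le> nrm ?M x + nrm ?M y"
      using multilin_nrm_ge[OF assms(1) x hs] multilin_nrm_ge[OF assms(1) y hs]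
        F.nrm_triangle[OF multilin_memD(1)[OF x hs(1,2)] multilin_memD(1)[OF y hs(1,2)]] by simp
  qed
  have sc: "nrm ?M (c *\<^sub>R x) \<le> \<bar>c\<bar> * nrm ?M x" if x: "x \<in> vecs ?M" for x c
  proof (rule multilin_nrm_le[OF assms(1)])
    fix hs assume hs: "length hs = i" "set hs \<subseteq> vecs E" "\<And>h. h \<in> set hs \<Longrightarrow> nrm E h \<le> 1"
    show "nrm F ((c *\<^sub>R x) hs) \<le> \<bar>c\<bar> * nrm ?M x"
      using multilin_nrm_ge[OF assms(1) x hs] F.nrm_scale[OF multilin_memD(1)[OF x hs(1,2)]]
      by (simp add: scaleR_fun_def mult_left_mono)
  qed
  have def: "x = 0" if x: "x \<in> vecs ?M" and "nrm ?M x = 0" for x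
  proof
    fix hs
    show "x hs = 0 hs"
    proof (cases "length hs = i \<and> set hs \<subseteq> vecs E")
      case True
      then show ?thesis
        using multilin_apply_le[OF assms x, of hs] that(2) multilin_memD(1)[OF x, of hs]
          F.nrm_nonneg F.nrm_definite by (simp add: order_antisym)
    qed (use multilin_memD(5)[OF x] in auto)
  qed
  show ?thesis by (rule normed_carrierI) (use add scale zero tri sc def in auto)
qed

text \<open>
  This and \<open>curry_bounded_lin\<close> are the two directions of \<open>L(E; L(E\<^sup>i; F)) = L(E\<^sup>i\<^sup>+\<^sup>1; F)\<close>, the
  identification by which iterated derivatives are multilinear maps.
\<close>

lemma uncurry_bounded_lin:
  assumes "normed_carrier E" "normed_carrier F" and A: "A \<in> bounded_lin E (multilin i E F)"
  shows "(\<lambda>hs. case hs of [] \<Rightarrow> 0 | h # t \<Rightarrow> A h t) \<in> vecs (multilin (Suc i) E F)" (is "?T \<in> _")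
proof -
  interpret E: normed_carrier E by fact
  interpret F: normed_carrier F by fact
  note d = bounded_linD[OF A]
  obtain C where C: "C > 0" "\<And>h. h \<in> vecs E \<Longrightarrow> nrm (multilin i E F) (A h) \<le> C * nrm E h"
    using bounded_lin_bound[OF assms(1) A] by blast
  note m = multilin_memD[OF d(1)]
  show ?thesis
  proof (rule multilin_memI[where C = C])
    fix hs assume hs: "length hs = Suc i" "set hs \<subseteq> vecs E"
    then obtain h t where ht: "hs = h # t" "h \<in> vecs E" "length t = i" "set t \<subseteq> vecs E" by (cases hs) auto
    show "?T hs \<in> vecs F" using ht m(1) by simp
    have p: "0 \<le> prod_list (map (nrm E) t)" using ht(4) by (induction t) auto
    have "nrm F (A h t) \<le> nrm (multilin i E F) (A h) * prod_list (map (nrm E) t)"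
      using multilin_apply_le[OF assms(1,2) d(1)] ht by blast
    also have "\<dots> \<le> (C * nrm E h) * prod_list (map (nrm E) t)"
      using C ht p by (intro mult_right_mono) auto
    finally show "nrm F (?T hs) \<le> C * prod_list (map (nrm E) hs)" using ht by (simp add: mult.assoc)
  next
    fix us vs h h' assume *: "h \<in> vecs E" "h' \<in> vecs E" "length us + 1 + length vs = Suc i"
      "set us \<subseteq> vecs E" "set vs \<subseteq> vecs E"
    show "?T (us @ (h + h') # vs) = ?T (us @ h # vs) + ?T (us @ h' # vs)"
      using * d(2) m(2) by (cases us) auto
  next
    fix us vs h c assume *: "h \<in> vecs E" "length us + 1 + length vs = Suc i"
      "set us \<subseteq> vecs E" "set vs \<subseteq> vecs E"
    show "?T (us @ (c *\<^sub>R h) # vs) = c *\<^sub>R ?T (us @ h # vs)"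
      using * d(3) m(3) by (cases us) (auto simp: scaleR_fun_def)
  next
    fix hs assume "\<not> (length hs = Suc i \<and> set hs \<subseteq> vecs E)"
    then show "?T hs = 0"
      using m(5)[of "hd hs" "tl hs"] d(4)[of "hd hs"]
      by (cases hs; cases "hd hs \<in> vecs E") auto
  qed
qed

lemma curry_bounded_lin:
  assumes "normed_carrier E" "normed_carrier F" and T: "T \<in> vecs (multilin (Suc i) E F)"
  shows "(\<lambda>h t. T (h # t)) \<in> bounded_lin E (multilin i E F)"
proof -
  interpret E: normed_carrier E by fact
  interpret F: normed_carrier F by fact
  interpret M: normed_carrier "multilin (Suc i) E F" by (rule normed_carrier_multilin[OF assms(1,2)])
  note m = multilin_memD[OF T]
  define C where "C = nrm (multilin (Suc i) E F) T"
  have C0: "C \<ge> 0" unfolding C_def using T by simp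
  have b: "nrm F (T (h # t)) \<le> C * nrm E h * prod_list (map (nrm E) t)"
    if "h \<in> vecs E" "length t = i" "set t \<subseteq> vecs E" for h t
    using multilin_apply_le[OF assms, of "h # t"] that by (simp add: C_def mult.assoc)
  show ?thesis
  proof (rule bounded_linI[where C = C])
    fix h assume h: "h \<in> vecs E"
    show "(\<lambda>t. T (h # t)) \<in> vecs (multilin i E F)"
    proof (rule multilin_memI[where C = "C * nrm E h"])
      show "T (h # us @ (g + g') # vs) = T (h # us @ g # vs) + T (h # us @ g' # vs)"
        if "g \<in> vecs E" "g' \<in> vecs E" "length us + 1 + length vs = i" "set us \<subseteq> vecs E" "set vs \<subseteq> vecs E"
        for us vs g g'
        using m(2)[of g g' "h # us" vs] that h by simp
      show "T (h # us @ (c *\<^sub>R g) # vs) = c *\<^sub>R T (h # us @ g # vs)"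
        if "g \<in> vecs E" "length us + 1 + length vs = i" "set us \<subseteq> vecs E" "set vs \<subseteq> vecs E"
        for us vs g c
        using m(3)[of g "h # us" vs] that h by simp
    qed (use h in \<open>auto intro!: m(1,5) b\<close>)
    show "nrm (multilin i E F) (\<lambda>t. T (h # t)) \<le> C * nrm E h"
    proof (rule multilin_nrm_le[OF assms(1)])
      fix hs assume hs: "length hs = i" "set hs \<subseteq> vecs E" "\<And>g. g \<in> set hs \<Longrightarrow> nrm E g \<le> 1"
      have p: "0 \<le> prod_list (map (nrm E) hs)" "prod_list (map (nrm E) hs) \<le> 1"
        using hs E.prod_nrm_le_1 by auto
      have "C * nrm E h * prod_list (map (nrm E) hs) \<le> C * nrm E h * 1"
        using p C0 h by (intro mult_left_mono) auto
      then show "nrm F (T (h # hs)) \<le> C * nrm E h" using b[OF h hs(1,2)] by simp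
    qed
  next
    fix h h' assume h: "h \<in> vecs E" "h' \<in> vecs E"
    show "(\<lambda>t. T ((h + h') # t)) = (\<lambda>t. T (h # t)) + (\<lambda>t. T (h' # t))"
    proof
      fix t show "T ((h + h') # t) = ((\<lambda>t. T (h # t)) + (\<lambda>t. T (h' # t))) t"
        using m(2)[of h h' "[]" t] h m(5)[of "_ # t"] by (cases "length t = i \<and> set t \<subseteq> vecs E") auto
    qed
  next
    fix c h assume h: "h \<in> vecs E"
    show "(\<lambda>t. T ((c *\<^sub>R h) # t)) = c *\<^sub>R (\<lambda>t. T (h # t))"
    proof
      fix t show "T ((c *\<^sub>R h) # t) = (c *\<^sub>R (\<lambda>t. T (h # t))) t"
        using m(3)[of h "[]" t] h m(5)[of "_ # t"]
        by (cases "length t = i \<and> set t \<subseteq> vecs E") (auto simp: scaleR_fun_def)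
    qed
  next
    fix h assume "h \<notin> vecs E"
    then show "(\<lambda>t. T (h # t)) = 0" using m(5)[of "h # _"] by auto
  qed
qed

subsection \<open>Rules for derivatives\<close>

text \<open>
  Approach along every ray is all that uniqueness of the derivative within \<open>S\<close> uses. It holds
  for open sets as well as for a whole carrier.
\<close>

definition inner_point :: "'v::real_vector nspace \<Rightarrow> 'v set \<Rightarrow> 'v \<Rightarrow> bool"
  where "inner_point E S x \<longleftrightarrow> x \<in> S \<and> S \<subseteq> vecs E \<and>
    (\<forall>h\<in>vecs E. \<exists>t0>0. \<forall>t. 0 < t \<and> t < t0 \<longrightarrow> x + t *\<^sub>R h \<in> S)"

lemma inner_point_vecs:
  assumes "normed_carrier E" "x \<in> vecs E"
  shows "inner_point E (vecs E) x"
proof -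
  interpret normed_carrier E by fact
  show ?thesis using assms(2) unfolding inner_point_def by (auto intro: exI[of _ 1])
qed

lemma inner_point_open:
  fixes S :: "'a::real_normed_vector set"
  assumes "open S" "x \<in> S"
  shows "inner_point type_space S x"
proof -
  obtain e where e: "e > 0" "ball x e \<subseteq> S" using assms open_contains_ball by blast
  have "\<exists>t0>0. \<forall>t. 0 < t \<and> t < t0 \<longrightarrow> x + t *\<^sub>R h \<in> S" for h
  proof (intro exI conjI allI impI)
    show "e / (norm h + 1) > 0" using e by (simp add: add_nonneg_pos)
    fix t assume t: "0 < t \<and> t < e / (norm h + 1)"
    then have "t * (norm h + 1) < e" using pos_less_divide_eq[of "norm h + 1" t e]
      by (simp add: add_nonneg_pos)
    then have "dist x (x + t *\<^sub>R h) < e" using t by (simp add: dist_norm distrib_left)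
    then show "x + t *\<^sub>R h \<in> S" using e by auto
  qed
  then show ?thesis using assms unfolding inner_point_def by simp
qed

lemma has_fderivD:
  assumes "has_fderiv E F S f A x"
  shows "A \<in> bounded_lin E F"
    and "e > 0 \<Longrightarrow> \<exists>d>0. \<forall>y\<in>S. nrm E (y - x) < d \<longrightarrow> nrm F (f y - f x - A (y - x)) \<le> e * nrm E (y - x)"
  using assms unfolding has_fderiv_def by auto

lemma has_fderivI:
  assumes "A \<in> bounded_lin E F"
    and "\<And>e. e > 0 \<Longrightarrow> \<exists>d>0. \<forall>y\<in>S. nrm E (y - x) < d \<longrightarrow> nrm F (f y - f x - A (y - x)) \<le> e * nrm E (y - x)"
  shows "has_fderiv E F S f A x"
  using assms unfolding has_fderiv_def by auto

text \<open>
  Along the ray in direction \<open>h\<close> both \<open>A (t h)\<close> and \<open>A' (t h)\<close> approximate the same increment up to \<open>o(t)\<close>.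
\<close>

lemma has_fderiv_unique:
  assumes "normed_carrier E" "normed_carrier F" "inner_point E S x"
    and f: "\<And>y. y \<in> S \<Longrightarrow> f y \<in> vecs F"
    and A: "has_fderiv E F S f A x" and A': "has_fderiv E F S f A' x"
  shows "A = A'"
proof
  interpret E: normed_carrier E by fact
  interpret F: normed_carrier F by fact
  note a = bounded_linD[OF has_fderivD(1)[OF A]] and a' = bounded_linD[OF has_fderivD(1)[OF A']]
  have x: "x \<in> S" "S \<subseteq> vecs E" using assms(3) unfolding inner_point_def by auto
  fix h
  show "A h = A' h"
  proof (cases "h \<in> vecs E")
    case h: True
    have m: "A h - A' h \<in> vecs F" using a(1) a'(1) h by auto
    have le: "nrm F (A h - A' h) \<le> 2 * e * nrm E h" if e: "e > 0" for e
    proof -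
      obtain d where d: "d > 0" "\<And>y. y \<in> S \<Longrightarrow> nrm E (y - x) < d \<Longrightarrow> nrm F (f y - f x - A (y - x)) \<le> e * nrm E (y - x)"
        using has_fderivD(2)[OF A e] by blast
      obtain d' where d': "d' > 0" "\<And>y. y \<in> S \<Longrightarrow> nrm E (y - x) < d' \<Longrightarrow> nrm F (f y - f x - A' (y - x)) \<le> e * nrm E (y - x)"
        using has_fderivD(2)[OF A' e] by blast
      obtain t0 where t0: "t0 > 0" "\<And>t. 0 < t \<Longrightarrow> t < t0 \<Longrightarrow> x + t *\<^sub>R h \<in> S"
        using assms(3) h unfolding inner_point_def by blast
      define n where "n = nrm E h + 1"
      have n: "n > 0" using h by (simp add: n_def add_nonneg_pos)
      define t where "t = min (t0 / 2) (min d d' / (2 * n))"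
      have t: "0 < t" "t < t0" using t0 d d' n by (auto simp: t_def min_def)
      have "t \<le> min d d' / (2 * n)" unfolding t_def by simp
      then have "t * n \<le> min d d' / 2" using n by (simp add: field_simps)
      moreover have "t * nrm E h \<le> t * n" using t by (simp add: n_def)
      ultimately have tn: "t * nrm E h < d" "t * nrm E h < d'" using d(1) d'(1) by auto
      let ?y = "x + t *\<^sub>R h"
      have y: "?y \<in> S" using t0 t by blast
      have "?y - x = t *\<^sub>R h" by simp
      then have n2: "nrm E (?y - x) = t * nrm E h" using E.nrm_scale[OF h] t by simp
      have mm: "f ?y - f x - A (t *\<^sub>R h) \<in> vecs F" "f ?y - f x - A' (t *\<^sub>R h) \<in> vecs F"
        using f y x a(1) a'(1) h by auto
      have "t * nrm F (A h - A' h) = nrm F (t *\<^sub>R (A h - A' h))" using F.nrm_scale[OF m] t by simp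
      also have "t *\<^sub>R (A h - A' h) = (f ?y - f x - A' (t *\<^sub>R h)) - (f ?y - f x - A (t *\<^sub>R h))"
        using a(3) a'(3) h by (simp add: scaleR_diff_right)
      also have "nrm F \<dots> \<le> nrm F (f ?y - f x - A' (t *\<^sub>R h)) + nrm F (f ?y - f x - A (t *\<^sub>R h))"
        using F.nrm_triangle_diff mm by blast
      also have "\<dots> \<le> e * (t * nrm E h) + e * (t * nrm E h)"
        using d(2)[OF y] d'(2)[OF y] n2 tn by (intro add_mono) simp_all
      also have "\<dots> = t * (2 * e * nrm E h)" by simp
      finally show ?thesis using t by simp
    qed
    have "nrm F (A h - A' h) \<le> 0"
    proof (rule field_le_epsilon)
      fix e :: real assume e: "e > 0"
      have "2 * (e / (2 * (nrm E h + 1))) * nrm E h \<le> e"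
        using e E.nrm_nonneg[OF h] by (simp add: field_simps)
      then show "nrm F (A h - A' h) \<le> 0 + e" using le[of "e / (2 * (nrm E h + 1))"] e E.nrm_nonneg[OF h]
        by (simp add: add_nonneg_pos)
    qed
    then show ?thesis using F.nrm_definite[OF m] F.nrm_nonneg[OF m] by simp
  qed (use a a' in auto)
qed

lemma fderiv_eq:
  assumes "normed_carrier E" "normed_carrier F" "inner_point E S x"
    and "\<And>y. y \<in> S \<Longrightarrow> f y \<in> vecs F" and "has_fderiv E F S f A x"
  shows "fderiv E F S f x = A"
  unfolding fderiv_def using has_fderiv_unique[OF assms(1-4)] assms(5) by (intro the_equality) blast+

lemma has_fderiv_cong:
  assumes "\<And>y. y \<in> S \<Longrightarrow> f y = g y" "x \<in> S"
  shows "has_fderiv E F S f A x = has_fderiv E F S g A x"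
  using assms unfolding has_fderiv_def by simp

lemma fderiv_cong:
  assumes "\<And>y. y \<in> S \<Longrightarrow> f y = g y" "x \<in> S"
  shows "fderiv E F S f x = fderiv E F S g x"
  unfolding fderiv_def using has_fderiv_cong[OF assms] by simp

text \<open>
  This absorbs the higher-order terms of the chain and product rules.
\<close>

lemma has_fderiv_lipschitz:
  assumes "normed_carrier E" "normed_carrier F" "S \<subseteq> vecs E" "x \<in> S"
    and f: "\<And>y. y \<in> S \<Longrightarrow> f y \<in> vecs F"
    and A: "has_fderiv E F S f A x"
  obtains M d where "M > 0" "d > 0"
    "\<And>y. y \<in> S \<Longrightarrow> nrm E (y - x) < d \<Longrightarrow> nrm F (f y - f x) \<le> M * nrm E (y - x)"
proof -
  interpret E: normed_carrier E by fact
  interpret F: normed_carrier F by fact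
  note a = bounded_linD[OF has_fderivD(1)[OF A]]
  obtain C where C: "C > 0" "\<And>h. h \<in> vecs E \<Longrightarrow> nrm F (A h) \<le> C * nrm E h"
    using bounded_lin_bound[OF assms(1) has_fderivD(1)[OF A]] by blast
  obtain d where d: "d > 0" "\<And>y. y \<in> S \<Longrightarrow> nrm E (y - x) < d \<Longrightarrow> nrm F (f y - f x - A (y - x)) \<le> 1 * nrm E (y - x)"
    using has_fderivD(2)[OF A, of 1] by auto
  have "nrm F (f y - f x) \<le> (C + 1) * nrm E (y - x)" if y: "y \<in> S" "nrm E (y - x) < d" for y
  proof -
    have yx: "y - x \<in> vecs E" using y assms(3,4) by auto
    have m: "f y - f x - A (y - x) \<in> vecs F" "A (y - x) \<in> vecs F" using f y assms(4) a(1) yx by auto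
    have "nrm F (f y - f x) = nrm F ((f y - f x - A (y - x)) + A (y - x))" by simp
    also have "\<dots> \<le> nrm F (f y - f x - A (y - x)) + nrm F (A (y - x))" using F.nrm_triangle m by blast
    also have "\<dots> \<le> 1 * nrm E (y - x) + C * nrm E (y - x)" using d(2)[OF y] C(2)[OF yx] by simp
    finally show ?thesis by (simp add: algebra_simps)
  qed
  then show thesis using that[of "C + 1" d] C d by simp
qed

lemma has_fderiv_const:
  assumes "normed_carrier E" "normed_carrier F" "S \<subseteq> vecs E" "x \<in> S"
  shows "has_fderiv E F S (\<lambda>_. c) (\<lambda>_. 0) x"
proof -
  interpret E: normed_carrier E by fact
  interpret F: normed_carrier F by fact
  show ?thesis
  proof (rule has_fderivI)
    show "(\<lambda>_. 0) \<in> bounded_lin E F" by (rule bounded_linI[where C = 0]) auto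
    show "\<exists>d>0. \<forall>y\<in>S. nrm E (y - x) < d \<longrightarrow> nrm F (c - c - 0) \<le> e * nrm E (y - x)" if "e > 0" for e
      using that assms(3,4) by (intro exI[of _ 1]) (auto intro!: mult_nonneg_nonneg E.nrm_nonneg)
  qed
qed

lemma has_fderiv_bounded_lin:
  assumes "normed_carrier E" "normed_carrier F" "S \<subseteq> vecs E" "x \<in> S" "A \<in> bounded_lin E F"
  shows "has_fderiv E F S A A x"
proof -
  interpret E: normed_carrier E by fact
  interpret F: normed_carrier F by fact
  show ?thesis
  proof (rule has_fderivI[OF assms(5)])
    show "\<exists>d>0. \<forall>y\<in>S. nrm E (y - x) < d \<longrightarrow> nrm F (A y - A x - A (y - x)) \<le> e * nrm E (y - x)" if "e > 0" for e
      using that assms bounded_lin_diff[OF assms(1,5)]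
      by (intro exI[of _ 1]) (auto simp: subset_iff intro!: mult_nonneg_nonneg E.nrm_nonneg)
  qed
qed

lemma has_fderiv_add:
  assumes "normed_carrier E" "normed_carrier F" "S \<subseteq> vecs E" "x \<in> S"
    and f: "\<And>y. y \<in> S \<Longrightarrow> f y \<in> vecs F" and g: "\<And>y. y \<in> S \<Longrightarrow> g y \<in> vecs F"
    and A: "has_fderiv E F S f A x" and B: "has_fderiv E F S g B x"
  shows "has_fderiv E F S (\<lambda>y. f y + g y) (\<lambda>h. A h + B h) x"
proof -
  interpret E: normed_carrier E by fact
  interpret F: normed_carrier F by fact
  note a = bounded_linD[OF has_fderivD(1)[OF A]] and b = bounded_linD[OF has_fderivD(1)[OF B]]
  obtain C where C: "C > 0" "\<And>h. h \<in> vecs E \<Longrightarrow> nrm F (A h) \<le> C * nrm E h"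
    using bounded_lin_bound[OF assms(1) has_fderivD(1)[OF A]] by blast
  obtain C' where C': "C' > 0" "\<And>h. h \<in> vecs E \<Longrightarrow> nrm F (B h) \<le> C' * nrm E h"
    using bounded_lin_bound[OF assms(1) has_fderivD(1)[OF B]] by blast
  show ?thesis
  proof (rule has_fderivI)
    show "(\<lambda>h. A h + B h) \<in> bounded_lin E F"
    proof (rule bounded_linI[where C = "C + C'"])
      fix h assume h: "h \<in> vecs E"
      show "nrm F (A h + B h) \<le> (C + C') * nrm E h"
        using F.nrm_triangle[OF a(1)[OF h] b(1)[OF h]] C(2)[OF h] C'(2)[OF h] by (simp add: distrib_right)
    qed (use a b in \<open>auto simp: scaleR_add_right\<close>)
    fix e :: real assume e: "e > 0"
    obtain d where d: "d > 0" "\<And>y. y \<in> S \<Longrightarrow> nrm E (y - x) < d \<Longrightarrow> nrm F (f y - f x - A (y - x)) \<le> e / 2 * nrm E (y - x)"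
      using has_fderivD(2)[OF A, of "e / 2"] e by auto
    obtain d' where d': "d' > 0" "\<And>y. y \<in> S \<Longrightarrow> nrm E (y - x) < d' \<Longrightarrow> nrm F (g y - g x - B (y - x)) \<le> e / 2 * nrm E (y - x)"
      using has_fderivD(2)[OF B, of "e / 2"] e by auto
    show "\<exists>d>0. \<forall>y\<in>S. nrm E (y - x) < d \<longrightarrow>
      nrm F (f y + g y - (f x + g x) - (A (y - x) + B (y - x))) \<le> e * nrm E (y - x)"
    proof (intro exI[of _ "min d d'"] conjI ballI impI)
      fix y assume y: "y \<in> S" "nrm E (y - x) < min d d'"
      have yx: "y - x \<in> vecs E" using y assms(3,4) by auto
      have m: "f y - f x - A (y - x) \<in> vecs F" "g y - g x - B (y - x) \<in> vecs F"
        using f g y assms(4) a(1) b(1) yx by auto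
      have eq: "f y + g y - (f x + g x) - (A (y - x) + B (y - x)) = (f y - f x - A (y - x)) + (g y - g x - B (y - x))"
        by simp
      then show "nrm F (f y + g y - (f x + g x) - (A (y - x) + B (y - x))) \<le> e * nrm E (y - x)"
        unfolding eq using F.nrm_triangle[OF m] d(2)[OF y(1)] d'(2)[OF y(1)] y(2) by simp
    qed (use d d' in auto)
  qed
qed

lemma has_fderiv_chain:
  assumes "normed_carrier E" "normed_carrier F" "normed_carrier G"
    and S: "S \<subseteq> vecs E" "x \<in> S" and T: "T \<subseteq> vecs F"
    and f: "\<And>y. y \<in> S \<Longrightarrow> f y \<in> T" and g: "\<And>y. y \<in> T \<Longrightarrow> g y \<in> vecs G"
    and A: "has_fderiv E F S f A x" and B: "has_fderiv F G T g B (f x)"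
  shows "has_fderiv E G S (\<lambda>y. g (f y)) (\<lambda>h. B (A h)) x"
proof -
  interpret E: normed_carrier E by fact
  interpret F: normed_carrier F by fact
  interpret G: normed_carrier G by fact
  have fF: "f y \<in> vecs F" if "y \<in> S" for y using f T that by blast
  note a = bounded_linD[OF has_fderivD(1)[OF A]] and b = bounded_linD[OF has_fderivD(1)[OF B]]
  obtain C where C: "C > 0" "\<And>h. h \<in> vecs F \<Longrightarrow> nrm G (B h) \<le> C * nrm F h"
    using bounded_lin_bound[OF assms(2) has_fderivD(1)[OF B]] by blast
  obtain M d0 where M: "M > 0" "d0 > 0"
    "\<And>y. y \<in> S \<Longrightarrow> nrm E (y - x) < d0 \<Longrightarrow> nrm F (f y - f x) \<le> M * nrm E (y - x)"
    using has_fderiv_lipschitz[OF assms(1,2) S fF A] by blast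
  show ?thesis
  proof (rule has_fderivI)
    show "(\<lambda>h. B (A h)) \<in> bounded_lin E G"
      using bounded_lin_comp[OF assms(1-3) has_fderivD(1)[OF A] has_fderivD(1)[OF B]] .
    fix e :: real assume e: "e > 0"
    obtain d where d: "d > 0" "\<And>y. y \<in> S \<Longrightarrow> nrm E (y - x) < d \<Longrightarrow> nrm F (f y - f x - A (y - x)) \<le> e / (2 * C) * nrm E (y - x)"
      using has_fderivD(2)[OF A, of "e / (2 * C)"] e C(1) by auto
    obtain d' where d': "d' > 0" "\<And>z. z \<in> T \<Longrightarrow> nrm F (z - f x) < d' \<Longrightarrow> nrm G (g z - g (f x) - B (z - f x)) \<le> e / (2 * M) * nrm F (z - f x)"
      using has_fderivD(2)[OF B, of "e / (2 * M)"] e M(1) by auto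
    show "\<exists>d>0. \<forall>y\<in>S. nrm E (y - x) < d \<longrightarrow>
      nrm G (g (f y) - g (f x) - B (A (y - x))) \<le> e * nrm E (y - x)"
    proof (intro exI[of _ "min (min d d0) (d' / M)"] conjI ballI impI)
      fix y assume y: "y \<in> S" "nrm E (y - x) < min (min d d0) (d' / M)"
      have yx: "y - x \<in> vecs E" using y S by auto
      have ff: "f y - f x \<in> vecs F" "A (y - x) \<in> vecs F" using fF y S a(1) yx by auto
      have fM: "nrm F (f y - f x) \<le> M * nrm E (y - x)" using M y by auto
      also have "\<dots> < d'" using y(2) M(1) by (simp add: pos_less_divide_eq mult.commute)
      finally have f': "nrm F (f y - f x) < d'" .
      have m: "g (f y) - g (f x) - B (f y - f x) \<in> vecs G" "B (f y - f x - A (y - x)) \<in> vecs G"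
        using f g y S b(1) ff by auto
      have "g (f y) - g (f x) - B (A (y - x)) =
        (g (f y) - g (f x) - B (f y - f x)) + B (f y - f x - A (y - x))"
        using bounded_lin_diff[OF assms(2) has_fderivD(1)[OF B] ff] by simp
      also have "nrm G \<dots> \<le> nrm G (g (f y) - g (f x) - B (f y - f x)) + nrm G (B (f y - f x - A (y - x)))"
        using G.nrm_triangle m by blast
      also have "\<dots> \<le> e / (2 * M) * nrm F (f y - f x) + C * nrm F (f y - f x - A (y - x))"
        using d'(2)[OF f[OF y(1)] f'] C(2)[of "f y - f x - A (y - x)"] ff by (intro add_mono) auto
      also have "\<dots> \<le> e / (2 * M) * (M * nrm E (y - x)) + C * (e / (2 * C) * nrm E (y - x))"
        using fM d(2)[OF y(1)] y(2) e M(1) C(1) by (intro add_mono mult_left_mono) auto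
      also have "\<dots> = e * nrm E (y - x)" using M(1) C(1) by simp
      finally show "nrm G (g (f y) - g (f x) - B (A (y - x))) \<le> e * nrm E (y - x)" .
    qed (use d d' M in auto)
  qed
qed

text \<open>
  Covers pointwise multiplication of functions and the evaluation of a linear map at a vector.
\<close>

lemma has_fderiv_bilinear:
  assumes "normed_carrier E" "normed_carrier F" "normed_carrier G" "normed_carrier H"
    and S: "S \<subseteq> vecs E" "x \<in> S"
    and f: "\<And>y. y \<in> S \<Longrightarrow> f y \<in> vecs F" and g: "\<And>y. y \<in> S \<Longrightarrow> g y \<in> vecs G"
    and A: "has_fderiv E F S f A x" and B: "has_fderiv E G S g B x"
    and p_mem: "\<And>u v. u \<in> vecs F \<Longrightarrow> v \<in> vecs G \<Longrightarrow> p u v \<in> vecs H"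
    and p_add_left: "\<And>u u' v. u \<in> vecs F \<Longrightarrow> u' \<in> vecs F \<Longrightarrow> v \<in> vecs G \<Longrightarrow> p (u + u') v = p u v + p u' v"
    and p_add_right: "\<And>u v v'. u \<in> vecs F \<Longrightarrow> v \<in> vecs G \<Longrightarrow> v' \<in> vecs G \<Longrightarrow> p u (v + v') = p u v + p u v'"
    and p_scale_left: "\<And>c u v. u \<in> vecs F \<Longrightarrow> v \<in> vecs G \<Longrightarrow> p (c *\<^sub>R u) v = c *\<^sub>R p u v"
    and p_scale_right: "\<And>c u v. u \<in> vecs F \<Longrightarrow> v \<in> vecs G \<Longrightarrow> p u (c *\<^sub>R v) = c *\<^sub>R p u v"
    and p_bound: "\<And>u v. u \<in> vecs F \<Longrightarrow> v \<in> vecs G \<Longrightarrow> nrm H (p u v) \<le> K * nrm F u * nrm G v"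
  shows "has_fderiv E H S (\<lambda>y. p (f y) (g y)) (\<lambda>h. p (A h) (g x) + p (f x) (B h)) x"
proof -
  interpret E: normed_carrier E by fact
  interpret F: normed_carrier F by fact
  interpret G: normed_carrier G by fact
  interpret H: normed_carrier H by fact
  note a = bounded_linD[OF has_fderivD(1)[OF A]] and b = bounded_linD[OF has_fderivD(1)[OF B]]
  obtain C where C: "C > 0" "\<And>h. h \<in> vecs E \<Longrightarrow> nrm F (A h) \<le> C * nrm E h"
    using bounded_lin_bound[OF assms(1) has_fderivD(1)[OF A]] by blast
  obtain C' where C': "C' > 0" "\<And>h. h \<in> vecs E \<Longrightarrow> nrm G (B h) \<le> C' * nrm E h"
    using bounded_lin_bound[OF assms(1) has_fderivD(1)[OF B]] by blast
  define L where "L = \<bar>K\<bar> + 1"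
  have L: "L > 0" by (simp add: L_def)
  have pb: "nrm H (p u v) \<le> L * (nrm F u * nrm G v)" if "u \<in> vecs F" "v \<in> vecs G" for u v
  proof -
    have "K * nrm F u * nrm G v \<le> L * (nrm F u * nrm G v)"
      using that by (simp only: mult.assoc) (intro mult_right_mono, auto simp: L_def)
    then show ?thesis using p_bound[OF that] by linarith
  qed
  have pdl: "p (u - u') v = p u v - p u' v" if "u \<in> vecs F" "u' \<in> vecs F" "v \<in> vecs G" for u u' v
    using p_add_left[of u "(-1) *\<^sub>R u'" v] p_scale_left[of u' v "-1"] that F.uminus_mem by simp
  have pdr: "p u (v - v') = p u v - p u v'" if "u \<in> vecs F" "v \<in> vecs G" "v' \<in> vecs G" for u v v'
    using p_add_right[of u v "(-1) *\<^sub>R v'"] p_scale_right[of u v' "-1"] that G.uminus_mem by simp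
  have p0: "p 0 v = 0" if "v \<in> vecs G" for v using p_scale_left[of 0 v 0] that by simp
  have p0': "p u 0 = 0" if "u \<in> vecs F" for u using p_scale_right[of u 0 0] that by simp
  note fx = f[OF S(2)] and gx = g[OF S(2)]
  obtain M d0 where M: "M > 0" "d0 > 0"
    "\<And>y. y \<in> S \<Longrightarrow> nrm E (y - x) < d0 \<Longrightarrow> nrm F (f y - f x) \<le> M * nrm E (y - x)"
    using has_fderiv_lipschitz[OF assms(1,2) S f A] by blast
  obtain M' d0' where M': "M' > 0" "d0' > 0"
    "\<And>y. y \<in> S \<Longrightarrow> nrm E (y - x) < d0' \<Longrightarrow> nrm G (g y - g x) \<le> M' * nrm E (y - x)"
    using has_fderiv_lipschitz[OF assms(1,3) S g B] by blast
  define nf where "nf = nrm F (f x) + 1"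
  define ng where "ng = nrm G (g x) + 1"
  have nf: "nf > 0" "nrm F (f x) \<le> nf" and ng: "ng > 0" "nrm G (g x) \<le> ng"
    using fx gx by (auto simp: nf_def ng_def add_nonneg_pos)
  show ?thesis
  proof (rule has_fderivI)
    show "(\<lambda>h. p (A h) (g x) + p (f x) (B h)) \<in> bounded_lin E H"
    proof (rule bounded_linI[where C = "L * (C * ng) + L * (nf * C')"])
      fix h assume h: "h \<in> vecs E"
      have "nrm H (p (A h) (g x) + p (f x) (B h)) \<le> nrm H (p (A h) (g x)) + nrm H (p (f x) (B h))"
        using H.nrm_triangle p_mem a(1)[OF h] b(1)[OF h] fx gx by blast
      also have "\<dots> \<le> L * (nrm F (A h) * nrm G (g x)) + L * (nrm F (f x) * nrm G (B h))"
        using pb a(1)[OF h] b(1)[OF h] fx gx by (intro add_mono) auto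
      also have "\<dots> \<le> L * (C * nrm E h * ng) + L * (nf * (C' * nrm E h))"
        using C C' L nf ng h a(1)[OF h] b(1)[OF h] fx gx
        by (intro add_mono mult_left_mono mult_mono) auto
      finally show "nrm H (p (A h) (g x) + p (f x) (B h)) \<le> (L * (C * ng) + L * (nf * C')) * nrm E h"
        by (simp add: algebra_simps)
    qed (use a b fx gx p_mem p0 p0' in \<open>auto simp: p_add_left p_add_right p_scale_left p_scale_right scaleR_add_right\<close>)
    fix e :: real assume e: "e > 0"
    define e' where "e' = e / (3 * L)"
    have e': "e' > 0" using e L by (simp add: e'_def)
    obtain d where d: "d > 0" "\<And>y. y \<in> S \<Longrightarrow> nrm E (y - x) < d \<Longrightarrow> nrm F (f y - f x - A (y - x)) \<le> e' / ng * nrm E (y - x)"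
      using has_fderivD(2)[OF A, of "e' / ng"] e' ng by auto
    obtain d' where d': "d' > 0" "\<And>y. y \<in> S \<Longrightarrow> nrm E (y - x) < d' \<Longrightarrow> nrm G (g y - g x - B (y - x)) \<le> e' / nf * nrm E (y - x)"
      using has_fderivD(2)[OF B, of "e' / nf"] e' nf by auto
    show "\<exists>d>0. \<forall>y\<in>S. nrm E (y - x) < d \<longrightarrow>
      nrm H (p (f y) (g y) - p (f x) (g x) - (p (A (y - x)) (g x) + p (f x) (B (y - x)))) \<le> e * nrm E (y - x)"
    proof (intro exI[of _ "min (min (min d d') (min d0 d0')) (e' / (M * M'))"] conjI ballI impI)
      fix y assume y: "y \<in> S" "nrm E (y - x) < min (min (min d d') (min d0 d0')) (e' / (M * M'))"
      have yx: "y - x \<in> vecs E" using y S by auto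
      note nn = E.nrm_nonneg[OF yx]
      note fy = f[OF y(1)] and gy = g[OF y(1)] and ay = a(1)[OF yx] and by' = b(1)[OF yx]
      have eq: "p (f y) (g y) - p (f x) (g x) - (p (A (y - x)) (g x) + p (f x) (B (y - x))) =
        p (f y - f x - A (y - x)) (g x) + p (f x) (g y - g x - B (y - x)) + p (f y - f x) (g y - g x)"
        using fx gx fy gy ay by' by (simp add: pdl pdr)
      have s: "nrm E (y - x) * (M * M') \<le> e'"
        using y(2) M(1) M'(1) by (simp add: pos_less_divide_eq)
      have "nrm H (p (f y - f x - A (y - x)) (g x) + p (f x) (g y - g x - B (y - x)) + p (f y - f x) (g y - g x))
        \<le> nrm H (p (f y - f x - A (y - x)) (g x)) + nrm H (p (f x) (g y - g x - B (y - x))) + nrm H (p (f y - f x) (g y - g x))"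
        using H.nrm_triangle p_mem fx gx fy gy ay by' by (smt (verit) F.diff_mem G.diff_mem H.add_mem)
      also have "\<dots> \<le> L * (nrm F (f y - f x - A (y - x)) * nrm G (g x)) + L * (nrm F (f x) * nrm G (g y - g x - B (y - x)))
          + L * (nrm F (f y - f x) * nrm G (g y - g x))"
        using pb fx gx fy gy ay by' by (intro add_mono) auto
      also have "\<dots> \<le> L * (e' / ng * nrm E (y - x) * ng) + L * (nf * (e' / nf * nrm E (y - x)))
          + L * (M * nrm E (y - x) * (M' * nrm E (y - x)))"
        using d d' M M' y L nf ng fx gx fy gy ay by' e' nn
        by (intro add_mono mult_left_mono mult_mono) auto
      also have "\<dots> = L * (e' * nrm E (y - x)) + L * (e' * nrm E (y - x)) + L * (nrm E (y - x) * (M * M') * nrm E (y - x))"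
        using nf ng by simp
      also have "\<dots> \<le> L * (e' * nrm E (y - x)) + L * (e' * nrm E (y - x)) + L * (e' * nrm E (y - x))"
        using s nn L by (intro add_mono mult_left_mono mult_right_mono) auto
      also have "\<dots> = e * nrm E (y - x)" using L by (simp add: e'_def)
      finally show "nrm H (p (f y) (g y) - p (f x) (g x) - (p (A (y - x)) (g x) + p (f x) (B (y - x)))) \<le> e * nrm E (y - x)"
        unfolding eq .
    qed (use d d' M M' e' in auto)
  qed
qed

subsection \<open>Iterated derivatives\<close>

definition level :: "nat \<Rightarrow> 'v nspace \<Rightarrow> ('v \<Rightarrow> 'v list \<Rightarrow> 'w::zero) \<Rightarrow> 'v \<Rightarrow> 'v list \<Rightarrow> 'w"
  where "level i E D x = (\<lambda>hs. if length hs = i \<and> set hs \<subseteq> vecs E then D x hs else 0)"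

text \<open>
  Families \<open>D x hs\<close> that are given by formulas can thus be recognised as iterated derivatives by
  a single differentiation step, in a new first direction.
\<close>

lemma nth_fderiv_eq_level:
  fixes E :: "'v::real_vector nspace" and F :: "'w::real_vector nspace"
  assumes "normed_carrier E" "normed_carrier F" "\<And>x. x \<in> S \<Longrightarrow> inner_point E S x"
    and "\<And>i x. i < k \<Longrightarrow> x \<in> S \<Longrightarrow> level i E D x \<in> vecs (multilin i E F)"
    and "\<And>i x. i < k \<Longrightarrow> x \<in> S \<Longrightarrow>
      has_fderiv E (multilin i E F) S (level i E D) (\<lambda>h t. level (Suc i) E D x (h # t)) x"
    and "\<And>x. x \<in> S \<Longrightarrow> f x = D x []"
  shows "i \<le> k \<Longrightarrow> x \<in> S \<Longrightarrow> nth_fderiv i E F S f x = level i E D x"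
proof (induction i arbitrary: x)
  case 0
  then show ?case using assms(6) by (auto simp: level_def)
next
  case (Suc i)
  have "fderiv E (multilin i E F) S (nth_fderiv i E F S f) x = fderiv E (multilin i E F) S (level i E D) x"
    using Suc by (intro fderiv_cong) auto
  also have "\<dots> = (\<lambda>h t. level (Suc i) E D x (h # t))"
    using Suc.prems assms by (intro fderiv_eq normed_carrier_multilin) auto
  finally show ?case by (auto simp: level_def split: list.split)
qed

text \<open>
  \<open>Ck_on\<close> provides some derivative of each entry; by uniqueness it is the next entry.
\<close>

lemma Ck_on_nth:
  fixes E :: "'v::real_vector nspace" and F :: "'w::real_vector nspace"
  assumes "normed_carrier E" "normed_carrier F" "\<And>x. x \<in> S \<Longrightarrow> inner_point E S x"
    and Ck: "Ck_on k E F S f"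
  shows Ck_on_nth_mem: "i \<le> k \<Longrightarrow> x \<in> S \<Longrightarrow> nth_fderiv i E F S f x \<in> vecs (multilin i E F)"
    and Ck_on_nth_has_fderiv: "i < k \<Longrightarrow> x \<in> S \<Longrightarrow>
      has_fderiv E (multilin i E F) S (nth_fderiv i E F S f) (\<lambda>h t. nth_fderiv (Suc i) E F S f x (h # t)) x"
proof -
  interpret F: normed_carrier F by fact
  have step: "has_fderiv E (multilin i E F) S (nth_fderiv i E F S f) (fderiv E (multilin i E F) S (nth_fderiv i E F S f) x) x"
    if i: "i < k" "x \<in> S" and m: "\<And>y. y \<in> S \<Longrightarrow> nth_fderiv i E F S f y \<in> vecs (multilin i E F)" for i x
  proof -
    obtain A where A: "has_fderiv E (multilin i E F) S (nth_fderiv i E F S f) A x"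
      using Ck i unfolding Ck_on_def by blast
    then show ?thesis
      using fderiv_eq[OF assms(1) normed_carrier_multilin[OF assms(1,2)] assms(3)[OF i(2)] m A] by simp
  qed
  have mem: "nth_fderiv i E F S f x \<in> vecs (multilin i E F)" if "i \<le> k" "x \<in> S" for i x
    using that
  proof (induction i arbitrary: x)
    case 0
    then have "f x \<in> vecs F" using Ck unfolding Ck_on_def by blast
    then show ?case by (intro multilin_memI[where C = "nrm F (f x)"]) auto
  next
    case (Suc i)
    have "fderiv E (multilin i E F) S (nth_fderiv i E F S f) x \<in> bounded_lin E (multilin i E F)"
      using Suc by (intro has_fderivD(1)[OF step]) auto
    from uncurry_bounded_lin[OF assms(1,2) this] show ?case by simp
  qed
  show "i \<le> k \<Longrightarrow> x \<in> S \<Longrightarrow> nth_fderiv i E F S f x \<in> vecs (multilin i E F)" by (rule mem)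
  show "has_fderiv E (multilin i E F) S (nth_fderiv i E F S f) (\<lambda>h t. nth_fderiv (Suc i) E F S f x (h # t)) x"
    if "i < k" "x \<in> S"
    using step[OF that mem] that by simp
qed

text \<open>
  The derivatives of order at least \<open>2\<close> vanish. This serves constant coordinate fields and the chart
  \<open>\<phi>\<^sub>e\<close>, which tests the Lie bracket.
\<close>

lemma smooth_affine:
  fixes E :: "'v::real_vector nspace" and F :: "'w::real_vector nspace"
  assumes "normed_carrier E" "normed_carrier F" "A \<in> bounded_lin E F" "c \<in> vecs F"
  shows "smooth_nspace E F (vecs E) (\<lambda>x. c + A x)"
proof -
  interpret E: normed_carrier E by fact
  interpret F: normed_carrier F by fact
  note a = bounded_linD[OF assms(3)]
  obtain C where C: "C > 0" "\<And>h. h \<in> vecs E \<Longrightarrow> nrm F (A h) \<le> C * nrm E h"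
    using bounded_lin_bound[OF assms(1,3)] by blast
  let ?M = "\<lambda>i. multilin i E F"
  have M: "normed_carrier (?M i)" for i by (rule normed_carrier_multilin[OF assms(1,2)])
  define D where "D x hs = (case hs of [] \<Rightarrow> c + A x | [h] \<Rightarrow> A h | _ \<Rightarrow> 0)" for x hs
  have lin: "(\<lambda>h t. level (Suc i) E D x (h # t)) \<in> bounded_lin E (?M i)" for i x
  proof (cases i)
    case 0
    have m: "(\<lambda>hs. if hs = [] then v else 0) \<in> vecs (?M 0)" if "v \<in> vecs F" for v
      using that by (intro multilin_memI[where C = "nrm F v"]) auto
    have "(\<lambda>h t. level (Suc i) E D x (h # t)) = (\<lambda>h t. if t = [] then A h else 0)"
      using a(4) by (auto simp: level_def D_def fun_eq_iff 0 split: list.split)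
    also have "\<dots> \<in> bounded_lin E (?M 0)"
    proof (rule bounded_linI[where C = C])
      show "nrm (?M 0) (\<lambda>t. if t = [] then A h else 0) \<le> C * nrm E h" if "h \<in> vecs E" for h
        using C(2)[OF that] by (intro multilin_nrm_le[OF assms(1)]) auto
      show "(\<lambda>t. if t = [] then A h else 0) \<in> vecs (?M 0)" if "h \<in> vecs E" for h
        by (rule m[OF a(1)[OF that]])
      show "(\<lambda>t. if t = [] then A (h + h') else 0) =
          (\<lambda>t. if t = [] then A h else 0) + (\<lambda>t. if t = [] then A h' else 0)"
        if "h \<in> vecs E" "h' \<in> vecs E" for h h'
        by (simp add: fun_eq_iff a(2)[OF that])
      show "(\<lambda>t. if t = [] then A (c *\<^sub>R h) else 0) = c *\<^sub>R (\<lambda>t. if t = [] then A h else 0)"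
        if "h \<in> vecs E" for h c
        by (simp add: fun_eq_iff scaleR_fun_def a(3)[OF that])
      show "(\<lambda>t. if t = [] then A h else 0) = 0" if "h \<notin> vecs E" for h
        by (simp add: fun_eq_iff a(4)[OF that])
    qed
    finally show ?thesis using 0 by simp
  next
    case (Suc j)
    then have "(\<lambda>h t. level (Suc i) E D x (h # t)) = (\<lambda>_. 0)"
      by (auto simp: level_def D_def fun_eq_iff split: list.split)
    then show ?thesis using has_fderivD(1)[OF has_fderiv_const[OF assms(1) M[of i], of "{0}" 0 0]] by simp
  qed
  have mem: "level i E D x \<in> vecs (?M i)" if "x \<in> vecs E" for i x
  proof (cases i)
    case 0
    then show ?thesis using a(1)[OF that] assms(4)
      by (intro multilin_memI[where C = "nrm F (c + A x)"]) (auto simp: level_def D_def)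
  next
    case (Suc j)
    have "level i E D x = (\<lambda>hs. case hs of [] \<Rightarrow> 0 | h # t \<Rightarrow> level (Suc j) E D x (h # t))"
      by (auto simp: Suc level_def fun_eq_iff split: list.split)
    then show ?thesis using uncurry_bounded_lin[OF assms(1,2) lin[of j x]] Suc by simp
  qed
  have deriv: "has_fderiv E (?M i) (vecs E) (level i E D) (\<lambda>h t. level (Suc i) E D x (h # t)) x"
    if x: "x \<in> vecs E" for i x
  proof (rule has_fderivI[OF lin])
    have "level i E D y - level i E D x - (\<lambda>t. level (Suc i) E D x ((y - x) # t)) = 0" if "y \<in> vecs E" for y
      using bounded_lin_diff[OF assms(1,3) that x] x that
      by (auto simp: level_def D_def fun_eq_iff split: list.split)
    then show "\<exists>d>0. \<forall>y\<in>vecs E. nrm E (y - x) < d \<longrightarrow>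
        nrm (?M i) (level i E D y - level i E D x - (\<lambda>t. level (Suc i) E D x ((y - x) # t))) \<le> e * nrm E (y - x)"
      if "e > 0" for e
      using that x by (intro exI[of _ 1]) (auto simp: normed_carrier.nrm_zero[OF M])
  qed
  have nth: "nth_fderiv i E F (vecs E) (\<lambda>x. c + A x) x = level i E D x" if "x \<in> vecs E" for i x
    using that by (intro nth_fderiv_eq_level[where k = i] assms inner_point_vecs mem deriv)
      (auto simp: D_def)
  have cont: "ncontinuous_on E (?M i) (vecs E) (nth_fderiv i E F (vecs E) (\<lambda>x. c + A x))" for i
    unfolding ncontinuous_on_def
  proof (intro ballI allI impI)
    fix x and e :: real assume x: "x \<in> vecs E" and e: "e > 0"
    obtain L d where L: "L > 0" "d > 0" "\<And>y. y \<in> vecs E \<Longrightarrow> nrm E (y - x) < d \<Longrightarrow>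
        nrm (?M i) (level i E D y - level i E D x) \<le> L * nrm E (y - x)"
      using has_fderiv_lipschitz[OF assms(1) M subset_refl x mem deriv[OF x]] by blast
    show "\<exists>d>0. \<forall>y\<in>vecs E. nrm E (y - x) < d \<longrightarrow> nrm (?M i) (nth_fderiv i E F (vecs E) (\<lambda>x. c + A x) y
        - nth_fderiv i E F (vecs E) (\<lambda>x. c + A x) x) < e"
    proof (intro exI[of _ "min d (e / L)"] conjI ballI impI)
      fix y assume y: "y \<in> vecs E" "nrm E (y - x) < min d (e / L)"
      have "L * nrm E (y - x) < e" using y(2) L(1) by (simp add: pos_less_divide_eq mult.commute)
      then show "nrm (?M i) (nth_fderiv i E F (vecs E) (\<lambda>x. c + A x) y
        - nth_fderiv i E F (vecs E) (\<lambda>x. c + A x) x) < e" using L(3)[of y] y x nth by auto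
    qed (use L e in auto)
  qed
  have has: "has_fderiv E (?M i) (vecs E) (nth_fderiv i E F (vecs E) (\<lambda>x. c + A x)) (\<lambda>h t. level (Suc i) E D x (h # t)) x"
    if "x \<in> vecs E" for i x
    using deriv[OF that, of i]
      has_fderiv_cong[of "vecs E" "nth_fderiv i E F (vecs E) (\<lambda>x. c + A x)" "level i E D", OF nth that]
    by blast
  show ?thesis unfolding smooth_nspace_def Ck_on_def
    using cont has a(1) assms(4) by auto
qed

section \<open>Jets and the function algebra\<close>

subsection \<open>The Leibniz sum\<close>

abbreviation pnorm :: "'a::real_normed_vector list \<Rightarrow> real"
  where "pnorm hs \<equiv> prod_list (map norm hs)"

lemma pnorm_nonneg [simp]: "0 \<le> pnorm hs"
  by (induction hs) auto

text \<open>
  The sum over all ways of distributing the directions between the two factors, that is, the iterated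
  product rule.
\<close>

fun leib :: "('a list \<Rightarrow> real) \<Rightarrow> ('a list \<Rightarrow> real) \<Rightarrow> 'a list \<Rightarrow> real"
  where
    "leib f g [] = f [] * g []"
  | "leib f g (h # t) = leib (\<lambda>p. f (h # p)) g t + leib f (\<lambda>q. g (h # q)) t"

lemma leib_add_left: "leib (\<lambda>p. f p + f' p) g t = leib f g t + leib f' g t"
  by (induction t arbitrary: f f' g) (auto simp: algebra_simps)

lemma leib_add_right: "leib f (\<lambda>q. g q + g' q) t = leib f g t + leib f g' t"
  by (induction t arbitrary: f g g') (auto simp: algebra_simps)

lemma leib_scale_left: "leib (\<lambda>p. c * f p) g t = c * leib f g t"
  by (induction t arbitrary: f g) (auto simp: algebra_simps)

lemma leib_scale_right: "leib f (\<lambda>q. c * g q) t = c * leib f g t"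
  by (induction t arbitrary: f g) (auto simp: algebra_simps)

lemma leib_diff_left: "leib (\<lambda>p. f p - f' p) g t = leib f g t - leib f' g t"
  using leib_add_left[of f "\<lambda>p. (-1) * f' p" g t] leib_scale_left[of "-1" f' g t] by simp

lemma leib_diff_right: "leib f (\<lambda>q. g q - g' q) t = leib f g t - leib f g' t"
  using leib_add_right[of f g "\<lambda>p. (-1) * g' p" t] leib_scale_right[of f "-1" g' t] by simp

lemma leib_zero_right: "leib f (\<lambda>_. 0) t = 0"
  by (induction t arbitrary: f) auto

lemma leib_unit_right: "leib f (\<lambda>q. if q = [] then 1 else 0) t = f t"
  by (induction t arbitrary: f) (auto simp: leib_zero_right)

lemma leib_bound:
  fixes f g :: "'a::real_normed_vector list \<Rightarrow> real"
  assumes "\<And>p. length p \<le> length t \<Longrightarrow> \<bar>f p\<bar> \<le> a * pnorm p"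
    and "\<And>q. length q \<le> length t \<Longrightarrow> \<bar>g q\<bar> \<le> b * pnorm q"
  shows "\<bar>leib f g t\<bar> \<le> 2 ^ length t * a * b * pnorm t"
  using assms
proof (induction t arbitrary: f g a b)
  case Nil
  have "\<bar>f []\<bar> \<le> a" "\<bar>g []\<bar> \<le> b" using Nil.prems(1)[of "[]"] Nil.prems(2)[of "[]"] by auto
  then show ?case by (simp add: abs_mult mult_mono')
next
  case (Cons h t)
  have "\<bar>leib (\<lambda>p. f (h # p)) g t\<bar> \<le> 2 ^ length t * (a * norm h) * b * pnorm t"
    using Cons.prems(1)[of "h # _"] Cons.prems(2) by (intro Cons.IH) (auto simp: mult.assoc)
  moreover have "\<bar>leib f (\<lambda>q. g (h # q)) t\<bar> \<le> 2 ^ length t * a * (b * norm h) * pnorm t"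
    using Cons.prems(2)[of "h # _"] Cons.prems(1) by (intro Cons.IH) (auto simp: mult.assoc)
  ultimately have "\<bar>leib f g (h # t)\<bar> \<le> 2 ^ length t * (a * norm h) * b * pnorm t + 2 ^ length t * a * (b * norm h) * pnorm t"
    unfolding leib.simps by linarith
  also have "\<dots> = 2 ^ length (h # t) * a * b * pnorm (h # t)" by simp
  finally show ?case .
qed

definition mlin :: "('a::real_vector list \<Rightarrow> real) \<Rightarrow> bool"
  where "mlin f \<longleftrightarrow> (\<forall>us vs h h'. f (us @ (h + h') # vs) = f (us @ h # vs) + f (us @ h' # vs)) \<and>
    (\<forall>us vs h c. f (us @ (c *\<^sub>R h) # vs) = c * f (us @ h # vs))"

lemma mlinD:
  assumes "mlin f"
  shows "f (us @ (h + h') # vs) = f (us @ h # vs) + f (us @ h' # vs)"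
    and "f (us @ (c *\<^sub>R h) # vs) = c * f (us @ h # vs)"
  using assms unfolding mlin_def by auto

lemma mlin_Cons: "mlin f \<Longrightarrow> mlin (\<lambda>p. f (h # p))"
  unfolding mlin_def by (metis append_Cons)

lemma mlin_snoc: "mlin f \<Longrightarrow> mlin (\<lambda>p. f (p @ [h]))"
  unfolding mlin_def by simp

lemma mlin_add: "mlin f \<Longrightarrow> mlin g \<Longrightarrow> mlin (\<lambda>p. f p + g p)"
  unfolding mlin_def by (simp add: algebra_simps)

lemma mlin_leib: "mlin f \<Longrightarrow> mlin g \<Longrightarrow> mlin (leib f g)"
proof -
  assume "mlin f" "mlin g"
  then have "leib f g (us @ (h + h') # vs) = leib f g (us @ h # vs) + leib f g (us @ h' # vs) \<and>
    leib f g (us @ (c *\<^sub>R h) # vs) = c * leib f g (us @ h # vs)" for us vs h h' c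
  proof (induction us arbitrary: f g)
    case Nil
    then show ?case
      using mlinD[OF Nil(1), of "[]"] mlinD[OF Nil(2), of "[]"]
      by (simp add: leib_add_left leib_add_right leib_scale_left leib_scale_right algebra_simps)
  next
    case (Cons u us)
    then show ?case using mlin_Cons[of f u] mlin_Cons[of g u] by (simp add: algebra_simps)
  qed
  then show ?thesis unfolding mlin_def by blast
qed

subsection \<open>Families of jets\<close>

text \<open>
  All derivatives up to order \<open>k\<close> of a family of functions, with the first element of a list as the
  outermost direction. The estimates are uniform in the index \<open>i\<close> with weight \<open>w i\<close>. Families are needed
  because the derivatives of a jet in an innermost direction \<open>i\<close> form a family of weight \<open>norm i\<close>
  (\<open>jets_snoc\<close>).
\<close>

definition jets :: "nat \<Rightarrow> 'a::real_normed_vector set \<Rightarrow> ('i \<Rightarrow> real) \<Rightarrow> ('i \<Rightarrow> 'a \<Rightarrow> 'a list \<Rightarrow> real) \<Rightarrow> bool"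
  where "jets k B w D \<longleftrightarrow>
    (\<forall>i. 0 \<le> w i) \<and> (\<forall>i. \<forall>x\<in>B. mlin (D i x)) \<and>
    (\<exists>C\<ge>0. \<forall>i. \<forall>x\<in>B. \<forall>hs. length hs \<le> k \<longrightarrow> \<bar>D i x hs\<bar> \<le> C * w i * pnorm hs) \<and>
    (\<forall>x\<in>B. \<forall>e>0. \<exists>d>0. \<forall>y\<in>B. norm (y - x) < d \<longrightarrow> (\<forall>i hs. length hs < k \<longrightarrow>
      \<bar>D i y hs - D i x hs - D i x ((y - x) # hs)\<bar> \<le> e * norm (y - x) * w i * pnorm hs)) \<and>
    (\<forall>x\<in>B. \<forall>e>0. \<exists>d>0. \<forall>y\<in>B. norm (y - x) < d \<longrightarrow> (\<forall>i hs. length hs \<le> k \<longrightarrow>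
      \<bar>D i y hs - D i x hs\<bar> \<le> e * w i * pnorm hs))"

abbreviation jet :: "nat \<Rightarrow> 'a::real_normed_vector set \<Rightarrow> ('a \<Rightarrow> 'a list \<Rightarrow> real) \<Rightarrow> bool"
  where "jet k B D \<equiv> jets k B (\<lambda>_::unit. 1) (\<lambda>_. D)"

lemma jetsI:
  assumes "\<And>i. 0 \<le> w i" "\<And>i x. x \<in> B \<Longrightarrow> mlin (D i x)" "0 \<le> C"
    and "\<And>i x hs. x \<in> B \<Longrightarrow> length hs \<le> k \<Longrightarrow> \<bar>D i x hs\<bar> \<le> C * w i * pnorm hs"
    and "\<And>x e. x \<in> B \<Longrightarrow> e > 0 \<Longrightarrow> \<exists>d>0. \<forall>y\<in>B. norm (y - x) < d \<longrightarrow> (\<forall>i hs. length hs < k \<longrightarrow>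
      \<bar>D i y hs - D i x hs - D i x ((y - x) # hs)\<bar> \<le> e * norm (y - x) * w i * pnorm hs)"
    and "\<And>x e. x \<in> B \<Longrightarrow> e > 0 \<Longrightarrow> \<exists>d>0. \<forall>y\<in>B. norm (y - x) < d \<longrightarrow> (\<forall>i hs. length hs \<le> k \<longrightarrow>
      \<bar>D i y hs - D i x hs\<bar> \<le> e * w i * pnorm hs)"
  shows "jets k B w D"
  using assms unfolding jets_def by blast

lemma jetsD:
  assumes "jets k B w D"
  shows "0 \<le> w i" "x \<in> B \<Longrightarrow> mlin (D i x)"
    and "\<exists>C\<ge>0. \<forall>i. \<forall>x\<in>B. \<forall>hs. length hs \<le> k \<longrightarrow> \<bar>D i x hs\<bar> \<le> C * w i * pnorm hs"
    and "x \<in> B \<Longrightarrow> e > 0 \<Longrightarrow> \<exists>d>0. \<forall>y\<in>B. norm (y - x) < d \<longrightarrow> (\<forall>i hs. length hs < k \<longrightarrow>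
      \<bar>D i y hs - D i x hs - D i x ((y - x) # hs)\<bar> \<le> e * norm (y - x) * w i * pnorm hs)"
    and "x \<in> B \<Longrightarrow> e > 0 \<Longrightarrow> \<exists>d>0. \<forall>y\<in>B. norm (y - x) < d \<longrightarrow> (\<forall>i hs. length hs \<le> k \<longrightarrow>
      \<bar>D i y hs - D i x hs\<bar> \<le> e * w i * pnorm hs)"
  using assms unfolding jets_def by blast+

lemma jets_snoc:
  assumes j: "jet k B D" and n: "n < k"
  shows "jets n B norm (\<lambda>i x hs. D x (hs @ [i]))"
proof -
  obtain C where C: "C \<ge> 0" "\<And>x hs. x \<in> B \<Longrightarrow> length hs \<le> k \<Longrightarrow> \<bar>D x hs\<bar> \<le> C * pnorm hs"
    using jetsD(3)[OF j] by auto
  show ?thesis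
  proof (rule jetsI[where C = C])
    show "mlin (\<lambda>hs. D x (hs @ [i]))" if "x \<in> B" for x i
      using jetsD(2)[OF j that] by (rule mlin_snoc)
    show "\<bar>D x (hs @ [i])\<bar> \<le> C * norm i * pnorm hs" if "x \<in> B" "length hs \<le> n" for i x hs
      using C(2)[OF that(1), of "hs @ [i]"] that n by (simp add: ac_simps)
    fix x and e :: real assume x: "x \<in> B" and e: "e > 0"
    obtain d where d: "d > 0" "\<And>y hs. y \<in> B \<Longrightarrow> norm (y - x) < d \<Longrightarrow> length hs < k \<Longrightarrow>
      \<bar>D y hs - D x hs - D x ((y - x) # hs)\<bar> \<le> e * norm (y - x) * pnorm hs"
      using jetsD(4)[OF j x e] by auto
    have "\<bar>D y (hs @ [i]) - D x (hs @ [i]) - D x (((y - x) # hs) @ [i])\<bar> \<le> e * norm (y - x) * norm i * pnorm hs"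
      if "y \<in> B" "norm (y - x) < d" "length hs < n" for y i hs
      using d(2)[OF that(1,2), of "hs @ [i]"] that n by (simp add: ac_simps)
    then show "\<exists>d>0. \<forall>y\<in>B. norm (y - x) < d \<longrightarrow> (\<forall>i hs. length hs < n \<longrightarrow>
      \<bar>D y (hs @ [i]) - D x (hs @ [i]) - D x (((y - x) # hs) @ [i])\<bar> \<le> e * norm (y - x) * norm i * pnorm hs)"
      using d(1) by blast
    obtain d where d: "d > 0" "\<And>y hs. y \<in> B \<Longrightarrow> norm (y - x) < d \<Longrightarrow> length hs \<le> k \<Longrightarrow>
      \<bar>D y hs - D x hs\<bar> \<le> e * pnorm hs"
      using jetsD(5)[OF j x e] by auto
    have "\<bar>D y (hs @ [i]) - D x (hs @ [i])\<bar> \<le> e * norm i * pnorm hs"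
      if "y \<in> B" "norm (y - x) < d" "length hs \<le> n" for y i hs
      using d(2)[OF that(1,2), of "hs @ [i]"] that n by (simp add: ac_simps)
    then show "\<exists>d>0. \<forall>y\<in>B. norm (y - x) < d \<longrightarrow> (\<forall>i hs. length hs \<le> n \<longrightarrow>
      \<bar>D y (hs @ [i]) - D x (hs @ [i])\<bar> \<le> e * norm i * pnorm hs)"
      using d(1) by blast
  qed (use C in auto)
qed

lemma jets_leib:
  assumes D: "jets k B w D" and G: "jet k B G"
  shows "jets k B w (\<lambda>i x. leib (D i x) (G x))"
proof -
  obtain C where C: "C \<ge> 0" "\<And>i x hs. x \<in> B \<Longrightarrow> length hs \<le> k \<Longrightarrow> \<bar>D i x hs\<bar> \<le> C * w i * pnorm hs"
    using jetsD(3)[OF D] by blast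
  obtain C' where C': "C' \<ge> 0" "\<And>x hs. x \<in> B \<Longrightarrow> length hs \<le> k \<Longrightarrow> \<bar>G x hs\<bar> \<le> C' * pnorm hs"
    using jetsD(3)[OF G] by auto
  note w = jetsD(1)[OF D]
  have pow: "2 ^ length hs \<le> (2::real) ^ k" if "length hs \<le> k" for hs :: "'a list"
    using that by (intro power_increasing) auto
  define M where "M = 2 ^ k * (C' + C + C + 1)"
  have M: "M > 0" using C C' by (simp add: M_def)
  show ?thesis
  proof (rule jetsI[where C = "2 ^ k * C * C'"])
    show "0 \<le> w i" for i by (rule w)
    show "0 \<le> 2 ^ k * C * C'" using C C' by simp
    show "mlin (leib (D i x) (G x))" if "x \<in> B" for i x
      using jetsD(2)[OF D that] jetsD(2)[OF G that] by (rule mlin_leib)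
    show "\<bar>leib (D i x) (G x) hs\<bar> \<le> 2 ^ k * C * C' * w i * pnorm hs" if x: "x \<in> B" "length hs \<le> k" for i x hs
    proof -
      have "\<bar>leib (D i x) (G x) hs\<bar> \<le> 2 ^ length hs * (C * w i) * C' * pnorm hs"
        using C(2)[OF x(1)] C'(2)[OF x(1)] x(2) by (intro leib_bound) auto
      also have "\<dots> = 2 ^ length hs * (C * w i * C' * pnorm hs)" by (simp add: ac_simps)
      also have "\<dots> \<le> 2 ^ k * (C * w i * C' * pnorm hs)"
        using pow[OF x(2)] C(1) C'(1) w[of i] by (intro mult_right_mono) auto
      finally show ?thesis by (simp add: ac_simps)
    qed
    fix x and e :: real assume x: "x \<in> B" and e: "e > 0"
    define e1 where "e1 = e / M"
    have e1: "e1 > 0" using e M by (simp add: e1_def)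
    obtain d1 where d1: "d1 > 0" "\<And>y i hs. y \<in> B \<Longrightarrow> norm (y - x) < d1 \<Longrightarrow> length hs < k \<Longrightarrow>
      \<bar>D i y hs - D i x hs - D i x ((y - x) # hs)\<bar> \<le> e1 * norm (y - x) * w i * pnorm hs"
      using jetsD(4)[OF D x e1] by blast
    obtain d2 where d2: "d2 > 0" "\<And>y hs. y \<in> B \<Longrightarrow> norm (y - x) < d2 \<Longrightarrow> length hs < k \<Longrightarrow>
      \<bar>G y hs - G x hs - G x ((y - x) # hs)\<bar> \<le> e1 * norm (y - x) * pnorm hs"
      using jetsD(4)[OF G x e1] by auto
    obtain d3 where d3: "d3 > 0" "\<And>y hs. y \<in> B \<Longrightarrow> norm (y - x) < d3 \<Longrightarrow> length hs \<le> k \<Longrightarrow>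
      \<bar>G y hs - G x hs\<bar> \<le> e1 * pnorm hs"
      using jetsD(5)[OF G x e1] by auto
    obtain d4 where d4: "d4 > 0" "\<And>y i hs. y \<in> B \<Longrightarrow> norm (y - x) < d4 \<Longrightarrow> length hs \<le> k \<Longrightarrow>
      \<bar>D i y hs - D i x hs\<bar> \<le> e1 * w i * pnorm hs"
      using jetsD(5)[OF D x e1] by blast
    have final: "2 ^ length hs * (e1 * s) * C' + 2 ^ length hs * (C * s) * e1 + 2 ^ length hs * (C * s) * e1 \<le> e * s"
      if "length hs \<le> k" "0 \<le> s" for hs :: "'a list" and s
    proof -
      have "2 ^ length hs * (e1 * s) * C' + 2 ^ length hs * (C * s) * e1 + 2 ^ length hs * (C * s) * e1
        = 2 ^ length hs * ((C' + C + C) * (e1 * s))" by (simp add: algebra_simps)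
      also have "\<dots> \<le> 2 ^ k * ((C' + C + C + 1) * (e1 * s))"
        using pow[OF that(1)] that(2) C(1) C'(1) e1 by (intro mult_mono) auto
      also have "\<dots> = M * (e / M) * s" by (simp add: M_def e1_def)
      also have "\<dots> = e * s" using M by simp
      finally show ?thesis .
    qed
    show "\<exists>d>0. \<forall>y\<in>B. norm (y - x) < d \<longrightarrow> (\<forall>i hs. length hs < k \<longrightarrow>
      \<bar>leib (D i y) (G y) hs - leib (D i x) (G x) hs - leib (D i x) (G x) ((y - x) # hs)\<bar>
      \<le> e * norm (y - x) * w i * pnorm hs)"
    proof (intro exI[of _ "min d1 (min d2 d3)"] conjI ballI allI impI)
      fix y i and hs :: "'a list" assume y: "y \<in> B" "norm (y - x) < min d1 (min d2 d3)" and l: "length hs < k"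
      define v where "v = y - x"
      have "\<bar>leib (\<lambda>p. D i y p - D i x p - D i x (v # p)) (G y) hs\<bar> \<le> 2 ^ length hs * (e1 * norm v * w i) * C' * pnorm hs"
        using d1(2)[OF y(1)] y(2) C'(2)[OF y(1)] l by (intro leib_bound) (auto simp: v_def)
      moreover have "\<bar>leib (\<lambda>p. D i x (v # p)) (\<lambda>q. G y q - G x q) hs\<bar> \<le> 2 ^ length hs * (C * norm v * w i) * e1 * pnorm hs"
      proof (rule leib_bound)
        show "\<bar>D i x (v # p)\<bar> \<le> C * norm v * w i * pnorm p" if "length p \<le> length hs" for p
          using C(2)[OF x, of "v # p" i] that l by (simp add: ac_simps)
        show "\<bar>G y q - G x q\<bar> \<le> e1 * pnorm q" if "length q \<le> length hs" for q
          using d3(2)[OF y(1)] that l y(2) by auto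
      qed
      moreover have "\<bar>leib (D i x) (\<lambda>q. G y q - G x q - G x (v # q)) hs\<bar> \<le> 2 ^ length hs * (C * w i) * (e1 * norm v) * pnorm hs"
        using d2(2)[OF y(1)] y(2) C(2)[OF x] l by (intro leib_bound) (auto simp: v_def)
      \<comment> \<open>The product rule remainder, as for \<open>f g\<close>: the remainder of each factor and one mixed term.\<close>
      moreover have "leib (D i y) (G y) hs - leib (D i x) (G x) hs - leib (D i x) (G x) (v # hs) =
        leib (\<lambda>p. D i y p - D i x p - D i x (v # p)) (G y) hs + leib (\<lambda>p. D i x (v # p)) (\<lambda>q. G y q - G x q) hs
        + leib (D i x) (\<lambda>q. G y q - G x q - G x (v # q)) hs"
        by (simp add: leib_diff_left leib_diff_right)
      ultimately have "\<bar>leib (D i y) (G y) hs - leib (D i x) (G x) hs - leib (D i x) (G x) (v # hs)\<bar>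
        \<le> 2 ^ length hs * (e1 * norm v * w i) * C' * pnorm hs + 2 ^ length hs * (C * norm v * w i) * e1 * pnorm hs
          + 2 ^ length hs * (C * w i) * (e1 * norm v) * pnorm hs" by linarith
      also have "\<dots> = 2 ^ length hs * (e1 * (norm v * w i * pnorm hs)) * C' + 2 ^ length hs * (C * (norm v * w i * pnorm hs)) * e1
          + 2 ^ length hs * (C * (norm v * w i * pnorm hs)) * e1" by (simp add: ac_simps)
      also have "\<dots> \<le> e * (norm v * w i * pnorm hs)" using l w[of i] by (intro final) auto
      finally show "\<bar>leib (D i y) (G y) hs - leib (D i x) (G x) hs - leib (D i x) (G x) ((y - x) # hs)\<bar>
        \<le> e * norm (y - x) * w i * pnorm hs" unfolding v_def by (simp add: mult.assoc)
    qed (use d1 d2 d3 in auto)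
    show "\<exists>d>0. \<forall>y\<in>B. norm (y - x) < d \<longrightarrow> (\<forall>i hs. length hs \<le> k \<longrightarrow>
      \<bar>leib (D i y) (G y) hs - leib (D i x) (G x) hs\<bar> \<le> e * w i * pnorm hs)"
    proof (intro exI[of _ "min d4 d3"] conjI ballI allI impI)
      fix y i and hs :: "'a list" assume y: "y \<in> B" "norm (y - x) < min d4 d3" and l: "length hs \<le> k"
      have "\<bar>leib (\<lambda>p. D i y p - D i x p) (G y) hs\<bar> \<le> 2 ^ length hs * (e1 * w i) * C' * pnorm hs"
        using d4(2)[OF y(1)] y(2) C'(2)[OF y(1)] l by (intro leib_bound) auto
      moreover have "\<bar>leib (D i x) (\<lambda>q. G y q - G x q) hs\<bar> \<le> 2 ^ length hs * (C * w i) * e1 * pnorm hs"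
        using d3(2)[OF y(1)] y(2) C(2)[OF x] l by (intro leib_bound) auto
      moreover have "leib (D i y) (G y) hs - leib (D i x) (G x) hs =
        leib (\<lambda>p. D i y p - D i x p) (G y) hs + leib (D i x) (\<lambda>q. G y q - G x q) hs"
        by (simp add: leib_diff_left leib_diff_right)
      moreover have "0 \<le> 2 ^ length hs * (C * w i) * e1 * pnorm hs" using C(1) w[of i] e1 by simp
      ultimately have "\<bar>leib (D i y) (G y) hs - leib (D i x) (G x) hs\<bar>
        \<le> 2 ^ length hs * (e1 * w i) * C' * pnorm hs + 2 ^ length hs * (C * w i) * e1 * pnorm hs
          + 2 ^ length hs * (C * w i) * e1 * pnorm hs" by linarith
      also have "\<dots> = 2 ^ length hs * (e1 * (w i * pnorm hs)) * C' + 2 ^ length hs * (C * (w i * pnorm hs)) * e1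
          + 2 ^ length hs * (C * (w i * pnorm hs)) * e1" by (simp add: ac_simps)
      also have "\<dots> \<le> e * (w i * pnorm hs)" using l w[of i] by (intro final) auto
      finally show "\<bar>leib (D i y) (G y) hs - leib (D i x) (G x) hs\<bar> \<le> e * w i * pnorm hs" by (simp add: mult.assoc)
    qed (use d4 d3 in auto)
  qed
qed

lemma jet_add:
  assumes D: "jet k B D" and G: "jet k B G"
  shows "jet k B (\<lambda>x hs. D x hs + G x hs)"
proof -
  obtain C where C: "C \<ge> 0" "\<And>x hs. x \<in> B \<Longrightarrow> length hs \<le> k \<Longrightarrow> \<bar>D x hs\<bar> \<le> C * pnorm hs"
    using jetsD(3)[OF D] by auto
  obtain C' where C': "C' \<ge> 0" "\<And>x hs. x \<in> B \<Longrightarrow> length hs \<le> k \<Longrightarrow> \<bar>G x hs\<bar> \<le> C' * pnorm hs"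
    using jetsD(3)[OF G] by auto
  show ?thesis
  proof (rule jetsI[where C = "C + C'"])
    show "mlin (\<lambda>hs. D x hs + G x hs)" if "x \<in> B" for x
      using jetsD(2)[OF D that] jetsD(2)[OF G that] by (rule mlin_add)
    show "\<bar>D x hs + G x hs\<bar> \<le> (C + C') * 1 * pnorm hs" if "x \<in> B" "length hs \<le> k" for x hs
      using C(2)[OF that] C'(2)[OF that] by (simp add: distrib_right)
    fix x and e :: real assume x: "x \<in> B" and e: "e > 0"
    then have e2: "e / 2 > 0" by simp
    obtain d where d: "d > 0" "\<And>y hs. y \<in> B \<Longrightarrow> norm (y - x) < d \<Longrightarrow> length hs < k \<Longrightarrow>
      \<bar>D y hs - D x hs - D x ((y - x) # hs)\<bar> \<le> e / 2 * norm (y - x) * pnorm hs"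
      using jetsD(4)[OF D x e2] by auto
    obtain d' where d': "d' > 0" "\<And>y hs. y \<in> B \<Longrightarrow> norm (y - x) < d' \<Longrightarrow> length hs < k \<Longrightarrow>
      \<bar>G y hs - G x hs - G x ((y - x) # hs)\<bar> \<le> e / 2 * norm (y - x) * pnorm hs"
      using jetsD(4)[OF G x e2] by auto
    have "\<bar>D y hs + G y hs - (D x hs + G x hs) - (D x ((y - x) # hs) + G x ((y - x) # hs))\<bar> \<le> e * norm (y - x) * 1 * pnorm hs"
      if "y \<in> B" "norm (y - x) < min d d'" "length hs < k" for y hs
      using d(2)[OF that(1) _ that(3)] d'(2)[OF that(1) _ that(3)] that(2) by (simp, linarith)
    then show "\<exists>d>0. \<forall>y\<in>B. norm (y - x) < d \<longrightarrow> (\<forall>i hs. length hs < k \<longrightarrow>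
      \<bar>D y hs + G y hs - (D x hs + G x hs) - (D x ((y - x) # hs) + G x ((y - x) # hs))\<bar> \<le> e * norm (y - x) * 1 * pnorm hs)"
      using d(1) d'(1) by (intro exI[of _ "min d d'"]) auto
    obtain d where d: "d > 0" "\<And>y hs. y \<in> B \<Longrightarrow> norm (y - x) < d \<Longrightarrow> length hs \<le> k \<Longrightarrow>
      \<bar>D y hs - D x hs\<bar> \<le> e / 2 * pnorm hs"
      using jetsD(5)[OF D x e2] by auto
    obtain d' where d': "d' > 0" "\<And>y hs. y \<in> B \<Longrightarrow> norm (y - x) < d' \<Longrightarrow> length hs \<le> k \<Longrightarrow>
      \<bar>G y hs - G x hs\<bar> \<le> e / 2 * pnorm hs"
      using jetsD(5)[OF G x e2] by auto
    have "\<bar>D y hs + G y hs - (D x hs + G x hs)\<bar> \<le> e * 1 * pnorm hs"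
      if "y \<in> B" "norm (y - x) < min d d'" "length hs \<le> k" for y hs
      using d(2)[OF that(1) _ that(3)] d'(2)[OF that(1) _ that(3)] that(2) by (simp, linarith)
    then show "\<exists>d>0. \<forall>y\<in>B. norm (y - x) < d \<longrightarrow> (\<forall>i hs. length hs \<le> k \<longrightarrow>
      \<bar>D y hs + G y hs - (D x hs + G x hs)\<bar> \<le> e * 1 * pnorm hs)"
      using d(1) d'(1) by (intro exI[of _ "min d d'"]) auto
  qed (use C C' in auto)
qed

lemma jet_const: "jet k B (\<lambda>_ hs. if hs = [] then c else 0)"
  by (rule jetsI[where C = "\<bar>c\<bar>"]) (auto simp: mlin_def intro: exI[of _ 1])

lemma jet_scale:
  assumes "jet k B D"
  shows "jet k B (\<lambda>x hs. c * D x hs)"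
proof -
  have "leib (D x) (\<lambda>hs. if hs = [] then c else 0) = (\<lambda>t. c * D x t)" for x
    using leib_scale_right[of "D x" c "\<lambda>q. if q = [] then 1 else 0"] leib_unit_right[of "D x"]
    by (auto simp: if_distrib fun_eq_iff cong: if_cong)
  then show ?thesis using jets_leib[OF assms jet_const[of k B c]] by simp
qed

subsection \<open>The exponential\<close>

lemma abs_exp_minus_one_le: "\<bar>exp u - 1\<bar> \<le> \<bar>u\<bar> * exp \<bar>u\<bar>" for u :: real
proof (cases "u \<ge> 0")
  case True
  have "(1 - u) * exp u \<le> exp (- u) * exp u"
    using exp_ge_add_one_self[of "- u"] by (intro mult_right_mono) auto
  then show ?thesis using True by (simp add: algebra_simps flip: exp_add)
next
  case False
  have "\<bar>u\<bar> * 1 \<le> \<bar>u\<bar> * exp \<bar>u\<bar>" by (intro mult_left_mono) auto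
  moreover have "exp u \<le> 1" "1 + u \<le> exp u" using False by auto
  ultimately show ?thesis using False by linarith
qed

lemma abs_exp_remainder_le: "\<bar>exp u - 1 - u\<bar> \<le> u\<^sup>2 * exp \<bar>u\<bar>" for u :: real
proof -
  have "(1 - u) * exp u \<le> exp (- u) * exp u"
    using exp_ge_add_one_self[of "- u"] by (intro mult_right_mono) auto
  then have "exp u - 1 - u \<le> u * (exp u - 1)" by (simp add: algebra_simps flip: exp_add)
  also have "\<dots> \<le> \<bar>u\<bar> * \<bar>exp u - 1\<bar>" by (simp flip: abs_mult)
  also have "\<dots> \<le> \<bar>u\<bar> * (\<bar>u\<bar> * exp \<bar>u\<bar>)" by (intro mult_left_mono abs_exp_minus_one_le) auto
  also have "\<dots> = u\<^sup>2 * exp \<bar>u\<bar>" by (simp add: power2_eq_square flip: mult.assoc)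
  finally show ?thesis using exp_ge_add_one_self[of u] by linarith
qed

text \<open>
  Since \<open>D (exp a) h = D a h * exp a\<close>, the derivative of \<open>exp a\<close> with innermost direction \<open>h\<close> and further
  directions \<open>t\<close> is a Leibniz sum of the derivatives of \<open>D a h\<close> and of those of \<open>exp a\<close> of lower order. The
  number \<open>n\<close> bounds the depth of the recursion: lists of length at most \<open>n\<close> get their correct value.
\<close>

primrec expj :: "nat \<Rightarrow> ('a list \<Rightarrow> real) \<Rightarrow> 'a list \<Rightarrow> real"
  where
    "expj 0 f = (\<lambda>hs. if hs = [] then exp (f []) else 0)"
  | "expj (Suc n) f = (\<lambda>hs. if hs = [] then exp (f [])
      else leib (\<lambda>p. f (p @ [last hs])) (expj n f) (butlast hs))"

lemma expj_Nil [simp]: "expj n f [] = exp (f [])"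
  by (cases n) auto

lemma expj_snoc [simp]: "expj (Suc n) f (t @ [h]) = leib (\<lambda>p. f (p @ [h])) (expj n f) t"
  by simp

lemma mlin_expj: "mlin f \<Longrightarrow> mlin (expj n f)"
proof (induction n)
  case (Suc n)
  have "expj (Suc n) f (us @ (h + h') # vs) = expj (Suc n) f (us @ h # vs) + expj (Suc n) f (us @ h' # vs) \<and>
    expj (Suc n) f (us @ (c *\<^sub>R h) # vs) = c * expj (Suc n) f (us @ h # vs)" for us vs h h' c
  proof (cases vs rule: rev_cases)
    case Nil
    show ?thesis unfolding Nil expj_snoc
      using mlinD[OF Suc.prems, of _ _ _ "[]"] by (simp add: leib_add_left leib_scale_left)
  next
    case (snoc vs' v)
    note l = mlinD[OF mlin_leib[OF mlin_snoc[OF Suc.prems, of v] Suc.IH[OF Suc.prems]]]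
    show ?thesis unfolding snoc append_Cons[symmetric] append_assoc[symmetric] expj_snoc
      using l by simp
  qed
  then show ?case unfolding mlin_def by blast
qed (simp add: mlin_def)

text \<open>
  The induction on the order splits off the innermost direction, which turns the claim for order
  \<open>Suc n\<close> into the product rule for a family of jets of order \<open>n\<close>.
\<close>

lemma jet_expj:
  fixes D :: "'a::real_normed_vector \<Rightarrow> 'a list \<Rightarrow> real"
  assumes D: "jet k B D"
  shows "n \<le> k \<Longrightarrow> jet n B (\<lambda>x. expj n (D x))"
proof (induction n)
  case 0
  obtain C where C: "C \<ge> 0" "\<And>x hs. x \<in> B \<Longrightarrow> length hs \<le> k \<Longrightarrow> \<bar>D x hs\<bar> \<le> C * pnorm hs"
    using jetsD(3)[OF D] by auto
  show ?case
  proof (rule jetsI[where C = "exp C"])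
    show "mlin (expj 0 (D x))" if "x \<in> B" for x using mlin_expj jetsD(2)[OF D that] by blast
    show "\<bar>expj 0 (D x) hs\<bar> \<le> exp C * 1 * pnorm hs" if "x \<in> B" "length hs \<le> 0" for x hs
      using C(2)[OF that(1), of "[]"] that(2) by auto
    fix x and e :: real assume x: "x \<in> B" and e: "e > 0"
    show "\<exists>d>0. \<forall>y\<in>B. norm (y - x) < d \<longrightarrow> (\<forall>i hs. length hs \<le> 0 \<longrightarrow>
        \<bar>expj 0 (D y) hs - expj 0 (D x) hs\<bar> \<le> e * 1 * pnorm hs)"
    proof -
      have "isCont exp (D x [])" by simp
      then obtain s where s: "s > 0" "\<And>z. \<bar>z - D x []\<bar> < s \<Longrightarrow> \<bar>exp z - exp (D x [])\<bar> < e"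
        unfolding continuous_at_eps_delta using e by (metis dist_real_def)
      obtain d where d: "d > 0" "\<And>y hs. y \<in> B \<Longrightarrow> norm (y - x) < d \<Longrightarrow> length hs \<le> k \<Longrightarrow> \<bar>D y hs - D x hs\<bar> \<le> s / 2 * pnorm hs"
        using jetsD(5)[OF D x, of "s / 2"] s by auto
      have "\<bar>exp (D y []) - exp (D x [])\<bar> \<le> e" if "y \<in> B" "norm (y - x) < d" for y
        using s(2)[of "D y []"] d(2)[OF that, of "[]"] s(1) by simp
      then show ?thesis using d(1) by (intro exI[of _ d]) auto
    qed
  qed auto
next
  case (Suc n)
  then have n: "n < k" and IH: "jet n B (\<lambda>x. expj n (D x))" by auto
  define G where "G i x = leib (\<lambda>p. D x (p @ [i])) (expj n (D x))" for i x
  have G: "jets n B norm G" unfolding G_def by (rule jets_leib[OF jets_snoc[OF D n] IH])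
  have EG: "expj (Suc n) (D x) (t @ [h]) = G h x t" for x t h by (simp add: G_def)
  obtain C where C: "C \<ge> 0" "\<And>x hs. x \<in> B \<Longrightarrow> length hs \<le> k \<Longrightarrow> \<bar>D x hs\<bar> \<le> C * pnorm hs"
    using jetsD(3)[OF D] by auto
  obtain C' where C': "C' \<ge> 0" "\<And>i x hs. x \<in> B \<Longrightarrow> length hs \<le> n \<Longrightarrow> \<bar>G i x hs\<bar> \<le> C' * norm i * pnorm hs"
    using jetsD(3)[OF G] by blast
  show ?case
  proof (rule jetsI[where C = "exp C + C'"])
    show "mlin (expj (Suc n) (D x))" if "x \<in> B" for x using mlin_expj jetsD(2)[OF D that] by blast
    show "\<bar>expj (Suc n) (D x) hs\<bar> \<le> (exp C + C') * 1 * pnorm hs" if "x \<in> B" "length hs \<le> Suc n" for x hs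
    proof (cases hs rule: rev_cases)
      case Nil
      have "exp (D x []) \<le> exp C" using C(2)[OF that(1), of "[]"] by auto
      then have "exp (D x []) \<le> exp C + C'" using C'(1) by linarith
      then show ?thesis by (simp add: Nil)
    next
      case (snoc t h)
      have "\<bar>G h x t\<bar> \<le> C' * norm h * pnorm t" using C'(2)[OF that(1)] that(2) snoc by simp
      also have "\<dots> \<le> (exp C + C') * (norm h * pnorm t)" by (simp only: mult.assoc) (intro mult_right_mono, auto)
      finally show ?thesis unfolding snoc EG by (simp add: ac_simps)
    qed
    fix x and e :: real assume x: "x \<in> B" and e: "e > 0"
    define E where "E = exp (D x [])"
    have E: "E > 0" by (simp add: E_def)
    show "\<exists>d>0. \<forall>y\<in>B. norm (y - x) < d \<longrightarrow> (\<forall>i hs. length hs < Suc n \<longrightarrow>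
      \<bar>expj (Suc n) (D y) hs - expj (Suc n) (D x) hs - expj (Suc n) (D x) ((y - x) # hs)\<bar> \<le> e * norm (y - x) * 1 * pnorm hs)"
    proof -
      obtain d where d: "d > 0" "\<And>y i hs. y \<in> B \<Longrightarrow> norm (y - x) < d \<Longrightarrow> length hs < n \<Longrightarrow>
        \<bar>G i y hs - G i x hs - G i x ((y - x) # hs)\<bar> \<le> e * norm (y - x) * norm i * pnorm hs"
        using jetsD(4)[OF G x e] by blast
      define e1 where "e1 = min 1 (e / (2 * E))"
      have e1: "e1 > 0" "e1 \<le> 1" "e1 * E \<le> e / 2" using e E by (auto simp: e1_def min_def field_simps)
      obtain d' where d': "d' > 0" "\<And>y hs. y \<in> B \<Longrightarrow> norm (y - x) < d' \<Longrightarrow> length hs < k \<Longrightarrow>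
        \<bar>D y hs - D x hs - D x ((y - x) # hs)\<bar> \<le> e1 * norm (y - x) * pnorm hs"
        using jetsD(4)[OF D x e1(1)] by auto
      define K where "K = C + 1"
      have K: "K > 0" using C by (simp add: K_def)
      define d'' where "d'' = min (1 / K) (e / (2 * E * K\<^sup>2 * exp 1))"
      have d'': "d'' > 0" using K e E by (simp add: d''_def)
      have nil: "\<bar>exp (D y []) - exp (D x []) - D x [y - x] * exp (D x [])\<bar> \<le> e * norm (y - x)"
        if y: "y \<in> B" "norm (y - x) < min d' d''" for y
      proof -
        define u where "u = D y [] - D x []"
        have l: "\<bar>u - D x [y - x]\<bar> \<le> e1 * norm (y - x)" using d'(2)[OF y(1), of "[]"] y(2) n by (simp add: u_def)
        have "\<bar>D x [y - x]\<bar> \<le> C * norm (y - x)" using C(2)[OF x, of "[y - x]"] n by simp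
        moreover have "e1 * norm (y - x) \<le> norm (y - x)" using e1 mult_right_mono[of e1 1 "norm (y - x)"] by simp
        ultimately have u: "\<bar>u\<bar> \<le> K * norm (y - x)" using l by (simp add: K_def algebra_simps)
        have nd: "norm (y - x) \<le> 1 / K" "norm (y - x) \<le> e / (2 * E * K\<^sup>2 * exp 1)" using y(2) by (auto simp: d''_def)
        have "K * norm (y - x) \<le> 1" using nd(1) K by (simp add: field_simps)
        then have u1: "\<bar>u\<bar> \<le> 1" using u by simp
        have "norm (y - x) * (2 * E * K\<^sup>2 * exp 1) \<le> e" using nd(2) E K by (simp add: field_simps)
        then have nd2: "E * K\<^sup>2 * exp 1 * norm (y - x) \<le> e / 2" by (simp add: ac_simps)
        have "exp (D y []) = E * exp u" by (simp add: E_def u_def flip: exp_add)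
        then have "exp (D y []) - exp (D x []) - D x [y - x] * exp (D x []) = E * (exp u - 1 - u) + E * (u - D x [y - x])"
          by (simp add: E_def algebra_simps)
        also have "\<bar>\<dots>\<bar> \<le> E * \<bar>exp u - 1 - u\<bar> + E * \<bar>u - D x [y - x]\<bar>"
          using E by (intro order_trans[OF abs_triangle_ineq]) (simp add: abs_mult)
        also have "\<dots> \<le> E * (\<bar>u\<bar> ^ 2 * exp \<bar>u\<bar>) + E * (e1 * norm (y - x))"
          using l E abs_exp_remainder_le[of u] by (intro add_mono mult_left_mono) auto
        also have "\<dots> \<le> E * ((K * norm (y - x)) ^ 2 * exp 1) + E * (e1 * norm (y - x))"
          using u u1 E e1 by (intro add_mono mult_left_mono mult_mono power_mono) auto
        also have "\<dots> = (E * K\<^sup>2 * exp 1 * norm (y - x)) * norm (y - x) + (e1 * E) * norm (y - x)"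
          by (simp add: power2_eq_square ac_simps)
        also have "\<dots> \<le> e / 2 * norm (y - x) + e / 2 * norm (y - x)"
          using nd2 e1 by (intro add_mono mult_right_mono) auto
        finally show ?thesis by simp
      qed
      have "\<bar>expj (Suc n) (D y) hs - expj (Suc n) (D x) hs - expj (Suc n) (D x) ((y - x) # hs)\<bar> \<le> e * norm (y - x) * 1 * pnorm hs"
        if y: "y \<in> B" "norm (y - x) < min d (min d' d'')" and l: "length hs < Suc n" for y hs
      proof (cases hs rule: rev_cases)
        case Nil
        then show ?thesis using nil[OF y(1)] y(2) expj_snoc[of n "D x" "[]" "y - x"] by simp
      next
        case (snoc t h)
        have "\<bar>G h y t - G h x t - G h x ((y - x) # t)\<bar> \<le> e * norm (y - x) * norm h * pnorm t"
          using d(2)[OF y(1)] y(2) l snoc by simp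
        then show ?thesis unfolding snoc append_Cons[symmetric] EG by (simp add: ac_simps)
      qed
      then show ?thesis using d d' d'' by (intro exI[of _ "min d (min d' d'')"]) auto
    qed
    show "\<exists>d>0. \<forall>y\<in>B. norm (y - x) < d \<longrightarrow> (\<forall>i hs. length hs \<le> Suc n \<longrightarrow>
        \<bar>expj (Suc n) (D y) hs - expj (Suc n) (D x) hs\<bar> \<le> e * 1 * pnorm hs)"
    proof -
      obtain d where d: "d > 0" "\<And>y i hs. y \<in> B \<Longrightarrow> norm (y - x) < d \<Longrightarrow> length hs \<le> n \<Longrightarrow>
        \<bar>G i y hs - G i x hs\<bar> \<le> e * norm i * pnorm hs"
        using jetsD(5)[OF G x e] by blast
      obtain d' where d': "d' > 0" "\<And>y hs. y \<in> B \<Longrightarrow> norm (y - x) < d' \<Longrightarrow> length hs \<le> n \<Longrightarrow>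
        \<bar>expj n (D y) hs - expj n (D x) hs\<bar> \<le> e * pnorm hs"
        using jetsD(5)[OF IH x e] by auto
      have "\<bar>expj (Suc n) (D y) hs - expj (Suc n) (D x) hs\<bar> \<le> e * 1 * pnorm hs"
        if y: "y \<in> B" "norm (y - x) < min d d'" and l: "length hs \<le> Suc n" for y hs
      proof (cases hs rule: rev_cases)
        case Nil
        then show ?thesis using d'(2)[OF y(1), of "[]"] y(2) by simp
      next
        case (snoc t h)
        have "\<bar>G h y t - G h x t\<bar> \<le> e * norm h * pnorm t"
          using d(2)[OF y(1)] y(2) l snoc by simp
        then show ?thesis unfolding snoc EG by (simp add: ac_simps)
      qed
      then show ?thesis using d d' by (intro exI[of _ "min d d'"]) auto
    qed
  qed (use C C' in auto)
qed

text \<open>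
  Unfolding the recursion of \<open>expj k f t\<close> yields one term for every set partition of \<open>t\<close>. Subtracting \<open>f t\<close>
  removes the partition into a single block, and the others are at least quadratic in \<open>f\<close>.
\<close>

lemma expj_bounds:
  fixes k :: nat
  obtains K where "K > 0"
    "\<And>(f :: 'a::real_normed_vector list \<Rightarrow> real) r t. 0 \<le> r \<Longrightarrow> r \<le> 1 \<Longrightarrow>
      (\<And>p. length p \<le> k \<Longrightarrow> \<bar>f p\<bar> \<le> r * pnorm p) \<Longrightarrow> length t \<le> k \<Longrightarrow>
      \<bar>expj k f t - (if t = [] then 1 else 0) - f t\<bar> \<le> K * r\<^sup>2 * pnorm t"
proof -
  let ?\<delta> = "\<lambda>t :: 'a list. if t = [] then 1 else (0::real)"
  have "\<exists>K>0. \<forall>(f :: 'a list \<Rightarrow> real) r. 0 \<le> r \<and> r \<le> 1 \<and> (\<forall>p. length p \<le> n \<longrightarrow> \<bar>f p\<bar> \<le> r * pnorm p) \<longrightarrow>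
    (\<forall>t. length t \<le> n \<longrightarrow> \<bar>expj n f t\<bar> \<le> K * pnorm t \<and> \<bar>expj n f t - ?\<delta> t\<bar> \<le> K * r * pnorm t \<and>
       \<bar>expj n f t - ?\<delta> t - f t\<bar> \<le> K * r\<^sup>2 * pnorm t)" for n
  proof (induction n)
    case 0
    show ?case
    proof (intro exI[of _ "exp 1"] conjI allI impI)
      fix f :: "'a list \<Rightarrow> real" and r and t :: "'a list"
      assume a: "0 \<le> r \<and> r \<le> 1 \<and> (\<forall>p. length p \<le> 0 \<longrightarrow> \<bar>f p\<bar> \<le> r * pnorm p)" and "length t \<le> 0"
      then have t: "t = []" and f: "\<bar>f []\<bar> \<le> r" by auto
      then have f1: "\<bar>f []\<bar> \<le> 1" using a by linarith
      show "\<bar>expj 0 f t\<bar> \<le> exp 1 * pnorm t" using f1 by (simp add: t)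
      have "\<bar>exp (f []) - 1\<bar> \<le> \<bar>f []\<bar> * exp \<bar>f []\<bar>" by (rule abs_exp_minus_one_le)
      also have "\<dots> \<le> r * exp 1" using f f1 a by (intro mult_mono) auto
      finally show "\<bar>expj 0 f t - ?\<delta> t\<bar> \<le> exp 1 * r * pnorm t" by (simp add: t mult.commute)
      have "\<bar>exp (f []) - 1 - f []\<bar> \<le> \<bar>f []\<bar>\<^sup>2 * exp \<bar>f []\<bar>" using abs_exp_remainder_le[of "f []"] by simp
      also have "\<dots> \<le> r\<^sup>2 * exp 1" using f f1 a by (intro mult_mono power_mono) auto
      finally show "\<bar>expj 0 f t - ?\<delta> t - f t\<bar> \<le> exp 1 * r\<^sup>2 * pnorm t" by (simp add: t mult.commute)
    qed auto
  next
    case (Suc n)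
    obtain K where K: "K > 0" and KI: "\<And>(f :: 'a list \<Rightarrow> real) r t. 0 \<le> r \<Longrightarrow> r \<le> 1 \<Longrightarrow>
      (\<And>p. length p \<le> n \<Longrightarrow> \<bar>f p\<bar> \<le> r * pnorm p) \<Longrightarrow> length t \<le> n \<Longrightarrow>
      \<bar>expj n f t\<bar> \<le> K * pnorm t \<and> \<bar>expj n f t - ?\<delta> t\<bar> \<le> K * r * pnorm t \<and> \<bar>expj n f t - ?\<delta> t - f t\<bar> \<le> K * r\<^sup>2 * pnorm t"
      using Suc.IH by blast
    define L where "L = K + 2 ^ n * K + 2 ^ n * K"
    have L: "L > 0" "K \<le> L" "2 ^ n * K \<le> L" using K by (auto simp: L_def intro!: add_nonneg_pos)
    show ?case
    proof (intro exI[of _ L] conjI allI impI L)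
      fix f :: "'a list \<Rightarrow> real" and r and t :: "'a list"
      assume a: "0 \<le> r \<and> r \<le> 1 \<and> (\<forall>p. length p \<le> Suc n \<longrightarrow> \<bar>f p\<bar> \<le> r * pnorm p)" and l: "length t \<le> Suc n"
      have r: "0 \<le> r" "r \<le> 1" and f: "\<And>p. length p \<le> Suc n \<Longrightarrow> \<bar>f p\<bar> \<le> r * pnorm p" using a by auto
      have KJ: "\<bar>expj n f t\<bar> \<le> K * pnorm t \<and> \<bar>expj n f t - ?\<delta> t\<bar> \<le> K * r * pnorm t \<and> \<bar>expj n f t - ?\<delta> t - f t\<bar> \<le> K * r\<^sup>2 * pnorm t"
        if "length t \<le> n" for t
        using KI[OF r, of f t] f that by auto
      have "\<bar>expj (Suc n) f t\<bar> \<le> L * pnorm t \<and> \<bar>expj (Suc n) f t - ?\<delta> t\<bar> \<le> L * r * pnorm t \<and>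
        \<bar>expj (Suc n) f t - ?\<delta> t - f t\<bar> \<le> L * r\<^sup>2 * pnorm t"
      proof (cases t rule: rev_cases)
        case Nil
        have "K * r \<le> L * r" "K * r\<^sup>2 \<le> L * r\<^sup>2" using r L by (auto intro: mult_right_mono)
        then show ?thesis using KJ[of "[]"] L(2) by (auto simp: Nil)
      next
        case (snoc s h)
        have s: "length s \<le> n" using l snoc by simp
        have pw: "2 ^ length s \<le> (2::real) ^ n" using s by (intro power_increasing) auto
        have fh: "\<bar>f (p @ [h])\<bar> \<le> (r * norm h) * pnorm p" if "length p \<le> length s" for p
          using f[of "p @ [h]"] that s by (simp add: ac_simps)
        have e: "expj (Suc n) f t = leib (\<lambda>p. f (p @ [h])) (expj n f) s" unfolding snoc by (rule expj_snoc)
        have "\<bar>leib (\<lambda>p. f (p @ [h])) (expj n f) s\<bar> \<le> 2 ^ length s * (r * norm h) * K * pnorm s"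
          using KJ fh s by (intro leib_bound) auto
        also have "\<dots> = 2 ^ length s * (K * r * pnorm t)" by (simp add: snoc)
        also have "\<dots> \<le> 2 ^ n * (K * r * pnorm t)" using pw K r by (intro mult_right_mono) auto
        also have "\<dots> = 2 ^ n * K * (r * pnorm t)" by simp
        also have "\<dots> \<le> L * (r * pnorm t)" using L r by (intro mult_right_mono) auto
        finally have 1: "\<bar>expj (Suc n) f t\<bar> \<le> L * r * pnorm t" unfolding e by (simp add: mult.assoc)
        have "L * r * pnorm t \<le> L * 1 * pnorm t" using L r by (intro mult_right_mono mult_left_mono) auto
        then have 2: "\<bar>expj (Suc n) f t\<bar> \<le> L * pnorm t" using 1 by linarith
        have e2: "expj (Suc n) f t - f t = leib (\<lambda>p. f (p @ [h])) (\<lambda>q. expj n f q - ?\<delta> q) s"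
          unfolding e leib_diff_right leib_unit_right by (simp add: snoc)
        have "\<bar>leib (\<lambda>p. f (p @ [h])) (\<lambda>q. expj n f q - ?\<delta> q) s\<bar> \<le> 2 ^ length s * (r * norm h) * (K * r) * pnorm s"
          using KJ fh s by (intro leib_bound) auto
        also have "\<dots> = 2 ^ length s * (K * r\<^sup>2 * pnorm t)" by (simp add: snoc power2_eq_square)
        also have "\<dots> \<le> 2 ^ n * (K * r\<^sup>2 * pnorm t)" using pw K r by (intro mult_right_mono) auto
        also have "\<dots> = 2 ^ n * K * (r\<^sup>2 * pnorm t)" by simp
        also have "\<dots> \<le> L * (r\<^sup>2 * pnorm t)" using L r by (intro mult_right_mono) auto
        finally have 3: "\<bar>expj (Suc n) f t - f t\<bar> \<le> L * r\<^sup>2 * pnorm t"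
          unfolding e2 by (simp add: mult.assoc)
        have "t \<noteq> []" by (simp add: snoc)
        then have "?\<delta> t = 0" by simp
        then show ?thesis using 1 2 3 by (simp del: expj.simps)
      qed
      then show "\<bar>expj (Suc n) f t\<bar> \<le> L * pnorm t" "\<bar>expj (Suc n) f t - ?\<delta> t\<bar> \<le> L * r * pnorm t"
        "\<bar>expj (Suc n) f t - ?\<delta> t - f t\<bar> \<le> L * r\<^sup>2 * pnorm t" by blast+
    qed
  qed
  from this[of k] show thesis using that by blast
qed

text \<open>
  Combines the conditions on the finitely many orders of derivatives, which \<open>Ck_on\<close> states separately.
\<close>

lemma ex_uniform_radius:
  fixes B :: "'a::real_normed_vector set" and n :: nat
  assumes "\<And>i. i < n \<Longrightarrow> \<exists>d>0. \<forall>y\<in>B. norm (y - x) < d \<longrightarrow> Q i y"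
  shows "\<exists>d>0. \<forall>y\<in>B. norm (y - x) < d \<longrightarrow> (\<forall>i<n. Q i y)"
  using assms
proof (induction n)
  case 0
  show ?case by (intro exI[of _ 1]) auto
next
  case (Suc n)
  obtain d where "d > 0" "\<And>y. y \<in> B \<Longrightarrow> norm (y - x) < d \<Longrightarrow> \<forall>i<n. Q i y"
    using Suc.IH Suc.prems less_Suc_eq by (metis (no_types, lifting))
  moreover obtain d' where "d' > 0" "\<And>y. y \<in> B \<Longrightarrow> norm (y - x) < d' \<Longrightarrow> Q n y"
    using Suc.prems[of n] by auto
  ultimately show ?case by (intro exI[of _ "min d d'"]) (auto simp: less_Suc_eq)
qed

lemma multilin_nrm_le_pnorm:
  fixes T :: "'a::real_normed_vector list \<Rightarrow> real"
  assumes "0 \<le> C" "\<And>hs. length hs = i \<Longrightarrow> \<bar>T hs\<bar> \<le> C * pnorm hs"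
  shows "nrm (multilin i type_space type_space) T \<le> C"
proof (rule multilin_nrm_le[OF normed_carrier_type_space])
  fix hs :: "'a list"
  assume hs: "length hs = i" "set hs \<subseteq> vecs type_space" "\<And>h. h \<in> set hs \<Longrightarrow> nrm type_space h \<le> 1"
  have "pnorm hs \<le> 1"
    using normed_carrier.prod_nrm_le_1[OF normed_carrier_type_space hs(2,3)] by simp
  then have "C * pnorm hs \<le> C * 1" using assms(1) by (rule mult_left_mono)
  then show "nrm type_space (T hs) \<le> C" using assms(2)[OF hs(1)] by simp
qed

lemma level_type_space: "level i type_space D x = (\<lambda>hs. if length hs = i then D x hs else 0)"
  by (simp add: level_def)

lemma level_mem_multilin:
  assumes "jet k B D" "i \<le> k" "x \<in> B"
  shows "level i type_space D x \<in> vecs (multilin i type_space type_space)"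
proof -
  obtain C where "C \<ge> 0" "\<And>x hs. x \<in> B \<Longrightarrow> length hs \<le> k \<Longrightarrow> \<bar>D x hs\<bar> \<le> C * pnorm hs"
    using jetsD(3)[OF assms(1)] by auto
  then show ?thesis using assms(2,3) mlinD[OF jetsD(2)[OF assms(1,3)]]
    by (intro multilin_memI[where C = C]) (auto simp: level_type_space)
qed

lemma level_has_fderiv:
  assumes "jet k B D" "i < k" "x \<in> B"
  shows "has_fderiv type_space (multilin i type_space type_space) B (level i type_space D)
    (\<lambda>h t. level (Suc i) type_space D x (h # t)) x"
proof (rule has_fderivI)
  show "(\<lambda>h t. level (Suc i) type_space D x (h # t)) \<in> bounded_lin type_space (multilin i type_space type_space)"
    using assms by (intro curry_bounded_lin normed_carrier_type_space level_mem_multilin) auto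
  fix e :: real assume e: "e > 0"
  obtain d where d: "d > 0" "\<And>y hs. y \<in> B \<Longrightarrow> norm (y - x) < d \<Longrightarrow> length hs < k \<Longrightarrow>
    \<bar>D y hs - D x hs - D x ((y - x) # hs)\<bar> \<le> e * norm (y - x) * pnorm hs"
    using jetsD(4)[OF assms(1,3) e] by auto
  have "nrm (multilin i type_space type_space) (level i type_space D y - level i type_space D x -
    (\<lambda>t. level (Suc i) type_space D x ((y - x) # t))) \<le> e * norm (y - x)"
    if y: "y \<in> B" "norm (y - x) < d" for y
    using d(2)[OF y] e assms(2) by (intro multilin_nrm_le_pnorm) (auto simp: level_type_space)
  then show "\<exists>d>0. \<forall>y\<in>B. nrm type_space (y - x) < d \<longrightarrow> nrm (multilin i type_space type_space)
    (level i type_space D y - level i type_space D x - (\<lambda>t. level (Suc i) type_space D x ((y - x) # t)))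
    \<le> e * nrm type_space (y - x)" using d(1) by auto
qed

text \<open>
  Cut off above \<open>k\<close>, so that it is multilinear in lists of all lengths.
\<close>

definition jet_of :: "nat \<Rightarrow> 'a::banach set \<Rightarrow> ('a \<Rightarrow> real) \<Rightarrow> 'a \<Rightarrow> 'a list \<Rightarrow> real"
  where "jet_of k B a x hs = (if length hs \<le> k then nth_fderiv (length hs) type_space type_space B a x hs else 0)"

locale Cbk_domain =
  fixes k :: nat and B :: "'a::banach set"
  assumes open_B: "open B" and B_nonempty: "B \<noteq> {}"
begin

abbreviation G where "G \<equiv> Cbk k B"
abbreviation Mlin :: "nat \<Rightarrow> ('a list \<Rightarrow> real) nspace" where "Mlin i \<equiv> multilin i type_space type_space"
abbreviation nth where "nth i a \<equiv> nth_fderiv i type_space type_space B a"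

lemma normed_Mlin: "normed_carrier (Mlin i)"
  by (intro normed_carrier_multilin normed_carrier_type_space)

lemma nth_jet:
  assumes "jet k B D" "\<forall>x\<in>B. a x = D x []" "i \<le> k" "x \<in> B"
  shows "nth i a x = level i type_space D x"
  using assms level_mem_multilin[OF assms(1)] level_has_fderiv[OF assms(1)] open_B
  by (intro nth_fderiv_eq_level[where k = k] normed_carrier_type_space inner_point_open) auto

lemma jet_Ck_on:
  assumes "jet k B D" "\<forall>x\<in>B. a x = D x []"
  shows "Ck_on k type_space type_space B a"
  unfolding Ck_on_def
proof (intro conjI allI impI ballI)
  note n = nth_jet[OF assms]
  fix i x assume i: "i < k" and x: "x \<in> B"
  have "has_fderiv type_space (Mlin i) B (nth i a) (\<lambda>h t. level (Suc i) type_space D x (h # t)) x"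
    using has_fderiv_cong[of B "nth i a" "level i type_space D" x] n[of i] level_has_fderiv[OF assms(1) i x] i x by simp
  then show "\<exists>A. has_fderiv type_space (Mlin i) B (nth i a) A x" by blast
next
  note n = nth_jet[OF assms]
  fix i assume i: "i \<le> k"
  show "ncontinuous_on type_space (Mlin i) B (nth i a)"
    unfolding ncontinuous_on_def
  proof (intro ballI allI impI)
    fix x and e :: real assume x: "x \<in> B" and e: "e > 0"
    obtain d where d: "d > 0" "\<And>y hs. y \<in> B \<Longrightarrow> norm (y - x) < d \<Longrightarrow> length hs \<le> k \<Longrightarrow>
      \<bar>D y hs - D x hs\<bar> \<le> e / 2 * pnorm hs"
      using jetsD(5)[OF assms(1) x, of "e / 2"] e by auto
    have "nrm (Mlin i) (nth i a y - nth i a x) < e" if y: "y \<in> B" "norm (y - x) < d" for y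
    proof -
      have "nrm (Mlin i) (nth i a y - nth i a x) \<le> e / 2"
        using d(2)[OF y] e i n[OF i] x y(1) by (intro multilin_nrm_le_pnorm) (auto simp: level_type_space)
      then show ?thesis using e by simp
    qed
    then show "\<exists>d>0. \<forall>y\<in>B. nrm type_space (y - x) < d \<longrightarrow> nrm (Mlin i) (nth i a y - nth i a x) < e"
      using d(1) by auto
  qed
qed auto

text \<open>
  The way in which functions are shown to belong to \<open>C\<^sub>b\<^sup>k(B)\<close>; \<open>jet_jet_of\<close> is the converse.
\<close>

lemma jet_mem:
  assumes "jet k B D" "\<forall>x\<in>B. a x = D x []" "\<And>x. x \<notin> B \<Longrightarrow> a x = 0"
  shows "a \<in> vecs G"
proof -
  obtain C where C: "C \<ge> 0" "\<And>x hs. x \<in> B \<Longrightarrow> length hs \<le> k \<Longrightarrow> \<bar>D x hs\<bar> \<le> C * pnorm hs"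
    using jetsD(3)[OF assms(1)] by auto
  have "nrm (Mlin i) (nth i a x) \<le> C" if "i \<le> k" "x \<in> B" for i x
    using C that nth_jet[OF assms(1,2) that] by (intro multilin_nrm_le_pnorm) (auto simp: level_type_space)
  then have "bdd_above ((\<lambda>x. nrm (Mlin i) (nth i a x)) ` B)" if "i \<le> k" for i
    using that by (intro bdd_aboveI2[where M = C]) auto
  then show ?thesis using jet_Ck_on[OF assms(1,2)] assms(3) unfolding Cbk_def by simp
qed

lemma jet_of_unique:
  assumes "jet k B D" "\<forall>x\<in>B. a x = D x []" "x \<in> B" "length hs \<le> k"
  shows "jet_of k B a x hs = D x hs"
  using nth_jet[OF assms(1,2) assms(4,3)] assms(4) by (simp add: jet_of_def level_type_space)

lemma jet_of_Nil [simp]: "jet_of k B a x [] = a x"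
  by (simp add: jet_of_def)

lemma memD:
  assumes "a \<in> vecs G"
  shows "x \<notin> B \<Longrightarrow> a x = 0" and "Ck_on k type_space type_space B a"
    and "i \<le> k \<Longrightarrow> bdd_above ((\<lambda>x. nrm (Mlin i) (nth i a x)) ` B)"
  using assms unfolding Cbk_def by auto

lemma nth_mem: "a \<in> vecs G \<Longrightarrow> i \<le> k \<Longrightarrow> x \<in> B \<Longrightarrow> nth i a x \<in> vecs (Mlin i)"
  using memD(2) open_B
  by (intro Ck_on_nth_mem[where k = k] normed_carrier_type_space inner_point_open) auto

lemma nth_has_fderiv: "a \<in> vecs G \<Longrightarrow> i < k \<Longrightarrow> x \<in> B \<Longrightarrow>
    has_fderiv type_space (Mlin i) B (nth i a) (\<lambda>h t. nth (Suc i) a x (h # t)) x"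
  using memD(2) open_B
  by (intro Ck_on_nth_has_fderiv[where k = k] normed_carrier_type_space inner_point_open) auto

lemma nrm_G: "nrm G a = (\<Sum>i\<le>k. SUP x\<in>B. nrm (Mlin i) (nth i a x))"
  by (simp add: Cbk_def)

lemma nth_le_SUP:
  assumes "a \<in> vecs G" "i \<le> k" "x \<in> B"
  shows "nrm (Mlin i) (nth i a x) \<le> (SUP x\<in>B. nrm (Mlin i) (nth i a x))"
  by (rule cSUP_upper[OF assms(3) memD(3)[OF assms(1,2)]])

lemma SUP_nth_nonneg:
  assumes "a \<in> vecs G" "i \<le> k"
  shows "0 \<le> (SUP x\<in>B. nrm (Mlin i) (nth i a x))"
proof -
  obtain x where x: "x \<in> B" using B_nonempty by blast
  show ?thesis using nth_le_SUP[OF assms x] normed_carrier.nrm_nonneg[OF normed_Mlin nth_mem[OF assms x]] by linarith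
qed

lemma nth_le_nrm:
  assumes "a \<in> vecs G" "i \<le> k" "x \<in> B"
  shows "nrm (Mlin i) (nth i a x) \<le> nrm G a"
proof -
  have "(SUP x\<in>B. nrm (Mlin i) (nth i a x)) \<le> nrm G a"
    unfolding nrm_G using assms(1,2) SUP_nth_nonneg by (intro member_le_sum) auto
  then show ?thesis using nth_le_SUP[OF assms] by linarith
qed

lemma jet_of_bound:
  assumes "a \<in> vecs G" "length hs \<le> k" "x \<in> B"
  shows "\<bar>jet_of k B a x hs\<bar> \<le> nrm G a * pnorm hs"
proof -
  have "\<bar>nth (length hs) a x hs\<bar> \<le> nrm (Mlin (length hs)) (nth (length hs) a x) * pnorm hs"
    using multilin_apply_le[OF normed_carrier_type_space normed_carrier_type_space nth_mem[OF assms], of hs] by simp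
  also have "\<dots> \<le> nrm G a * pnorm hs" by (intro mult_right_mono nth_le_nrm assms) auto
  finally show ?thesis using assms(2) by (simp add: jet_of_def)
qed

text \<open>
  With \<open>jet_of_bound\<close>: up to the factor \<open>Suc k\<close>, the number of orders, the norm is the least constant that
  bounds the jet.
\<close>

lemma nrm_le_jet:
  assumes "\<And>x hs. x \<in> B \<Longrightarrow> length hs \<le> k \<Longrightarrow> \<bar>jet_of k B a x hs\<bar> \<le> C * pnorm hs"
  shows "nrm G a \<le> real (Suc k) * C"
proof -
  obtain x0 where x0: "x0 \<in> B" using B_nonempty by blast
  have C: "C \<ge> 0" using assms[OF x0, of "[]"] by (simp add: abs_le_iff)
  have "(SUP x\<in>B. nrm (Mlin i) (nth i a x)) \<le> C" if "i \<le> k" for i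
  proof (rule cSUP_least[OF B_nonempty])
    fix x assume x: "x \<in> B"
    have "\<bar>nth i a x hs\<bar> \<le> C * pnorm hs" if "length hs = i" for hs
      using assms[OF x, of hs] that \<open>i \<le> k\<close> by (simp add: jet_of_def)
    then show "nrm (Mlin i) (nth i a x) \<le> C" by (rule multilin_nrm_le_pnorm[OF C])
  qed
  then have "(\<Sum>i\<le>k. SUP x\<in>B. nrm (Mlin i) (nth i a x)) \<le> (\<Sum>i\<le>k. C)" by (intro sum_mono) auto
  then show ?thesis unfolding nrm_G by simp
qed

lemma jet_jet_of:
  assumes a: "a \<in> vecs G"
  shows "jet k B (jet_of k B a)"
proof (rule jetsI[where C = "nrm G a"])
  obtain x0 where x0: "x0 \<in> B" using B_nonempty by blast
  show "0 \<le> nrm G a" using nth_le_nrm[OF a _ x0, of 0] normed_carrier.nrm_nonneg[OF normed_Mlin nth_mem[OF a _ x0], of 0]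
    by simp
  show "\<bar>jet_of k B a x hs\<bar> \<le> nrm G a * 1 * pnorm hs" if "x \<in> B" "length hs \<le> k" for x hs
    using jet_of_bound[OF a that(2,1)] by simp
  show "mlin (jet_of k B a x)" if x: "x \<in> B" for x
    unfolding mlin_def
  proof (intro conjI allI)
    fix us vs :: "'a list" and h h' c
    show "jet_of k B a x (us @ (h + h') # vs) = jet_of k B a x (us @ h # vs) + jet_of k B a x (us @ h' # vs)"
      using multilin_memD(2)[OF nth_mem[OF a _ x], of "length us + 1 + length vs" h h' us vs]
      by (simp add: jet_of_def)
    show "jet_of k B a x (us @ (c *\<^sub>R h) # vs) = c * jet_of k B a x (us @ h # vs)"
      using multilin_memD(3)[OF nth_mem[OF a _ x], of "length us + 1 + length vs" h us vs c]
      by (simp add: jet_of_def)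
  qed
  fix x and e :: real assume x: "x \<in> B" and e: "e > 0"
  have "\<exists>d>0. \<forall>y\<in>B. norm (y - x) < d \<longrightarrow>
      nrm (Mlin i) (nth i a y - nth i a x - (\<lambda>t. nth (Suc i) a x ((y - x) # t))) \<le> e * norm (y - x)" if "i < k" for i
    using has_fderivD(2)[OF nth_has_fderiv[OF a that x] e] by simp
  then obtain d where d: "d > 0" "\<And>y i. y \<in> B \<Longrightarrow> norm (y - x) < d \<Longrightarrow> i < k \<Longrightarrow>
      nrm (Mlin i) (nth i a y - nth i a x - (\<lambda>t. nth (Suc i) a x ((y - x) # t))) \<le> e * norm (y - x)"
    using ex_uniform_radius[of k B x "\<lambda>i y. nrm (Mlin i) (nth i a y - nth i a x -
      (\<lambda>t. nth (Suc i) a x ((y - x) # t))) \<le> e * norm (y - x)"] by blast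
  show "\<exists>d>0. \<forall>y\<in>B. norm (y - x) < d \<longrightarrow> (\<forall>i hs. length hs < k \<longrightarrow>
    \<bar>jet_of k B a y hs - jet_of k B a x hs - jet_of k B a x ((y - x) # hs)\<bar> \<le> e * norm (y - x) * 1 * pnorm hs)"
  proof (intro exI[of _ d] conjI ballI allI impI d(1))
    fix y and hs :: "'a list" assume y: "y \<in> B" "norm (y - x) < d" and l: "length hs < k"
    let ?T = "nth (length hs) a y - nth (length hs) a x - (\<lambda>t. nth (Suc (length hs)) a x ((y - x) # t))"
    interpret M: normed_carrier "Mlin (length hs)" by (rule normed_Mlin)
    have "?T \<in> vecs (Mlin (length hs))"
      using l x y nth_mem[OF a] bounded_linD(1)[OF has_fderivD(1)[OF nth_has_fderiv[OF a l x]], of "y - x"]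
      by (intro M.diff_mem) auto
    then have "\<bar>?T hs\<bar> \<le> nrm (Mlin (length hs)) ?T * pnorm hs"
      using multilin_apply_le[OF normed_carrier_type_space normed_carrier_type_space, of ?T "length hs" hs] by simp
    also have "\<dots> \<le> e * norm (y - x) * pnorm hs" using d(2)[OF y l] by (intro mult_right_mono) auto
    finally show "\<bar>jet_of k B a y hs - jet_of k B a x hs - jet_of k B a x ((y - x) # hs)\<bar> \<le> e * norm (y - x) * 1 * pnorm hs"
      using l by (simp add: jet_of_def del: nth_fderiv.simps)
  qed
  have "\<exists>d>0. \<forall>y\<in>B. norm (y - x) < d \<longrightarrow> nrm (Mlin i) (nth i a y - nth i a x) \<le> e" if "i < Suc k" for i
  proof -
    have "ncontinuous_on type_space (Mlin i) B (nth i a)" using memD(2)[OF a] that unfolding Ck_on_def by simp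
    from this[unfolded ncontinuous_on_def, rule_format, OF x e]
    obtain d where "d > 0" "\<forall>y\<in>B. norm (y - x) < d \<longrightarrow> nrm (Mlin i) (nth i a y - nth i a x) < e"
      by auto
    then show ?thesis by (intro exI[of _ d]) auto
  qed
  then obtain d where d: "d > 0" "\<And>y i. y \<in> B \<Longrightarrow> norm (y - x) < d \<Longrightarrow> i < Suc k \<Longrightarrow>
      nrm (Mlin i) (nth i a y - nth i a x) \<le> e"
    using ex_uniform_radius[of "Suc k" B x "\<lambda>i y. nrm (Mlin i) (nth i a y - nth i a x) \<le> e"] by blast
  show "\<exists>d>0. \<forall>y\<in>B. norm (y - x) < d \<longrightarrow> (\<forall>i hs. length hs \<le> k \<longrightarrow>
    \<bar>jet_of k B a y hs - jet_of k B a x hs\<bar> \<le> e * 1 * pnorm hs)"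
  proof (intro exI[of _ d] conjI ballI allI impI d(1))
    fix y and hs :: "'a list" assume y: "y \<in> B" "norm (y - x) < d" and l: "length hs \<le> k"
    let ?T = "nth (length hs) a y - nth (length hs) a x"
    interpret M: normed_carrier "Mlin (length hs)" by (rule normed_Mlin)
    have "?T \<in> vecs (Mlin (length hs))" using l x y nth_mem[OF a] by (intro M.diff_mem) auto
    then have "\<bar>?T hs\<bar> \<le> nrm (Mlin (length hs)) ?T * pnorm hs"
      using multilin_apply_le[OF normed_carrier_type_space normed_carrier_type_space, of ?T "length hs" hs] by simp
    also have "\<dots> \<le> e * pnorm hs" using d(2)[OF y, of "length hs"] l by (intro mult_right_mono) auto
    finally show "\<bar>jet_of k B a y hs - jet_of k B a x hs\<bar> \<le> e * 1 * pnorm hs"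
      using l by (simp add: jet_of_def del: nth_fderiv.simps)
  qed
qed auto

lemma add_jet:
  assumes "a \<in> vecs G" "b \<in> vecs G"
  shows "a + b \<in> vecs G" and "x \<in> B \<Longrightarrow> length hs \<le> k \<Longrightarrow> jet_of k B (a + b) x hs = jet_of k B a x hs + jet_of k B b x hs"
proof -
  note j = jet_add[OF jet_jet_of[OF assms(1)] jet_jet_of[OF assms(2)]]
  show "a + b \<in> vecs G" using memD(1)[OF assms(1)] memD(1)[OF assms(2)] by (intro jet_mem[OF j]) auto
  show "x \<in> B \<Longrightarrow> length hs \<le> k \<Longrightarrow> jet_of k B (a + b) x hs = jet_of k B a x hs + jet_of k B b x hs"
    by (intro jet_of_unique[OF j]) auto
qed

lemma scale_jet:
  assumes "a \<in> vecs G"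
  shows "c *\<^sub>R a \<in> vecs G" and "x \<in> B \<Longrightarrow> length hs \<le> k \<Longrightarrow> jet_of k B (c *\<^sub>R a) x hs = c * jet_of k B a x hs"
proof -
  note j = jet_scale[OF jet_jet_of[OF assms], of c]
  show "c *\<^sub>R a \<in> vecs G" using memD(1)[OF assms] by (intro jet_mem[OF j]) (auto simp: scaleR_fun_def)
  show "x \<in> B \<Longrightarrow> length hs \<le> k \<Longrightarrow> jet_of k B (c *\<^sub>R a) x hs = c * jet_of k B a x hs"
    by (intro jet_of_unique[OF j]) (auto simp: scaleR_fun_def)
qed

lemma nth_eq_jet_of: "i \<le> k \<Longrightarrow> a \<in> vecs G \<Longrightarrow> x \<in> B \<Longrightarrow> nth i a x = (\<lambda>hs. if length hs = i then jet_of k B a x hs else 0)"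
  using nth_jet[OF jet_jet_of[of a], of a i x] by (simp add: level_type_space)

lemma normed_G: "normed_carrier G"
proof (rule normed_carrierI)
  have z: "jet k B (\<lambda>_ hs. if hs = [] then 0 else 0)" by (rule jet_const)
  show "0 \<in> vecs G" by (rule jet_mem[OF z]) auto
  show "x + y \<in> vecs G" if "x \<in> vecs G" "y \<in> vecs G" for x y using that by (rule add_jet)
  show "c *\<^sub>R x \<in> vecs G" if "x \<in> vecs G" for x c using that by (rule scale_jet)
  show "nrm G (a + b) \<le> nrm G a + nrm G b" if a: "a \<in> vecs G" and b: "b \<in> vecs G" for a b
    unfolding nrm_G sum.distrib[symmetric]
  proof (rule sum_mono, rule cSUP_least[OF B_nonempty])
    fix i x assume i: "i \<in> {..k}" and x: "x \<in> B"
    have "nth i (a + b) x = nth i a x + nth i b x"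
      using i x a b add_jet[OF a b] by (auto simp: nth_eq_jet_of fun_eq_iff simp del: nth_fderiv.simps)
    then show "nrm (Mlin i) (nth i (a + b) x) \<le>
      (SUP x\<in>B. nrm (Mlin i) (nth i a x)) + (SUP x\<in>B. nrm (Mlin i) (nth i b x))"
      using normed_carrier.nrm_triangle[OF normed_Mlin nth_mem[OF a _ x] nth_mem[OF b _ x], of i]
        nth_le_SUP[OF a _ x, of i] nth_le_SUP[OF b _ x, of i] i by simp
  qed
  show "nrm G (c *\<^sub>R a) \<le> \<bar>c\<bar> * nrm G a" if a: "a \<in> vecs G" for a c
    unfolding nrm_G sum_distrib_left
  proof (rule sum_mono, rule cSUP_least[OF B_nonempty])
    fix i x assume i: "i \<in> {..k}" and x: "x \<in> B"
    have "nth i (c *\<^sub>R a) x = c *\<^sub>R nth i a x"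
      using i x a scale_jet[OF a] by (auto simp: nth_eq_jet_of fun_eq_iff scaleR_fun_def simp del: nth_fderiv.simps)
    then show "nrm (Mlin i) (nth i (c *\<^sub>R a) x) \<le> \<bar>c\<bar> * (SUP x\<in>B. nrm (Mlin i) (nth i a x))"
      using normed_carrier.nrm_scale[OF normed_Mlin nth_mem[OF a _ x], of i c]
        nth_le_SUP[OF a _ x, of i] i by (simp add: mult_left_mono)
  qed
  show "a = 0" if a: "a \<in> vecs G" "nrm G a = 0" for a
  proof
    fix x show "a x = 0 x" using jet_of_bound[OF a(1), of "[]" x] memD(1)[OF a(1), of x] a(2) by (cases "x \<in> B") auto
  qed
qed

lemma eval_le: "a \<in> vecs G \<Longrightarrow> \<bar>a x\<bar> \<le> nrm G a"
  using jet_of_bound[of a "[]" x] memD(1)[of a x] normed_carrier.nrm_nonneg[OF normed_G, of a]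
  by (cases "x \<in> B") auto

lemma indicator_mem: "indicator B \<in> vecs G"
  by (rule jet_mem[OF jet_const[of k B 1]]) auto

lemma jet_of_indicator: "x \<in> B \<Longrightarrow> length hs \<le> k \<Longrightarrow> jet_of k B (indicator B) x hs = (if hs = [] then 1 else 0)"
  by (rule jet_of_unique[OF jet_const[of k B 1]]) auto

lemma mult_jet:
  assumes "a \<in> vecs G" "b \<in> vecs G"
  shows mult_mem: "a * b \<in> vecs G"
    and "x \<in> B \<Longrightarrow> length hs \<le> k \<Longrightarrow> jet_of k B (a * b) x hs = leib (jet_of k B a x) (jet_of k B b x) hs"
proof -
  note j = jets_leib[OF jet_jet_of[OF assms(1)] jet_jet_of[OF assms(2)]]
  show "a * b \<in> vecs G" using memD(1)[OF assms(1)] by (intro jet_mem[OF j]) auto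
  show "x \<in> B \<Longrightarrow> length hs \<le> k \<Longrightarrow> jet_of k B (a * b) x hs = leib (jet_of k B a x) (jet_of k B b x) hs"
    by (intro jet_of_unique[OF j]) auto
qed

lemma nrm_mult_le:
  assumes "a \<in> vecs G" "b \<in> vecs G"
  shows "nrm G (a * b) \<le> (real (Suc k) * 2 ^ k) * nrm G a * nrm G b"
proof -
  interpret normed_carrier G by (rule normed_G)
  have "nrm G (a * b) \<le> real (Suc k) * (2 ^ k * nrm G a * nrm G b)"
  proof (rule nrm_le_jet)
    fix x and hs :: "'a list" assume x: "x \<in> B" "length hs \<le> k"
    have "\<bar>leib (jet_of k B a x) (jet_of k B b x) hs\<bar> \<le> 2 ^ length hs * nrm G a * nrm G b * pnorm hs"
      using x jet_of_bound[OF assms(1)] jet_of_bound[OF assms(2)] by (intro leib_bound) auto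
    also have "\<dots> \<le> 2 ^ k * nrm G a * nrm G b * pnorm hs"
      using x(2) assms by (intro mult_right_mono power_increasing) auto
    finally show "\<bar>jet_of k B (a * b) x hs\<bar> \<le> 2 ^ k * nrm G a * nrm G b * pnorm hs"
      using mult_jet(2)[OF assms x] by simp
  qed
  then show ?thesis by (simp add: mult.assoc)
qed

lemma exp_jet:
  assumes "a \<in> vecs G"
  shows exp_on_mem: "exp_on B a \<in> vecs G"
    and "x \<in> B \<Longrightarrow> length hs \<le> k \<Longrightarrow> jet_of k B (exp_on B a) x hs = expj k (jet_of k B a x) hs"
proof -
  note j = jet_expj[OF jet_jet_of[OF assms] order_refl]
  show "exp_on B a \<in> vecs G" by (intro jet_mem[OF j]) (auto simp: exp_on_def)
  show "x \<in> B \<Longrightarrow> length hs \<le> k \<Longrightarrow> jet_of k B (exp_on B a) x hs = expj k (jet_of k B a x) hs"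
    by (intro jet_of_unique[OF j]) (auto simp: exp_on_def)
qed

lemma exp_on_add: "exp_on B (a + b) = exp_on B a * exp_on B b"
  by (auto simp: exp_on_def exp_add fun_eq_iff)

lemma exp_remainder:
  obtains K where "K > 0" "\<And>h. h \<in> vecs G \<Longrightarrow> nrm G h \<le> 1 \<Longrightarrow>
    nrm G (exp_on B h - indicator B - h) \<le> K * (nrm G h)\<^sup>2"
proof -
  interpret normed_carrier G by (rule normed_G)
  obtain K where K: "K > 0" "\<And>(f :: 'a list \<Rightarrow> real) r t. 0 \<le> r \<Longrightarrow> r \<le> 1 \<Longrightarrow>
      (\<And>p. length p \<le> k \<Longrightarrow> \<bar>f p\<bar> \<le> r * pnorm p) \<Longrightarrow> length t \<le> k \<Longrightarrow>
      \<bar>expj k f t - (if t = [] then 1 else 0) - f t\<bar> \<le> K * r\<^sup>2 * pnorm t"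
    using expj_bounds[of k] by blast
  have "nrm G (exp_on B h - indicator B - h) \<le> real (Suc k) * (K * (nrm G h)\<^sup>2)" if h: "h \<in> vecs G" "nrm G h \<le> 1" for h
  proof (rule nrm_le_jet)
    fix x and hs :: "'a list" assume x: "x \<in> B" "length hs \<le> k"
    have m: "(-1) *\<^sub>R indicator B \<in> vecs G" "(-1) *\<^sub>R h \<in> vecs G" "exp_on B h + (-1) *\<^sub>R indicator B \<in> vecs G"
      using h(1) indicator_mem exp_on_mem by auto
    have "jet_of k B (exp_on B h - indicator B - h) x hs = jet_of k B ((exp_on B h + (-1) *\<^sub>R indicator B) + (-1) *\<^sub>R h) x hs"
      by simp
    also have "\<dots> = expj k (jet_of k B h x) hs - (if hs = [] then 1 else 0) - jet_of k B h x hs"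
      unfolding add_jet(2)[OF m(3) m(2) x] add_jet(2)[OF exp_on_mem[OF h(1)] m(1) x]
        scale_jet(2)[OF h(1) x] scale_jet(2)[OF indicator_mem x] exp_jet(2)[OF h(1) x] jet_of_indicator[OF x] by simp
    also have "\<bar>\<dots>\<bar> \<le> K * (nrm G h)\<^sup>2 * pnorm hs"
      using K(2)[OF nrm_nonneg[OF h(1)] h(2), of "jet_of k B h x" hs] jet_of_bound[OF h(1) _ x(1)] x(2) by simp
    finally show "\<bar>jet_of k B (exp_on B h - indicator B - h) x hs\<bar> \<le> K * (nrm G h)\<^sup>2 * pnorm hs" .
  qed
  then show thesis using that[of "real (Suc k) * K"] K(1) by (simp add: mult.assoc)
qed

text \<open>
  By \<open>exp (a + h) - exp a - exp a * h = exp a * (exp h - 1 - h)\<close> the claim reduces to the remainder at \<open>0\<close>.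
\<close>

lemma has_fderiv_exp_on:
  assumes a: "a \<in> vecs G"
  shows "has_fderiv G G (vecs G) (exp_on B) (\<lambda>h. if h \<in> vecs G then exp_on B a * h else 0) a"
proof -
  interpret normed_carrier G by (rule normed_G)
  define C where "C = real (Suc k) * 2 ^ k"
  have C: "C > 0" by (simp add: C_def)
  obtain K where K: "K > 0" "\<And>h. h \<in> vecs G \<Longrightarrow> nrm G h \<le> 1 \<Longrightarrow>
    nrm G (exp_on B h - indicator B - h) \<le> K * (nrm G h)\<^sup>2" using exp_remainder by blast
  define N where "N = nrm G (exp_on B a) + 1"
  have N: "N > 0" "nrm G (exp_on B a) \<le> N" using exp_on_mem[OF a] by (auto simp: N_def add_nonneg_pos)
  note E = exp_on_mem[OF a]
  define A where "A h = (if h \<in> vecs G then exp_on B a * h else 0)" for h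
  have "has_fderiv G G (vecs G) (exp_on B) A a"
  proof (rule has_fderivI)
    show "A \<in> bounded_lin G G"
    proof (rule bounded_linI[where C = "C * nrm G (exp_on B a)"])
      show "nrm G (A h) \<le> C * nrm G (exp_on B a) * nrm G h" if "h \<in> vecs G" for h
        using nrm_mult_le[OF E that] that by (simp add: A_def C_def)
      show "A (h + h') = A h + A h'" if "h \<in> vecs G" "h' \<in> vecs G" for h h'
        using that by (simp add: A_def distrib_left)
      show "A (c *\<^sub>R h) = c *\<^sub>R A h" if "h \<in> vecs G" for c h
        using that by (simp add: A_def) (simp add: scaleR_fun_def fun_eq_iff)
    qed (simp_all add: A_def mult_mem[OF E])
    fix e :: real assume e: "e > 0"
    show "\<exists>d>0. \<forall>y\<in>vecs G. nrm G (y - a) < d \<longrightarrow> nrm G (exp_on B y - exp_on B a - A (y - a)) \<le> e * nrm G (y - a)"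
    proof (intro exI[of _ "min 1 (e / (C * N * K))"] conjI ballI impI)
      fix y assume y: "y \<in> vecs G" "nrm G (y - a) < min 1 (e / (C * N * K))"
      define h where "h = y - a"
      have h: "h \<in> vecs G" using y a by (auto simp: h_def)
      have yh: "y = a + h" by (simp add: h_def)
      have n: "nrm G h \<le> 1" "nrm G h * (C * N * K) \<le> e"
        using y(2) C N K by (auto simp: h_def pos_less_divide_eq)
      have m: "exp_on B h - indicator B - h \<in> vecs G" using h exp_on_mem indicator_mem by auto
      have eq: "exp_on B y - exp_on B a - exp_on B a * h = exp_on B a * (exp_on B h - indicator B - h)"
        unfolding yh exp_on_add by (auto simp: fun_eq_iff exp_on_def algebra_simps indicator_def)
      have "nrm G (exp_on B y - exp_on B a - exp_on B a * h) \<le> C * nrm G (exp_on B a) * nrm G (exp_on B h - indicator B - h)"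
        unfolding eq using nrm_mult_le[OF E m] by (simp add: C_def)
      also have "\<dots> \<le> C * N * (K * (nrm G h)\<^sup>2)"
        using K(2)[OF h n(1)] N C m E by (intro mult_mono) auto
      also have "\<dots> = nrm G h * (C * N * K) * nrm G h" by (simp add: power2_eq_square)
      also have "\<dots> \<le> e * nrm G h" using n(2) h by (intro mult_right_mono) auto
      finally show "nrm G (exp_on B y - exp_on B a - A (y - a)) \<le> e * nrm G (y - a)"
        using h by (simp add: A_def h_def)
    qed (use e C N K in auto)
  qed
  then show ?thesis by (simp add: A_def[abs_def])
qed

end

section \<open>Bounded functionals and non-constant elements of the function algebra\<close>

text \<open>
  Hahn-Banach. Partial functionals dominated by the norm are represented by their graphs, which
  are linear subspaces of \<open>X \<times> \<real>\<close>; a maximal graph has full domain.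
\<close>

lemma norming_functional:
  fixes x0 :: "'a::real_normed_vector"
  obtains l :: "'a \<Rightarrow> real" where "linear l" "\<And>x. \<bar>l x\<bar> \<le> norm x" "l x0 = norm x0"
proof -
  define \<A> where "\<A> = {g :: ('a \<times> real) set. subspace g \<and> (\<forall>p\<in>g. snd p \<le> norm (fst p)) \<and> (x0, norm x0) \<in> g}"
  have base: "range (\<lambda>t. t *\<^sub>R (x0, norm x0)) \<in> \<A>"
  proof -
    have "subspace (range (\<lambda>t. t *\<^sub>R (x0, norm x0)))"
      using subspace_span[of "{(x0, norm x0)}"] by (simp add: span_singleton)
    moreover have "t * norm x0 \<le> norm (t *\<^sub>R x0)" for t by (simp add: mult_right_mono)
    moreover have "(x0, norm x0) = 1 *\<^sub>R (x0, norm x0)" by simp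
    ultimately show ?thesis unfolding \<A>_def by (auto simp del: scaleR_one norm_scaleR)
  qed
  have "\<exists>M\<in>\<A>. \<forall>g\<in>\<A>. M \<subseteq> g \<longrightarrow> g = M"
  proof (rule subset_Zorn_nonempty)
    show "\<A> \<noteq> {}" using base by blast
    fix \<C> assume C: "\<C> \<noteq> {}" "subset.chain \<A> \<C>"
    then have sub: "\<And>g. g \<in> \<C> \<Longrightarrow> g \<in> \<A>" and lin: "\<And>g g'. g \<in> \<C> \<Longrightarrow> g' \<in> \<C> \<Longrightarrow> g \<subseteq> g' \<or> g' \<subseteq> g"
      unfolding subset.chain_def by auto
    have "subspace (\<Union>\<C>)"
    proof (rule subspaceI)
      show "0 \<in> \<Union>\<C>" using C(1) sub subspace_0 unfolding \<A>_def by blast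
      show "c *\<^sub>R x \<in> \<Union>\<C>" if "x \<in> \<Union>\<C>" for c x
        using that sub subspace_scale unfolding \<A>_def by blast
      show "x + y \<in> \<Union>\<C>" if xy: "x \<in> \<Union>\<C>" "y \<in> \<Union>\<C>" for x y
      proof -
        obtain g g' where g: "g \<in> \<C>" "x \<in> g" "g' \<in> \<C>" "y \<in> g'" using xy by blast
        obtain g'' where "g'' \<in> \<C>" "x \<in> g''" "y \<in> g''" using lin[OF g(1,3)] g by blast
        then show ?thesis using sub subspace_add unfolding \<A>_def by blast
      qed
    qed
    then show "\<Union>\<C> \<in> \<A>" using C(1) sub unfolding \<A>_def by blast
  qed
  then obtain M where M: "M \<in> \<A>" and max: "\<And>g. g \<in> \<A> \<Longrightarrow> M \<subseteq> g \<Longrightarrow> g = M" by blast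
  have sM: "subspace M" and bM: "\<And>y r. (y, r) \<in> M \<Longrightarrow> r \<le> norm y" and xM: "(x0, norm x0) \<in> M"
    using M unfolding \<A>_def by auto
  have total: "\<exists>r. (x, r) \<in> M" for x
  proof -
    define L where "L = (\<lambda>p. snd p - norm (fst p - x)) ` M"
    \<comment> \<open>The left sides are the lower bounds, the right sides the upper bounds for an admissible value at \<open>x\<close>.\<close>
    have cross: "r - norm (y - x) \<le> norm (y' + x) - r'" if "(y, r) \<in> M" "(y', r') \<in> M" for y r y' r'
    proof -
      have "r + r' \<le> norm (y + y')" using bM subspace_add[OF sM that] by simp
      also have "\<dots> \<le> norm (y - x) + norm (y' + x)" using norm_triangle_ineq[of "y - x" "y' + x"] by simp
      finally show ?thesis by simp
    qed
    have ne: "L \<noteq> {}" using xM by (auto simp: L_def)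
    have bdd: "bdd_above L" using cross[OF _ xM] by (auto simp: L_def intro!: bdd_aboveI2)
    define c where "c = Sup L"
    have lo: "r - norm (y - x) \<le> c" if "(y, r) \<in> M" for y r
      using cSup_upper[OF _ bdd, of "r - norm (y - x)"] that by (force simp: L_def c_def)
    have hi: "c \<le> norm (y + x) - r" if "(y, r) \<in> M" for y r
      unfolding c_def using cross[OF _ that] by (intro cSup_least[OF ne]) (auto simp: L_def)
    define g where "g = (\<Union>t. (\<lambda>p. p + t *\<^sub>R (x, c)) ` M)"
    have sg: "subspace g"
    proof (rule subspaceI)
      have "0 = 0 + 0 *\<^sub>R (x, c)" by (simp only: scaleR_zero_left add_0)
      then show "0 \<in> g" using subspace_0[OF sM] unfolding g_def by blast
      fix u v assume "u \<in> g" "v \<in> g"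
      then obtain p t q s where *: "p \<in> M" "q \<in> M" "u = p + t *\<^sub>R (x, c)" "v = q + s *\<^sub>R (x, c)" unfolding g_def by blast
      then have "u + v = (p + q) + (t + s) *\<^sub>R (x, c)" by (simp only: scaleR_add_left ac_simps)
      then show "u + v \<in> g" using subspace_add[OF sM *(1,2)] unfolding g_def by blast
    next
      fix u a assume "u \<in> g"
      then obtain p t where *: "p \<in> M" "u = p + t *\<^sub>R (x, c)" unfolding g_def by blast
      then have "a *\<^sub>R u = a *\<^sub>R p + (a * t) *\<^sub>R (x, c)" by (simp only: scaleR_add_right scaleR_scaleR)
      then show "a *\<^sub>R u \<in> g" using subspace_scale[OF sM *(1)] unfolding g_def by blast
    qed
    have bg: "r + t * c \<le> norm (y + t *\<^sub>R x)" if yr: "(y, r) \<in> M" for y r t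
    proof (cases "t = 0")
      case False
      have sc: "((1 / \<bar>t\<bar>) *\<^sub>R y, (1 / \<bar>t\<bar>) * r) \<in> M" using subspace_scale[OF sM yr, of "1 / \<bar>t\<bar>"] by simp
      have nt: "\<bar>t\<bar> * norm ((1 / \<bar>t\<bar>) *\<^sub>R y + z) = norm (y + \<bar>t\<bar> *\<^sub>R z)" for z
        using norm_scaleR[of "\<bar>t\<bar>" "(1 / \<bar>t\<bar>) *\<^sub>R y + z"] False by (simp add: scaleR_add_right)
      have rt: "\<bar>t\<bar> * (1 / \<bar>t\<bar> * r) = r" using False by simp
      show ?thesis
      proof (cases "t > 0")
        case True
        have "\<bar>t\<bar> * c \<le> \<bar>t\<bar> * (norm ((1 / \<bar>t\<bar>) *\<^sub>R y + x) - 1 / \<bar>t\<bar> * r)" using hi[OF sc] by (intro mult_left_mono) auto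
        also have "\<dots> = norm (y + \<bar>t\<bar> *\<^sub>R x) - r" by (simp only: right_diff_distrib nt rt)
        finally show ?thesis using True by simp
      next
        case neg: False
        have "\<bar>t\<bar> * (1 / \<bar>t\<bar> * r - norm ((1 / \<bar>t\<bar>) *\<^sub>R y + (- x))) \<le> \<bar>t\<bar> * c" using lo[OF sc] by (intro mult_left_mono) auto
        then have "r - norm (y + \<bar>t\<bar> *\<^sub>R (- x)) \<le> \<bar>t\<bar> * c" by (simp only: right_diff_distrib nt rt)
        then show ?thesis using neg by simp
      qed
    qed (use bM yr in auto)
    have Mg: "M \<subseteq> g"
    proof
      fix p assume "p \<in> M"
      moreover have "p = p + 0 *\<^sub>R (x, c)" by (simp only: scaleR_zero_left add_0_right)
      ultimately show "p \<in> g" unfolding g_def by blast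
    qed
    have "\<forall>p\<in>g. snd p \<le> norm (fst p)" unfolding g_def using bg by auto
    then have "g \<in> \<A>" using sg Mg xM unfolding \<A>_def by auto
    then have "g = M" using max Mg by blast
    moreover have "(x, c) = 0 + 1 *\<^sub>R (x, c)" by (simp only: scaleR_one add_0)
    then have "(x, c) \<in> g" using subspace_0[OF sM] unfolding g_def by blast
    ultimately show ?thesis by blast
  qed
  have uniq: "r = r'" if "(x, r) \<in> M" "(x, r') \<in> M" for x r r'
    using bM[of 0 "r - r'"] bM[of 0 "r' - r"] subspace_diff[OF sM that] subspace_diff[OF sM that(2,1)] by simp
  define l where "l x = (THE r. (x, r) \<in> M)" for x
  have l: "(x, l x) \<in> M" for x unfolding l_def using total[of x] uniq by (metis theI)
  have le: "l x = r" if "(x, r) \<in> M" for x r using uniq[OF l that] .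
  have "linear l"
    using le[of _ _] subspace_add[OF sM l l] subspace_scale[OF sM l] by (intro linearI) auto
  moreover have "\<bar>l x\<bar> \<le> norm x" for x
    using bM[OF l, of x] bM[OF l, of "- x"] linear_neg[OF \<open>linear l\<close>, of x] by simp
  ultimately show thesis using that le[OF xM] by blast
qed

lemma abs_sin_remainder_le: "\<bar>sin (s + u) - sin s - u * cos s\<bar> \<le> u\<^sup>2" for s u :: real
proof -
  have c: "\<bar>cos a - cos b\<bar> \<le> \<bar>a - b\<bar>" for a b :: real
  proof -
    have "\<bar>cos a - cos b\<bar> = 2 * (\<bar>sin ((a + b) / 2)\<bar> * \<bar>sin ((b - a) / 2)\<bar>)"
      by (simp add: cos_diff_cos abs_mult)
    also have "\<dots> \<le> 2 * (1 * \<bar>(b - a) / 2\<bar>)"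
      by (intro mult_left_mono mult_mono abs_sin_x_le_abs_x) auto
    finally show ?thesis by simp
  qed
  show ?thesis
  proof (cases "u = 0")
    case False
    have "((\<lambda>t. sin (s + t) - t * cos s) has_real_derivative (cos (s + t) - cos s)) (at t)" for t
      by (auto intro!: derivative_eq_intros)
    then obtain z where z: "\<bar>z\<bar> \<le> \<bar>u\<bar>" "(sin (s + u) - u * cos s) - (sin (s + 0) - 0 * cos s) = (u - 0) * (cos (s + z) - cos s)"
    proof (cases "u > 0")
      case True
      then show thesis
        using MVT2[of 0 u "\<lambda>t. sin (s + t) - t * cos s" "\<lambda>t. cos (s + t) - cos s"] that
          \<open>\<And>t. ((\<lambda>t. sin (s + t) - t * cos s) has_real_derivative (cos (s + t) - cos s)) (at t)\<close> by force
    next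
      case neg: False
      then have "u < 0" using False by simp
      then obtain z where "u < z" "z < 0" "(sin (s + 0) - 0 * cos s) - (sin (s + u) - u * cos s) = (0 - u) * (cos (s + z) - cos s)"
        using MVT2[of u 0 "\<lambda>t. sin (s + t) - t * cos s" "\<lambda>t. cos (s + t) - cos s"]
          \<open>\<And>t. ((\<lambda>t. sin (s + t) - t * cos s) has_real_derivative (cos (s + t) - cos s)) (at t)\<close> by force
      then show thesis using that[of z] by simp
    qed
    have "\<bar>sin (s + u) - sin s - u * cos s\<bar> = \<bar>u\<bar> * \<bar>cos (s + z) - cos s\<bar>"
      using z(2) by (simp flip: abs_mult)
    also have "\<dots> \<le> \<bar>u\<bar> * \<bar>u\<bar>" using c[of "s + z" s] z(1) by (intro mult_left_mono) auto
    finally show ?thesis by (simp add: power2_eq_square)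
  qed simp
qed

lemma abs_sin_diff_le: "\<bar>sin (s + u) - sin s\<bar> \<le> \<bar>u\<bar>" for s u :: real
proof -
  have "\<bar>sin (s + u) - sin s\<bar> = 2 * (\<bar>sin (u / 2)\<bar> * \<bar>cos ((s + u + s) / 2)\<bar>)"
    by (simp add: sin_diff_sin abs_mult)
  also have "\<dots> \<le> 2 * (\<bar>u / 2\<bar> * 1)"
    by (intro mult_left_mono mult_mono abs_sin_x_le_abs_x) auto
  finally show ?thesis by simp
qed

lemma abs_prod_list_le_pnorm:
  assumes "\<And>x. \<bar>l x\<bar> \<le> norm x"
  shows "\<bar>prod_list (map l hs)\<bar> \<le> pnorm hs"
  using assms by (induction hs) (auto simp: abs_mult intro: mult_mono)

text \<open>Each derivative of the sine shifts its argument by a quarter turn.\<close>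

lemma jet_sin:
  assumes l: "linear l" "\<And>x. \<bar>l x\<bar> \<le> norm x"
  shows "jet k B (\<lambda>x hs. sin (l x + \<phi> + real (length hs) * (pi / 2)) * prod_list (map l hs))"
proof (rule jetsI[where C = 1])
  note p = abs_prod_list_le_pnorm[OF l(2)]
  let ?s = "\<lambda>x hs :: 'a list. l x + \<phi> + real (length hs) * (pi / 2)"
  show "mlin (\<lambda>hs. sin (?s x hs) * prod_list (map l hs))" for x
    unfolding mlin_def using linear_add[OF l(1)] linear_scale[OF l(1)] by (simp add: algebra_simps)
  show "\<bar>sin (?s x hs) * prod_list (map l hs)\<bar> \<le> 1 * 1 * pnorm hs" for x hs
    using mult_mono[OF abs_sin_le_one p] by (simp add: abs_mult)
  fix x and e :: real assume "x \<in> B" and e: "e > 0"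
  have yx: "l y = l x + l (y - x)" for y using linear_diff[OF l(1), of y x] by simp
  show "\<exists>d>0. \<forall>y\<in>B. norm (y - x) < d \<longrightarrow> (\<forall>i hs. length hs < k \<longrightarrow>
    \<bar>sin (?s y hs) * prod_list (map l hs) - sin (?s x hs) * prod_list (map l hs)
      - sin (?s x ((y - x) # hs)) * prod_list (map l ((y - x) # hs))\<bar> \<le> e * norm (y - x) * 1 * pnorm hs)"
  proof (intro exI[of _ e] conjI ballI allI impI e)
    fix y hs assume y: "norm (y - x) < e"
    let ?u = "l (y - x)"
    have "sin (?s x ((y - x) # hs)) = cos (?s x hs)"
    proof -
      have "?s x ((y - x) # hs) = ?s x hs + pi / 2" by (simp add: field_simps)
      then have "sin (?s x ((y - x) # hs)) = sin (?s x hs + pi / 2)" by (rule arg_cong)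
      also have "\<dots> = cos (?s x hs)" unfolding sin_add by simp
      finally show ?thesis .
    qed
    then have "sin (?s y hs) * prod_list (map l hs) - sin (?s x hs) * prod_list (map l hs)
      - sin (?s x ((y - x) # hs)) * prod_list (map l ((y - x) # hs))
      = (sin (?s x hs + ?u) - sin (?s x hs) - ?u * cos (?s x hs)) * prod_list (map l hs)"
      using yx[of y] by (simp add: algebra_simps)
    also have "\<bar>\<dots>\<bar> \<le> ?u\<^sup>2 * pnorm hs"
      unfolding abs_mult using abs_sin_remainder_le p by (intro mult_mono) auto
    also have "\<dots> \<le> (e * norm (y - x)) * pnorm hs"
    proof (intro mult_right_mono pnorm_nonneg)
      have "?u\<^sup>2 = \<bar>?u\<bar> * \<bar>?u\<bar>" by (simp add: power2_eq_square)
      also have "\<dots> \<le> e * norm (y - x)" using l(2)[of "y - x"] y e by (intro mult_mono) auto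
      finally show "?u\<^sup>2 \<le> e * norm (y - x)" .
    qed
    finally show "\<bar>sin (?s y hs) * prod_list (map l hs) - sin (?s x hs) * prod_list (map l hs)
      - sin (?s x ((y - x) # hs)) * prod_list (map l ((y - x) # hs))\<bar> \<le> e * norm (y - x) * 1 * pnorm hs" by simp
  qed
  show "\<exists>d>0. \<forall>y\<in>B. norm (y - x) < d \<longrightarrow> (\<forall>i hs. length hs \<le> k \<longrightarrow>
    \<bar>sin (?s y hs) * prod_list (map l hs) - sin (?s x hs) * prod_list (map l hs)\<bar> \<le> e * 1 * pnorm hs)"
  proof (intro exI[of _ e] conjI ballI allI impI e)
    fix y hs assume y: "norm (y - x) < e"
    have "sin (?s y hs) * prod_list (map l hs) - sin (?s x hs) * prod_list (map l hs)
      = (sin (?s x hs + l (y - x)) - sin (?s x hs)) * prod_list (map l hs)"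
      using yx[of y] by (simp add: algebra_simps)
    also have "\<bar>\<dots>\<bar> \<le> e * pnorm hs"
      unfolding abs_mult using abs_sin_diff_le[of "?s x hs" "l (y - x)"] p l(2)[of "y - x"] y e by (intro mult_mono) auto
    finally show "\<bar>sin (?s y hs) * prod_list (map l hs) - sin (?s x hs) * prod_list (map l hs)\<bar> \<le> e * 1 * pnorm hs" by simp
  qed
qed auto

text \<open>
  The functions are the sine and the cosine of a non-zero functional. On a line through a point of
  \<open>B\<close> a relation between them and \<open>1\<close> becomes a relation between shifted sines and cosines.
\<close>

lemma (in Cbk_domain) ex_independent_mod_constants:
  assumes "(UNIV :: 'a set) \<noteq> {0}"
  obtains a b where "a \<in> vecs G" "b \<in> vecs G"
    "\<And>p q r. (\<And>x. x \<in> B \<Longrightarrow> p * a x + q * b x + r = 0) \<Longrightarrow> p = 0 \<and> q = 0"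
proof -
  obtain x0 :: 'a where x0: "x0 \<noteq> 0" using assms by auto
  obtain l :: "'a \<Rightarrow> real" where l: "linear l" "\<And>x. \<bar>l x\<bar> \<le> norm x" "l x0 = norm x0"
    using norming_functional by blast
  define f where "f \<phi> x = (if x \<in> B then sin (l x + \<phi>) else 0)" for \<phi> x
  have f: "f \<phi> \<in> vecs G" for \<phi> by (rule jet_mem[OF jet_sin[OF l(1,2), of k B \<phi>]]) (auto simp: f_def)
  have "p = 0 \<and> q = 0" if z: "\<And>x. x \<in> B \<Longrightarrow> p * f 0 x + q * f (pi / 2) x + r = 0" for p q r
  proof -
    obtain x where x: "x \<in> B" using B_nonempty by blast
    obtain e where e: "e > 0" "ball x e \<subseteq> B" using open_B x open_contains_ball by blast
    define \<delta> where "\<delta> = min (e / 2) 1"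
    have d: "0 < \<delta>" "\<delta> < e" "\<delta> \<le> 1" using e by (auto simp: \<delta>_def)
    define h where "h = (1 / norm x0) *\<^sub>R x0"
    have h: "norm h = 1" "l h = 1" using x0 l(3) linear_scale[OF l(1)] by (auto simp: h_def)
    define \<theta> where "\<theta> = l x"
    have val: "p * sin (\<theta> + t) + q * cos (\<theta> + t) + r = 0" if "\<bar>t\<bar> \<le> \<delta>" for t
    proof -
      have m: "x + t *\<^sub>R h \<in> B" using e(2) that d h(1) by (auto simp: dist_norm subset_iff)
      have "l (x + t *\<^sub>R h) = \<theta> + t" using linear_add[OF l(1)] linear_scale[OF l(1)] h(2) by (simp add: \<theta>_def)
      then show ?thesis using z[OF m] m by (simp add: f_def sin_add)
    qed
    \<comment> \<open>The even and the odd part of the relation in \<open>t\<close> vanish separately.\<close>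
    note v = val[of 0] val[of \<delta>] val[of "- \<delta>"]
    have "(cos \<delta> - 1) * (p * sin \<theta> + q * cos \<theta>) = 0"
      using v d by (simp add: sin_add cos_add sin_diff cos_diff algebra_simps)
    moreover have "cos \<delta> < 1" using cos_monotone_0_pi[of 0 \<delta>] d pi_gt3 by simp
    ultimately have 1: "p * sin \<theta> + q * cos \<theta> = 0" by simp
    have "2 * (sin \<delta> * (p * cos \<theta> - q * sin \<theta>)) =
      (p * sin (\<theta> + \<delta>) + q * cos (\<theta> + \<delta>) + r) - (p * sin (\<theta> + - \<delta>) + q * cos (\<theta> + - \<delta>) + r)"
      by (simp add: sin_add cos_add sin_diff cos_diff algebra_simps)
    then have "sin \<delta> * (p * cos \<theta> - q * sin \<theta>) = 0" using v(2,3) d by (smt (verit) mult_eq_0_iff)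
    moreover have "sin \<delta> > 0" using d pi_gt3 by (intro sin_gt_zero) auto
    ultimately have 2: "p * cos \<theta> - q * sin \<theta> = 0" by simp
    have "p * ((sin \<theta>)\<^sup>2 + (cos \<theta>)\<^sup>2) = sin \<theta> * (p * sin \<theta> + q * cos \<theta>) + cos \<theta> * (p * cos \<theta> - q * sin \<theta>)"
      by (simp only: power2_eq_square algebra_simps)
    moreover have "q * ((sin \<theta>)\<^sup>2 + (cos \<theta>)\<^sup>2) = cos \<theta> * (p * sin \<theta> + q * cos \<theta>) - sin \<theta> * (p * cos \<theta> - q * sin \<theta>)"
      by (simp only: power2_eq_square algebra_simps)
    ultimately show ?thesis using 1 2 by auto
  qed
  then show thesis using that[OF f f] by blast
qed

section \<open>The manifolds and their charts\<close>

locale stat_manifold =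
  fixes k :: nat and \<mu> :: "'a::banach measure"
  assumes open_space: "open (space \<mu>)"
    and sets_mu: "sets \<mu> = sets (restrict_space borel (space \<mu>))"
    and prob: "prob_space \<mu>"
    and charges_open: "\<And>A. open A \<Longrightarrow> A \<subseteq> space \<mu> \<Longrightarrow> A \<noteq> {} \<Longrightarrow> emeasure \<mu> A > 0"
begin

sublocale prob_space \<mu> by (rule prob)

sublocale Cbk_domain k "space \<mu>"
  using open_space not_empty by unfold_locales

sublocale G: normed_carrier G by (rule normed_G)

abbreviation one :: "'a \<Rightarrow> real" where "one \<equiv> indicator (space \<mu>)"

lemma GG_eq [simp]: "GG k \<mu> = G"
  by (simp add: GG_def)

lemma one_mem [simp]: "one \<in> vecs G"
  by (rule indicator_mem)

lemma mult_one: "a \<in> vecs G \<Longrightarrow> a * one = a"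
  using memD(1) by (auto simp: fun_eq_iff indicator_def)

subsection \<open>Integration of elements of the function algebra\<close>

lemma continuous_mem:
  assumes "a \<in> vecs G"
  shows "continuous_on (space \<mu>) a"
  unfolding continuous_on_iff
proof (intro ballI allI impI)
  fix x and e :: real assume x: "x \<in> space \<mu>" and e: "e > 0"
  then have e2: "e / 2 > 0" by simp
  from jetsD(5)[OF jet_jet_of[OF assms] x e2]
  obtain d where d: "d > 0" "\<And>y hs. y \<in> space \<mu> \<Longrightarrow> norm (y - x) < d \<Longrightarrow> length hs \<le> k \<Longrightarrow>
      \<bar>jet_of k (space \<mu>) a y hs - jet_of k (space \<mu>) a x hs\<bar> \<le> e / 2 * pnorm hs" by auto
  have "\<bar>a y - a x\<bar> < e" if "y \<in> space \<mu>" "norm (y - x) < d" for y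
    using d(2)[OF that, of "[]"] e by simp
  then show "\<exists>d>0. \<forall>y\<in>space \<mu>. dist y x < d \<longrightarrow> dist (a y) (a x) < e"
    using d(1) by (auto simp: dist_norm)
qed

lemma measurable_mem [measurable (raw)]:
  assumes "a \<in> vecs G"
  shows "a \<in> borel_measurable \<mu>"
  using borel_measurable_continuous_on_restrict[OF continuous_mem[OF assms]] sets_mu
  by (simp cong: measurable_cong_sets)

lemma integrable_mem [simp]: "a \<in> vecs G \<Longrightarrow> integrable \<mu> a"
  using eval_le[of a] by (intro integrable_const_bound[where B = "nrm G a"]) auto

text \<open>
  A continuous function that is not zero is bounded away from zero near some point, and \<open>\<mu>\<close> charges that
  neighbourhood. All uniqueness statements about densities rest on this.
\<close>

lemma AE_zero_imp_zero:
  assumes "a \<in> vecs G" "AE x in \<mu>. a x = 0"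
  shows "a = 0"
proof (rule ccontr)
  assume "a \<noteq> 0"
  let ?A = "{x \<in> space \<mu>. a x \<noteq> 0}"
  obtain x where "a x \<noteq> 0" using \<open>a \<noteq> 0\<close> by (auto simp: fun_eq_iff)
  then have ne: "?A \<noteq> {}" using memD(1)[OF assms(1)] by auto
  have "open (space \<mu> \<inter> a -` (- {0}))"
    using continuous_mem[OF assms(1)] open_space by (intro continuous_open_preimage) auto
  moreover have "?A = space \<mu> \<inter> a -` (- {0})" by auto
  ultimately have "emeasure \<mu> ?A > 0" using ne by (intro charges_open) auto
  moreover have "emeasure \<mu> ?A = 0"
    using assms measurable_mem[OF assms(1)] by (intro AE_iff_measurable[THEN iffD1]) auto
  ultimately show False by simp
qed

lemma AE_eq_imp_eq:
  assumes "a \<in> vecs G" "b \<in> vecs G" "AE x in \<mu>. a x = b x"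
  shows "a = b"
  using AE_zero_imp_zero[of "a - b"] assms by auto

declare prob_space [simp]

lemma integral_one [simp]: "(\<integral>x. one x \<partial>\<mu>) = 1"
  by simp

lemma integral_zero_fun [simp]: "integral\<^sup>L \<mu> (0 :: 'a \<Rightarrow> real) = 0"
  by (simp add: zero_fun_def)

lemma integral_add_fun [simp]:
  "a \<in> vecs G \<Longrightarrow> b \<in> vecs G \<Longrightarrow> integral\<^sup>L \<mu> (a + b) = integral\<^sup>L \<mu> a + integral\<^sup>L \<mu> b"
  by (simp add: plus_fun_def)

lemma integral_diff_fun [simp]:
  "a \<in> vecs G \<Longrightarrow> b \<in> vecs G \<Longrightarrow> integral\<^sup>L \<mu> (a - b) = integral\<^sup>L \<mu> a - integral\<^sup>L \<mu> b"
  by (simp add: fun_diff_def)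

lemma integral_scaleR_fun [simp]: "integral\<^sup>L \<mu> (c *\<^sub>R (f :: 'a \<Rightarrow> real)) = c * integral\<^sup>L \<mu> f"
  by (simp add: scaleR_fun_def)

lemma integral_le_nrm: "a \<in> vecs G \<Longrightarrow> \<bar>\<integral>x. a x \<partial>\<mu>\<bar> \<le> nrm G a"
  using integral_abs_bound[of \<mu> a] integral_mono[of \<mu> "\<lambda>x. \<bar>a x\<bar>" "\<lambda>_. nrm G a"] eval_le[of a]
  by (simp, linarith)

subsection \<open>Measures with exponential densities\<close>

lemma exp_on_pos: "x \<in> space \<mu> \<Longrightarrow> 0 < exp_on (space \<mu>) a x"
  by (simp add: exp_on_def)

lemma exp_on_nonneg [simp]: "0 \<le> exp_on (space \<mu>) a x"
  by (simp add: exp_on_def)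

lemma exp_mem [simp]: "a \<in> vecs G \<Longrightarrow> exp_on (space \<mu>) a \<in> vecs G"
  by (rule exp_on_mem)

lemma mult_mem' [simp]: "a \<in> vecs G \<Longrightarrow> b \<in> vecs G \<Longrightarrow> a * b \<in> vecs G"
  by (rule mult_mem)

lemma sets_exp_measure [simp]: "sets (exp_measure \<mu> a) = sets \<mu>"
  and space_exp_measure [simp]: "space (exp_measure \<mu> a) = space \<mu>"
  by (simp_all add: exp_measure_def)

lemma integral_exp_measure:
  assumes "a \<in> vecs G" "f \<in> borel_measurable \<mu>"
  shows "(\<integral>x. f x \<partial>exp_measure \<mu> a) = (\<integral>x. (exp_on (space \<mu>) a * f) x \<partial>\<mu>)"
  unfolding exp_measure_def using assms measurable_mem[OF exp_mem[OF assms(1)]]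
  by (subst integral_density) (auto simp: times_fun_def)

lemma integrable_exp_measure:
  assumes "a \<in> vecs G" "f \<in> vecs G"
  shows "integrable (exp_measure \<mu> a) f"
  unfolding exp_measure_def
  using assms measurable_mem[OF exp_mem[OF assms(1)]] measurable_mem[OF assms(2)]
    integrable_mem[OF mult_mem[OF exp_mem[OF assms(1)] assms(2)]]
  by (subst integrable_density) (auto simp: times_fun_def)

text \<open>
  The normalising constant of the density \<open>exp a\<close>.
\<close>

definition Z :: "('a \<Rightarrow> real) \<Rightarrow> real"
  where "Z a = (\<integral>x. exp_on (space \<mu>) a x \<partial>\<mu>)"

lemma Z_pos:
  assumes "a \<in> vecs G"
  shows "Z a > 0"
proof -
  have "Z a \<noteq> 0"
  proof
    assume "Z a = 0"
    then have "AE x in \<mu>. exp_on (space \<mu>) a x = 0"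
      unfolding Z_def using integral_nonneg_eq_0_iff_AE[OF integrable_mem[OF exp_mem[OF assms]]] by simp
    then have "exp_on (space \<mu>) a = 0" using AE_zero_imp_zero assms by simp
    moreover obtain x where "x \<in> space \<mu>" using not_empty by blast
    ultimately show False using exp_on_pos[of x a] by simp
  qed
  moreover have "Z a \<ge> 0" unfolding Z_def by (intro integral_nonneg_AE) simp
  ultimately show ?thesis by simp
qed

lemma emeasure_exp_measure:
  assumes "a \<in> vecs G"
  shows "emeasure (exp_measure \<mu> a) (space \<mu>) = ennreal (Z a)"
proof -
  have "emeasure (exp_measure \<mu> a) (space \<mu>) = (\<integral>\<^sup>+x. ennreal (exp_on (space \<mu>) a x) \<partial>\<mu>)"
    unfolding exp_measure_def using measurable_mem[OF exp_mem[OF assms]]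
    by (subst emeasure_density) (auto intro!: nn_integral_cong simp: indicator_def)
  also have "\<dots> = ennreal (Z a)"
    unfolding Z_def using assms by (intro nn_integral_eq_integral) auto
  finally show ?thesis .
qed

lemma exp_measure_mem_M:
  assumes "a \<in> vecs G"
  shows "exp_measure \<mu> a \<in> manifold_M k \<mu>"
proof -
  have m: "(\<lambda>x. ennreal (exp_on (space \<mu>) a x)) \<in> borel_measurable \<mu>"
    using measurable_mem[OF exp_mem[OF assms]] by measurable
  have null: "null_sets (exp_measure \<mu> a) = null_sets \<mu>"
  proof (intro set_eqI)
    fix A
    have "A \<in> null_sets (exp_measure \<mu> a) \<longleftrightarrow> A \<in> sets \<mu> \<and> (AE x in \<mu>. x \<notin> A)"
      unfolding exp_measure_def null_sets_density_iff[OF m]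
    proof (intro conj_cong refl AE_cong)
      fix x assume "x \<in> space \<mu>"
      then show "(x \<in> A \<longrightarrow> ennreal (exp_on (space \<mu>) a x) = 0) = (x \<notin> A)"
        using exp_on_pos[of x a] by (auto simp: ennreal_eq_0_iff)
    qed
    then show "A \<in> null_sets (exp_measure \<mu> a) \<longleftrightarrow> A \<in> null_sets \<mu>"
      using AE_iff_null_sets by blast
  qed
  have "finite_measure (exp_measure \<mu> a)"
    using emeasure_exp_measure[OF assms] by (intro finite_measureI) simp
  then show ?thesis using assms null unfolding manifold_M_def absolutely_continuous_def by auto
qed

lemma manifold_M_eq: "manifold_M k \<mu> = exp_measure \<mu> ` vecs G"
  using exp_measure_mem_M by (auto simp: manifold_M_def)

lemma exp_on_cancel:
  assumes "a \<in> vecs G" "b \<in> vecs G" "exp_on (space \<mu>) a = exp_on (space \<mu>) b"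
  shows "a = b"
proof
  fix x show "a x = b x"
    using fun_cong[OF assms(3), of x] memD(1)[OF assms(1), of x] memD(1)[OF assms(2), of x]
    by (cases "x \<in> space \<mu>") (auto simp: exp_on_def)
qed

lemma exp_measure_inj:
  assumes "a \<in> vecs G" "b \<in> vecs G" "exp_measure \<mu> a = exp_measure \<mu> b"
  shows "a = b"
proof -
  have "AE x in \<mu>. ennreal (exp_on (space \<mu>) a x) = ennreal (exp_on (space \<mu>) b x)"
    using assms(3) measurable_mem[OF exp_mem[OF assms(1)]] measurable_mem[OF exp_mem[OF assms(2)]]
    unfolding exp_measure_def by (intro density_unique_iff[THEN iffD1]) auto
  then have "AE x in \<mu>. exp_on (space \<mu>) a x = exp_on (space \<mu>) b x" by simp
  then show ?thesis using AE_eq_imp_eq exp_on_cancel assms by simp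
qed

lemma chart_1_exp_measure [simp]: "a \<in> vecs G \<Longrightarrow> chart_1 k \<mu> (exp_measure \<mu> a) = a"
  unfolding chart_1_def using exp_measure_inj by (intro the_equality) auto

lemma inv_chart_1 [simp]:
  assumes "a \<in> vecs G"
  shows "inv_into (manifold_M k \<mu>) (chart_1 k \<mu>) a = exp_measure \<mu> a"
proof (rule inv_into_f_eq)
  show "inj_on (chart_1 k \<mu>) (manifold_M k \<mu>)" unfolding manifold_M_eq by (auto simp: inj_on_def)
qed (use assms in \<open>auto simp: manifold_M_eq\<close>)

subsection \<open>Normalisation and the exponential chart\<close>

text \<open>
  The logarithm of the normalised density, that is, \<open>\<phi>\<^sub>1 \<circ> \<nu> \<circ> \<phi>\<^sub>1\<^sup>-\<^sup>1\<close>.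
\<close>

definition \<theta> :: "('a \<Rightarrow> real) \<Rightarrow> 'a \<Rightarrow> real"
  where "\<theta> a = a - ln (Z a) *\<^sub>R one"

definition centre :: "('a \<Rightarrow> real) \<Rightarrow> 'a \<Rightarrow> real"
  where "centre a = a - (\<integral>x. a x \<partial>\<mu>) *\<^sub>R one"

lemma \<theta>_mem [simp]: "a \<in> vecs G \<Longrightarrow> \<theta> a \<in> vecs G"
  by (auto simp: \<theta>_def)

lemma exp_on_shift: "exp_on (space \<mu>) (a + c *\<^sub>R one) = exp c *\<^sub>R exp_on (space \<mu>) a"
  by (auto simp: exp_on_def fun_eq_iff scaleR_fun_def exp_add mult.commute)

lemma exp_on_\<theta>:
  assumes "a \<in> vecs G"
  shows "exp_on (space \<mu>) (\<theta> a) = (1 / Z a) *\<^sub>R exp_on (space \<mu>) a"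
  using exp_on_shift[of a "- ln (Z a)"] Z_pos[OF assms] by (simp add: \<theta>_def exp_minus inverse_eq_divide)

lemma Z_\<theta> [simp]: "a \<in> vecs G \<Longrightarrow> Z (\<theta> a) = 1"
  using Z_pos[of a] by (simp add: Z_def[of "\<theta> a"] exp_on_\<theta>) (simp add: Z_def)

lemma Z_shift: "Z (a + c *\<^sub>R one) = exp c * Z a"
  by (simp add: Z_def exp_on_shift)

lemma \<theta>_shift:
  assumes "a \<in> vecs G"
  shows "\<theta> (a + c *\<^sub>R one) = \<theta> a"
  using Z_pos[OF assms] by (simp add: \<theta>_def Z_shift ln_mult algebra_simps)

lemma \<theta>_fixed: "Z a = 1 \<Longrightarrow> \<theta> a = a"
  by (simp add: \<theta>_def)

lemma normalise_exp_measure: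
  assumes "a \<in> vecs G"
  shows "normalise \<mu> (exp_measure \<mu> a) = exp_measure \<mu> (\<theta> a)"
proof (rule measure_eqI)
  note Z = Z_pos[OF assms]
  note m = measurable_mem[OF exp_mem[OF assms]] measurable_mem[OF exp_mem[OF \<theta>_mem[OF assms]]]
  have inv: "1 / ennreal (Z a) = ennreal (1 / Z a)"
    using Z by (metis divide_ennreal ennreal_1 zero_le_one)
  fix A assume "A \<in> sets (normalise \<mu> (exp_measure \<mu> a))"
  then have A: "A \<in> sets \<mu>" by (simp add: normalise_def)
  have "emeasure (normalise \<mu> (exp_measure \<mu> a)) A = ennreal (1 / Z a) * (\<integral>\<^sup>+x. ennreal (exp_on (space \<mu>) a x) * indicator A x \<partial>\<mu>)"
    using A m unfolding normalise_def emeasure_scale_measure emeasure_exp_measure[OF assms] inv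
    unfolding exp_measure_def by (simp add: emeasure_density)
  also have "\<dots> = (\<integral>\<^sup>+x. ennreal (1 / Z a) * (ennreal (exp_on (space \<mu>) a x) * indicator A x) \<partial>\<mu>)"
    using A m by (intro nn_integral_cmult[symmetric]) auto
  also have "\<dots> = (\<integral>\<^sup>+x. ennreal (exp_on (space \<mu>) (\<theta> a) x) * indicator A x \<partial>\<mu>)"
    using Z by (intro nn_integral_cong)
      (simp add: exp_on_\<theta>[OF assms] scaleR_fun_def ennreal_mult'[symmetric] mult.assoc[symmetric])
  also have "\<dots> = emeasure (exp_measure \<mu> (\<theta> a)) A"
    using A m unfolding exp_measure_def by (simp add: emeasure_density)
  finally show "emeasure (normalise \<mu> (exp_measure \<mu> a)) A = emeasure (exp_measure \<mu> (\<theta> a)) A" .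
qed (simp add: normalise_def)

lemma centre_mem [simp]: "a \<in> vecs G \<Longrightarrow> centre a \<in> vecs G"
  by (auto simp: centre_def)

lemma integral_centre [simp]: "a \<in> vecs G \<Longrightarrow> (\<integral>x. centre a x \<partial>\<mu>) = 0"
  by (simp add: centre_def)

lemma vecs_GG0: "vecs (GG0 k \<mu>) = {a \<in> vecs G. (\<integral>x. a x \<partial>\<mu>) = 0}"
  and nrm_GG0 [simp]: "nrm (GG0 k \<mu>) = nrm G"
  by (simp_all add: GG0_def)

lemma GG0_mem: "a \<in> vecs (GG0 k \<mu>) \<Longrightarrow> a \<in> vecs G"
  by (simp add: vecs_GG0)

lemma centre_mem_GG0 [simp]: "a \<in> vecs G \<Longrightarrow> centre a \<in> vecs (GG0 k \<mu>)"
  by (simp add: vecs_GG0)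

lemma centre_GG0 [simp]: "a \<in> vecs (GG0 k \<mu>) \<Longrightarrow> centre a = a"
  by (simp add: vecs_GG0 centre_def)

lemma normed_GG0: "normed_carrier (GG0 k \<mu>)"
proof (rule normed_carrierI)
  show "0 \<in> vecs (GG0 k \<mu>)" by (simp add: vecs_GG0)
  show "x + y \<in> vecs (GG0 k \<mu>)" if "x \<in> vecs (GG0 k \<mu>)" "y \<in> vecs (GG0 k \<mu>)" for x y
    using that by (simp add: vecs_GG0)
  show "c *\<^sub>R x \<in> vecs (GG0 k \<mu>)" if "x \<in> vecs (GG0 k \<mu>)" for x c
    using that by (simp add: vecs_GG0)
qed (auto simp: vecs_GG0 G.nrm_triangle G.nrm_scale intro: G.nrm_definite)

sublocale G0: normed_carrier "GG0 k \<mu>" by (rule normed_GG0)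

lemma centre_shift: "a \<in> vecs G \<Longrightarrow> centre (a + c *\<^sub>R one) = centre a"
  by (simp add: centre_def algebra_simps)

lemma centre_\<theta> [simp]: "a \<in> vecs G \<Longrightarrow> centre (\<theta> a) = centre a"
  using centre_shift[of a "- ln (Z a)"] by (simp add: \<theta>_def)

lemma \<theta>_centre: "a \<in> vecs G \<Longrightarrow> \<theta> (centre a) = \<theta> a"
  using \<theta>_shift[of a "- (\<integral>x. a x \<partial>\<mu>)"] by (simp add: centre_def)

text \<open>
  On \<open>G\<^sub>0\<close> this is the inverse of the chart \<open>\<phi>\<^sub>e\<close>.
\<close>

definition Pt :: "('a \<Rightarrow> real) \<Rightarrow> 'a measure"
  where "Pt a = exp_measure \<mu> (\<theta> a)"

lemma manifold_N_eq: "manifold_N k \<mu> = Pt ` vecs (GG0 k \<mu>)"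
proof
  show "Pt ` vecs (GG0 k \<mu>) \<subseteq> manifold_N k \<mu>"
    using GG0_mem by (auto simp: manifold_N_def manifold_M_eq Pt_def emeasure_exp_measure)
  show "manifold_N k \<mu> \<subseteq> Pt ` vecs (GG0 k \<mu>)"
  proof
    fix P assume "P \<in> manifold_N k \<mu>"
    then obtain b where b: "b \<in> vecs G" "P = exp_measure \<mu> b" and "emeasure P (space \<mu>) = 1"
      by (auto simp: manifold_N_def manifold_M_eq)
    then have "ennreal (Z b) = ennreal 1" by (simp add: emeasure_exp_measure)
    then have "Z b = 1" using Z_pos[OF b(1)] by (subst (asm) ennreal_inj) auto
    then have "P = Pt (centre b)" using b by (simp add: Pt_def \<theta>_centre \<theta>_fixed)
    then show "P \<in> Pt ` vecs (GG0 k \<mu>)" using b(1) by auto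
  qed
qed

lemma chart_e_exp_measure: "a \<in> vecs G \<Longrightarrow> chart_e k \<mu> (exp_measure \<mu> a) = centre a"
  by (simp add: chart_e_def centre_def)

lemma chart_e_Pt [simp]: "a \<in> vecs (GG0 k \<mu>) \<Longrightarrow> chart_e k \<mu> (Pt a) = a"
  using GG0_mem[of a] by (simp add: Pt_def chart_e_exp_measure)

lemma inv_chart_e [simp]:
  assumes "a \<in> vecs (GG0 k \<mu>)"
  shows "inv_into (manifold_N k \<mu>) (chart_e k \<mu>) a = Pt a"
proof (rule inv_into_f_eq)
  show "inj_on (chart_e k \<mu>) (manifold_N k \<mu>)" unfolding manifold_N_eq by (auto simp: inj_on_def)
qed (use assms in \<open>auto simp: manifold_N_eq\<close>)

lemma normalise_Pt: "a \<in> vecs G \<Longrightarrow> normalise \<mu> (Pt a) = Pt a"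
  by (simp add: Pt_def normalise_exp_measure \<theta>_fixed)

subsection \<open>Tangent vectors\<close>

lemma signed_density_inj:
  assumes a: "a \<in> vecs G" and u: "u \<in> vecs G" and v: "v \<in> vecs G"
    and eq: "signed_density (exp_measure \<mu> a) u = signed_density (exp_measure \<mu> a) v"
  shows "u = v"
proof -
  have "set_lebesgue_integral (exp_measure \<mu> a) A u = set_lebesgue_integral (exp_measure \<mu> a) A v"
    if "A \<in> sets (exp_measure \<mu> a)" for A
    using fun_cong[OF eq, of A] that by (simp add: signed_density_def)
  then have "AE x in exp_measure \<mu> a. u x = v x"
    using integrable_exp_measure[OF a] u v by (intro density_unique_real) auto
  then have "AE x in \<mu>. u x = v x"
    using measurable_mem[OF exp_mem[OF a]] unfolding exp_measure_def
    by (subst (asm) AE_density) (auto simp: exp_on_def elim: AE_mp)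
  then show ?thesis using AE_eq_imp_eq u v by simp
qed

lemma signed_density_add:
  assumes "a \<in> vecs G" "u \<in> vecs G" "v \<in> vecs G"
  shows "signed_density (exp_measure \<mu> a) (u + v) = signed_density (exp_measure \<mu> a) u + signed_density (exp_measure \<mu> a) v"
proof
  fix A
  have i: "set_integrable (exp_measure \<mu> a) A f" if "A \<in> sets \<mu>" "f \<in> vecs G" for f
    using integrable_exp_measure[OF assms(1) that(2)] that(1)
    unfolding set_integrable_def by (intro integrable_mult_indicator) auto
  show "signed_density (exp_measure \<mu> a) (u + v) A = (signed_density (exp_measure \<mu> a) u + signed_density (exp_measure \<mu> a) v) A"
    using set_integral_add(2)[OF i[of u] i[of v]] assms(2,3) by (auto simp: signed_density_def plus_fun_def)
qed

lemma signed_density_scale: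
  "signed_density P (c *\<^sub>R u) = c *\<^sub>R signed_density P u"
  by (auto simp: signed_density_def scaleR_fun_def fun_eq_iff)

lemma tangent_density_eq [simp]:
  "a \<in> vecs G \<Longrightarrow> u \<in> vecs G \<Longrightarrow> tangent_density k \<mu> (exp_measure \<mu> a) (signed_density (exp_measure \<mu> a) u) = u"
  unfolding tangent_density_def using signed_density_inj by (intro the_equality) auto

lemma signed_density_space:
  assumes "a \<in> vecs G" "u \<in> vecs G"
  shows "signed_density (exp_measure \<mu> a) u (space \<mu>) = (\<integral>x. u x \<partial>exp_measure \<mu> a)"
  using set_integral_space[OF integrable_exp_measure[OF assms]] by (simp add: signed_density_def)

end

section \<open>Second derivatives\<close>

lemma nth_fderiv_cong:
  assumes "\<And>x. x \<in> S \<Longrightarrow> f x = g x"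
  shows "x \<in> S \<Longrightarrow> nth_fderiv i E F S f x = nth_fderiv i E F S g x"
proof (induction i arbitrary: x)
  case (Suc i)
  have "fderiv E (multilin i E F) S (nth_fderiv i E F S f) x = fderiv E (multilin i E F) S (nth_fderiv i E F S g) x"
    using Suc by (intro fderiv_cong) auto
  then show ?case by simp
qed (use assms in auto)

lemma smooth_nspace_cong:
  assumes "\<And>x. x \<in> S \<Longrightarrow> f x = g x"
  shows "smooth_nspace E F S f \<longleftrightarrow> smooth_nspace E F S g"
proof -
  have "Ck_on k E F S f \<longleftrightarrow> Ck_on k E F S g" for k
    unfolding Ck_on_def ncontinuous_on_def
    using assms nth_fderiv_cong[of S f g, OF assms]
      has_fderiv_cong[of S "nth_fderiv _ E F S f" "nth_fderiv _ E F S g", OF nth_fderiv_cong[of S f g, OF assms]]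
    by simp
  then show ?thesis unfolding smooth_nspace_def by simp
qed

lemma eval_bounded_lin:
  assumes "normed_carrier E" "normed_carrier F" "length hs = i" "set hs \<subseteq> vecs E"
  shows "(\<lambda>T. if T \<in> vecs (multilin i E F) then T hs else 0) \<in> bounded_lin (multilin i E F) F"
proof -
  interpret M: normed_carrier "multilin i E F" by (rule normed_carrier_multilin[OF assms(1,2)])
  show ?thesis
  proof (rule bounded_linI[where C = "prod_list (map (nrm E) hs)"])
    show "nrm F (if T \<in> vecs (multilin i E F) then T hs else 0) \<le> prod_list (map (nrm E) hs) * nrm (multilin i E F) T"
      if "T \<in> vecs (multilin i E F)" for T
      using multilin_apply_le[OF assms(1,2) that assms(3,4)] that by (simp add: mult.commute)
    show "(if c *\<^sub>R T \<in> vecs (multilin i E F) then (c *\<^sub>R T) hs else 0) =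
        c *\<^sub>R (if T \<in> vecs (multilin i E F) then T hs else 0)"
      if "T \<in> vecs (multilin i E F)" for T c
      using that by simp (simp add: scaleR_fun_def)
    show "(if T \<in> vecs (multilin i E F) then T hs else 0) \<in> vecs F" if "T \<in> vecs (multilin i E F)" for T
      using multilin_memD(1)[OF that assms(3,4)] that by simp
  qed auto
qed

declare nth_fderiv.simps(2) [simp del]

locale twice_differentiable =
  E: normed_carrier E + F: normed_carrier F
  for E :: "'v::real_vector nspace" and F :: "'w::real_vector nspace" +
  fixes f :: "'v \<Rightarrow> 'w"
  assumes C2: "Ck_on 2 E F (vecs E) f"
begin

definition d1 :: "'v \<Rightarrow> 'v \<Rightarrow> 'w"
  where "d1 a h = nth_fderiv (Suc 0) E F (vecs E) f a [h]"

text \<open>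
  In \<open>d2 a h h'\<close> the map is differentiated along \<open>h'\<close> first, and the result along \<open>h\<close>.
\<close>

definition d2 :: "'v \<Rightarrow> 'v \<Rightarrow> 'v \<Rightarrow> 'w"
  where "d2 a h h' = nth_fderiv (Suc (Suc 0)) E F (vecs E) f a [h, h']"

abbreviation M where "M i \<equiv> multilin i E F"
abbreviation N where "N i \<equiv> nth_fderiv i E F (vecs E) f"

lemma normed_M: "normed_carrier (M i)"
  by (rule normed_carrier_multilin[OF E.normed_carrier_axioms F.normed_carrier_axioms])

lemma N_mem: "i \<le> 2 \<Longrightarrow> a \<in> vecs E \<Longrightarrow> N i a \<in> vecs (M i)"
  and N_has_fderiv: "i < 2 \<Longrightarrow> a \<in> vecs E \<Longrightarrow>
    has_fderiv E (M i) (vecs E) (N i) (\<lambda>h t. N (Suc i) a (h # t)) a"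
  using Ck_on_nth[OF E.normed_carrier_axioms F.normed_carrier_axioms
      inner_point_vecs[OF E.normed_carrier_axioms] C2] by blast+

lemma f_mem: "a \<in> vecs E \<Longrightarrow> f a \<in> vecs F"
  using C2 unfolding Ck_on_def by blast

lemma d1_mem [simp]: "a \<in> vecs E \<Longrightarrow> h \<in> vecs E \<Longrightarrow> d1 a h \<in> vecs F"
  using multilin_memD(1)[OF N_mem[of "Suc 0"], of a "[h]"] by (simp add: d1_def del: nth_fderiv.simps)

lemma d2_mem [simp]: "a \<in> vecs E \<Longrightarrow> h \<in> vecs E \<Longrightarrow> h' \<in> vecs E \<Longrightarrow> d2 a h h' \<in> vecs F"
  using multilin_memD(1)[OF N_mem[of "Suc (Suc 0)"], of a "[h, h']"] by (simp add: d2_def del: nth_fderiv.simps)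

lemma has_fderiv_d1:
  assumes a: "a \<in> vecs E"
  shows "has_fderiv E F (vecs E) f (d1 a) a"
proof -
  let ?ev = "\<lambda>T. if T \<in> vecs (M 0) then T [] else 0"
  note D = N_has_fderiv[OF _ a, of 0]
  have "has_fderiv E F (vecs E) (\<lambda>y. ?ev (N 0 y)) (\<lambda>h. ?ev (\<lambda>t. N (Suc 0) a (h # t))) a"
  proof (rule has_fderiv_chain[where f = "N 0" and g = ?ev and B = ?ev and A = "\<lambda>h t. N (Suc 0) a (h # t)",
        OF E.normed_carrier_axioms normed_M[of 0] F.normed_carrier_axioms subset_refl a subset_refl])
    show "has_fderiv (M 0) F (vecs (M 0)) ?ev ?ev (N 0 a)"
      using N_mem[of 0 a] a eval_bounded_lin[OF E.normed_carrier_axioms F.normed_carrier_axioms, of "[]" 0]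
      by (intro has_fderiv_bounded_lin normed_M F.normed_carrier_axioms) auto
    show "N 0 y \<in> vecs (M 0)" if "y \<in> vecs E" for y using N_mem[of 0 y] that by simp
    show "?ev T \<in> vecs F" for T using multilin_memD(1)[of T 0 E F "[]"] by auto
    show "has_fderiv E (M 0) (vecs E) (N 0) (\<lambda>h t. N (Suc 0) a (h # t)) a" by (rule D) simp
  qed
  moreover have "(\<lambda>h. ?ev (\<lambda>t. N (Suc 0) a (h # t))) = d1 a"
  proof
    fix h
    have b: "(\<lambda>h t. N (Suc 0) a (h # t)) \<in> bounded_lin E (M 0)" using has_fderivD(1)[OF D] by simp
    show "?ev (\<lambda>t. N (Suc 0) a (h # t)) = d1 a h"
      using bounded_linD(1)[OF b, of h] fun_cong[OF bounded_linD(4)[OF b, of h], of "[]"]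
      by (cases "h \<in> vecs E") (auto simp: d1_def simp del: nth_fderiv.simps)
  qed
  moreover have "?ev (N 0 y) = f y" if "y \<in> vecs E" for y
    using N_mem[of 0 y] that by auto
  ultimately show ?thesis
    using has_fderiv_cong[of "vecs E" "\<lambda>y. ?ev (N 0 y)" f a E F "d1 a"] a by simp
qed

lemmas d1_lin = bounded_linD[OF has_fderivD(1)[OF has_fderiv_d1]]

text \<open>
  The first derivative lies in a space of linear maps, whose evaluation at a vector is bilinear.
\<close>

lemma has_fderiv_d1_apply:
  assumes a: "a \<in> vecs E" and u: "\<And>y. y \<in> vecs E \<Longrightarrow> u y \<in> vecs E"
    and U: "has_fderiv E E (vecs E) u U a"
  shows "has_fderiv E F (vecs E) (\<lambda>y. d1 y (u y)) (\<lambda>h. d2 a h (u a) + d1 a (U h)) a"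
proof -
  have "has_fderiv E F (vecs E) (\<lambda>y. (\<lambda>T x. T [x]) (N (Suc 0) y) (u y))
    (\<lambda>h. (\<lambda>T x. T [x]) (\<lambda>t. N (Suc (Suc 0)) a (h # t)) (u a) + (\<lambda>T x. T [x]) (N (Suc 0) a) (U h)) a"
  proof (rule has_fderiv_bilinear[where F = "M (Suc 0)" and G = E and K = 1])
    show "N (Suc 0) y \<in> vecs (M (Suc 0))" if "y \<in> vecs E" for y using N_mem[of "Suc 0"] that by simp
    show "has_fderiv E (M (Suc 0)) (vecs E) (N (Suc 0)) (\<lambda>h t. N (Suc (Suc 0)) a (h # t)) a"
      by (rule N_has_fderiv) (use a in auto)
    show "T [c *\<^sub>R x] = c *\<^sub>R T [x]" if "T \<in> vecs (M (Suc 0))" "x \<in> vecs E" for T c x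
      using multilin_memD(3)[OF that(1), of x "[]" "[]" c] that(2) by simp
    show "T [x + y] = T [x] + T [y]" if "T \<in> vecs (M (Suc 0))" "x \<in> vecs E" "y \<in> vecs E" for T x y
      using multilin_memD(2)[OF that(1), of x y "[]" "[]"] that(2,3) by simp
    show "nrm F (T [x]) \<le> 1 * nrm (M (Suc 0)) T * nrm E x" if "T \<in> vecs (M (Suc 0))" "x \<in> vecs E" for T x
      using multilin_apply_le[OF E.normed_carrier_axioms F.normed_carrier_axioms that(1), of "[x]"] that(2) by simp
    show "T [x] \<in> vecs F" if "T \<in> vecs (M (Suc 0))" "x \<in> vecs E" for T x
      using multilin_memD(1)[OF that(1), of "[x]"] that(2) by simp
  qed (use a u U normed_M E.normed_carrier_axioms F.normed_carrier_axioms in \<open>auto simp: scaleR_fun_def\<close>)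
  then show ?thesis by (simp add: d1_def d2_def del: nth_fderiv.simps)
qed

end

text \<open>
  Evaluation at \<open>x\<close> is a bounded functional, which makes one-variable calculus available along lines.
\<close>

lemma has_real_derivative_line:
  fixes E :: "'v::real_vector nspace" and F :: "('x \<Rightarrow> real) nspace"
  assumes E: "normed_carrier E" and F: "normed_carrier F"
    and ev: "\<And>b. b \<in> vecs F \<Longrightarrow> \<bar>b x\<bar> \<le> nrm F b"
    and f: "\<And>y. y \<in> vecs E \<Longrightarrow> f y \<in> vecs F"
    and A: "\<And>y. y \<in> vecs E \<Longrightarrow> has_fderiv E F (vecs E) f (A y) y"
    and b: "b \<in> vecs E" and h: "h \<in> vecs E"
  shows "((\<lambda>s. f (b + s *\<^sub>R h) x) has_real_derivative A (b + s *\<^sub>R h) h x) (at s)"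
proof -
  interpret E: normed_carrier E by fact
  interpret F: normed_carrier F by fact
  note R = normed_carrier_type_space
  let ?T = "type_space :: real nspace"
  let ?y = "b + s *\<^sub>R h"
  let ?ev = "\<lambda>b. if b \<in> vecs F then b x else (0::real)"
  have y: "?y \<in> vecs E" using b h by simp
  have sh: "(\<lambda>s. s *\<^sub>R h) \<in> bounded_lin ?T E"
    by (rule bounded_linI[where C = "nrm E h"]) (use h in \<open>auto simp: scaleR_add_left E.nrm_scale mult.commute\<close>)
  have "has_fderiv ?T E UNIV (\<lambda>s. b + s *\<^sub>R h) (\<lambda>t. 0 + t *\<^sub>R h) s"
    by (intro has_fderiv_add has_fderiv_const has_fderiv_bounded_lin R E sh) (use b h in auto)
  then have 1: "has_fderiv ?T E UNIV (\<lambda>s. b + s *\<^sub>R h) (\<lambda>t. t *\<^sub>R h) s" by simp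
  have 2: "has_fderiv ?T F UNIV (\<lambda>s. f (b + s *\<^sub>R h)) (\<lambda>t. A ?y (t *\<^sub>R h)) s"
    by (rule has_fderiv_chain[OF R E F _ _ _ _ _ 1 A[OF y]]) (use b h f in auto)
  have evl: "?ev \<in> bounded_lin F ?T"
  proof (rule bounded_linI[where C = 1])
    show "?ev (c *\<^sub>R b) = c *\<^sub>R ?ev b" if "b \<in> vecs F" for b c
      using that by simp (simp add: scaleR_fun_def)
  qed (use ev in auto)
  have "has_fderiv ?T ?T UNIV (\<lambda>s. ?ev (f (b + s *\<^sub>R h))) (\<lambda>t. ?ev (A ?y (t *\<^sub>R h))) s"
    by (rule has_fderiv_chain[OF R F R _ _ _ _ _ 2 has_fderiv_bounded_lin[OF F R subset_refl _ evl]]) (use b h f in auto)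
  then have "((\<lambda>s. ?ev (f (b + s *\<^sub>R h))) has_derivative (\<lambda>t. ?ev (A ?y (t *\<^sub>R h)))) (at s)"
    unfolding has_fderiv_type_space .
  moreover have "(\<lambda>s. ?ev (f (b + s *\<^sub>R h))) = (\<lambda>s. f (b + s *\<^sub>R h) x)" using f b h by auto
  moreover have "?ev (A ?y (t *\<^sub>R h)) = A ?y h x * t" for t
  proof -
    have "A ?y (t *\<^sub>R h) = t *\<^sub>R A ?y h" "A ?y h \<in> vecs F"
      using bounded_linD(1,3)[OF has_fderivD(1)[OF A[OF y]]] h by auto
    then show ?thesis by simp (simp add: scaleR_fun_def)
  qed
  ultimately show ?thesis by (simp add: has_field_derivative_def)
qed

locale twice_differentiable_fun = twice_differentiable E F f
  for E :: "'v::real_vector nspace" and F :: "('x \<Rightarrow> real) nspace" and f +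
  assumes eval_le_nrm: "\<And>b x. b \<in> vecs F \<Longrightarrow> \<bar>b x\<bar> \<le> nrm F b"
begin

text \<open>
  The mean value theorem along \<open>h\<close>, and then for the derivative in direction \<open>h\<close> along \<open>h'\<close>.
\<close>

lemma second_difference:
  assumes a: "a \<in> vecs E" and h: "h \<in> vecs E" "h' \<in> vecs E" and t: "t > 0"
  obtains y where "y \<in> vecs E" "nrm E (y - a) \<le> t * (nrm E h + nrm E h')"
    "f (a + t *\<^sub>R h + t *\<^sub>R h') x - f (a + t *\<^sub>R h) x - f (a + t *\<^sub>R h') x + f a x = t\<^sup>2 * d2 y h' h x"
proof -
  note E = E.normed_carrier_axioms and F = F.normed_carrier_axioms
  have p: "((\<lambda>s. f (b + s *\<^sub>R h) x) has_real_derivative d1 (b + s *\<^sub>R h) h x) (at s)" if "b \<in> vecs E" for b s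
    using that h by (intro has_real_derivative_line[OF E F eval_le_nrm f_mem has_fderiv_d1]) auto
  have q: "((\<lambda>s. d1 (b + s *\<^sub>R h') h x) has_real_derivative d2 (b + s *\<^sub>R h') h' h x) (at s)" if b: "b \<in> vecs E" for b s
  proof -
    have D: "has_fderiv E F (vecs E) (\<lambda>y. d1 y h) (\<lambda>k. d2 y k h + d1 y 0) y" if "y \<in> vecs E" for y
      using that h by (intro has_fderiv_d1_apply has_fderiv_const E) auto
    have "((\<lambda>s. d1 (b + s *\<^sub>R h') h x) has_real_derivative (d2 (b + s *\<^sub>R h') h' h + d1 (b + s *\<^sub>R h') 0) x) (at s)"
      using b h by (intro has_real_derivative_line[OF E F eval_le_nrm _ D]) auto
    moreover have "d1 (b + s *\<^sub>R h') 0 = 0"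
      using d1_lin(3)[of "b + s *\<^sub>R h'" 0 0] b h by simp
    ultimately show ?thesis by simp
  qed
  let ?\<psi> = "\<lambda>s. f ((a + t *\<^sub>R h') + s *\<^sub>R h) x - f (a + s *\<^sub>R h) x"
  obtain \<xi> where xi: "0 < \<xi>" "\<xi> < t" "?\<psi> t - ?\<psi> 0 = (t - 0) * (d1 ((a + t *\<^sub>R h') + \<xi> *\<^sub>R h) h x - d1 (a + \<xi> *\<^sub>R h) h x)"
  proof -
    have "(?\<psi> has_real_derivative (d1 ((a + t *\<^sub>R h') + s *\<^sub>R h) h x - d1 (a + s *\<^sub>R h) h x)) (at s)" for s
      using a h by (intro DERIV_diff p) auto
    from MVT2[OF t this] show thesis using that by blast
  qed
  let ?\<chi> = "\<lambda>r. d1 ((a + \<xi> *\<^sub>R h) + r *\<^sub>R h') h x"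
  obtain \<eta> where eta: "0 < \<eta>" "\<eta> < t" "?\<chi> t - ?\<chi> 0 = (t - 0) * d2 ((a + \<xi> *\<^sub>R h) + \<eta> *\<^sub>R h') h' h x"
  proof -
    have "(?\<chi> has_real_derivative d2 ((a + \<xi> *\<^sub>R h) + s *\<^sub>R h') h' h x) (at s)" for s
      using a h by (intro q) auto
    from MVT2[OF t this] show thesis using that by blast
  qed
  let ?y = "(a + \<xi> *\<^sub>R h) + \<eta> *\<^sub>R h'"
  have "?\<psi> t - ?\<psi> 0 = t * (?\<chi> t - ?\<chi> 0)" using xi(3) by (simp add: ac_simps)
  also have "\<dots> = t\<^sup>2 * d2 ?y h' h x" using eta(3) by (simp add: power2_eq_square)
  finally have "f (a + t *\<^sub>R h + t *\<^sub>R h') x - f (a + t *\<^sub>R h) x - f (a + t *\<^sub>R h') x + f a x = t\<^sup>2 * d2 ?y h' h x"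
    by (simp add: ac_simps)
  moreover have "nrm E (?y - a) \<le> t * (nrm E h + nrm E h')"
  proof -
    have "?y - a = \<xi> *\<^sub>R h + \<eta> *\<^sub>R h'" by simp
    then have "nrm E (?y - a) \<le> \<xi> * nrm E h + \<eta> * nrm E h'"
      using E.nrm_triangle[of "\<xi> *\<^sub>R h" "\<eta> *\<^sub>R h'"] E.nrm_scale h xi eta by simp
    also have "\<dots> \<le> t * nrm E h + t * nrm E h'" using xi eta h by (intro add_mono mult_right_mono) auto
    finally show ?thesis by (simp add: distrib_left)
  qed
  ultimately show thesis using that[of ?y] a h by simp
qed

text \<open>The second difference is symmetric in the two directions.\<close>

lemma d2_symmetric:
  assumes a: "a \<in> vecs E" and h: "h \<in> vecs E" "h' \<in> vecs E"
  shows "d2 a h h' = d2 a h' h"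
proof
  fix x
  let ?n = "nrm E h + nrm E h'"
  have n: "0 \<le> ?n" using h by simp
  have near: "\<exists>d>0. \<forall>y\<in>vecs E. nrm E (y - a) < d \<longrightarrow> \<bar>d2 y u v x - d2 a u v x\<bar> < e"
    if e: "e > 0" and uv: "u \<in> vecs E" "v \<in> vecs E" for e u v
  proof -
    let ?M = "M (Suc (Suc 0))"
    interpret M: normed_carrier ?M by (rule normed_M)
    define c where "c = nrm E u * nrm E v + 1"
    have c: "c > 0" using uv by (simp add: c_def add_nonneg_pos)
    have "ncontinuous_on E ?M (vecs E) (N (Suc (Suc 0)))" using C2 unfolding Ck_on_def numeral_2_eq_2 by blast
    from this[unfolded ncontinuous_on_def, rule_format, OF a divide_pos_pos[OF e c]]
    obtain d where d: "d > 0" "\<And>y. y \<in> vecs E \<Longrightarrow> nrm E (y - a) < d \<Longrightarrow> nrm ?M (N (Suc (Suc 0)) y - N (Suc (Suc 0)) a) < e / c"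
      by blast
    have "\<bar>d2 y u v x - d2 a u v x\<bar> < e" if y: "y \<in> vecs E" "nrm E (y - a) < d" for y
    proof -
      let ?T = "N (Suc (Suc 0)) y - N (Suc (Suc 0)) a"
      have T: "?T \<in> vecs ?M" by (intro M.diff_mem N_mem) (use a y in auto)
      have Tn: "nrm ?M ?T < e / c" using d(2)[OF y] .
      have "\<bar>d2 y u v x - d2 a u v x\<bar> = \<bar>?T [u, v] x\<bar>" by (simp add: d2_def del: nth_fderiv.simps)
      also have "\<dots> \<le> nrm F (?T [u, v])" using eval_le_nrm[OF multilin_memD(1)[OF T, of "[u, v]"], of x] uv by simp
      also have "\<dots> \<le> nrm ?M ?T * (nrm E u * nrm E v)"
        using multilin_apply_le[OF E.normed_carrier_axioms F.normed_carrier_axioms T, of "[u, v]"] uv by simp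
      also have "\<dots> \<le> nrm ?M ?T * c" using M.nrm_nonneg[OF T] by (intro mult_left_mono) (auto simp: c_def)
      also have "\<dots> < e / c * c" using Tn c by (intro mult_strict_right_mono)
      finally show ?thesis using c by simp
    qed
    then show ?thesis using d(1) by blast
  qed
  have "\<bar>d2 a h h' x - d2 a h' h x\<bar> \<le> e" if e: "e > 0" for e
  proof -
    from e have e2: "e / 2 > 0" by simp
    obtain d where d: "d > 0" "\<And>y. y \<in> vecs E \<Longrightarrow> nrm E (y - a) < d \<Longrightarrow> \<bar>d2 y h h' x - d2 a h h' x\<bar> < e / 2"
      using near[OF e2 h] by blast
    obtain d' where d': "d' > 0" "\<And>y. y \<in> vecs E \<Longrightarrow> nrm E (y - a) < d' \<Longrightarrow> \<bar>d2 y h' h x - d2 a h' h x\<bar> < e / 2"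
      using near[OF e2 h(2,1)] by blast
    define t where "t = min d d' / (?n + 1)"
    have t: "t > 0" using d d' n by (simp add: t_def)
    have "t * (?n + 1) = min d d'" using n by (simp add: t_def)
    then have tn: "t * ?n < min d d'" using t unfolding distrib_left by linarith
    obtain y where y: "y \<in> vecs E" "nrm E (y - a) \<le> t * (nrm E h + nrm E h')"
      "f (a + t *\<^sub>R h + t *\<^sub>R h') x - f (a + t *\<^sub>R h) x - f (a + t *\<^sub>R h') x + f a x = t\<^sup>2 * d2 y h' h x"
      using second_difference[OF a h t] by blast
    obtain z where z: "z \<in> vecs E" "nrm E (z - a) \<le> t * (nrm E h' + nrm E h)"
      "f (a + t *\<^sub>R h' + t *\<^sub>R h) x - f (a + t *\<^sub>R h') x - f (a + t *\<^sub>R h) x + f a x = t\<^sup>2 * d2 z h h' x"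
      using second_difference[OF a h(2,1) t] by blast
    have comm: "a + t *\<^sub>R h' + t *\<^sub>R h = a + t *\<^sub>R h + t *\<^sub>R h'" by (simp add: ac_simps)
    have "t\<^sup>2 * d2 y h' h x = t\<^sup>2 * d2 z h h' x" using y(3) z(3)[unfolded comm] by linarith
    then have "d2 y h' h x = d2 z h h' x" using t by simp
    moreover have "\<bar>d2 y h' h x - d2 a h' h x\<bar> < e / 2" using d'(2)[OF y(1)] y(2) tn by simp
    moreover have "\<bar>d2 z h h' x - d2 a h h' x\<bar> < e / 2" using d(2)[OF z(1)] z(2) tn by (simp add: add.commute)
    ultimately show ?thesis by linarith
  qed
  then have "\<bar>d2 a h h' x - d2 a h' h x\<bar> \<le> 0 + e" if "e > 0" for e using that by simp
  then have "\<bar>d2 a h h' x - d2 a h' h x\<bar> \<le> 0" by (rule field_le_epsilon)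
  then show "d2 a h h' x = d2 a h' h x" by simp
qed

end

section \<open>Differentiation on the manifolds\<close>

lemma scaleR_fun_apply [simp]: "(c *\<^sub>R f) x = c *\<^sub>R f x"
  by (simp add: scaleR_fun_def)

context stat_manifold
begin

abbreviation "G0 \<equiv> GG0 k \<mu>"

subsection \<open>Coordinates of tangent vectors\<close>

text \<open>
  The mean under \<open>Pt a\<close>.
\<close>

definition mean :: "('a \<Rightarrow> real) \<Rightarrow> ('a \<Rightarrow> real) \<Rightarrow> real"
  where "mean a h = integral\<^sup>L \<mu> (exp_on (space \<mu>) (\<theta> a) * h)"

text \<open>
  The density with respect to \<open>Pt a\<close> of the tangent vector with coordinate \<open>h\<close>.
\<close>

definition score :: "('a \<Rightarrow> real) \<Rightarrow> ('a \<Rightarrow> real) \<Rightarrow> 'a \<Rightarrow> real"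
  where "score a h = h - mean a h *\<^sub>R one"

definition tangent :: "('a \<Rightarrow> real) \<Rightarrow> ('a \<Rightarrow> real) \<Rightarrow> 'a set \<Rightarrow> real"
  where "tangent a h = signed_density (Pt a) (score a h)"

definition metric :: "('a \<Rightarrow> real) \<Rightarrow> ('a \<Rightarrow> real) \<Rightarrow> ('a \<Rightarrow> real) \<Rightarrow> real"
  where "metric a u v = mean a (score a u * score a v)"

lemma mean_add: "a \<in> vecs G \<Longrightarrow> h \<in> vecs G \<Longrightarrow> h' \<in> vecs G \<Longrightarrow> mean a (h + h') = mean a h + mean a h'"
  by (simp add: mean_def distrib_left)

lemma mult_scaleR_fun: "(f :: 'a \<Rightarrow> real) * c *\<^sub>R g = c *\<^sub>R (f * g)" "c *\<^sub>R g * f = c *\<^sub>R (g * f)"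
  by (auto simp: fun_eq_iff)

lemma mean_scale: "mean a (c *\<^sub>R h) = c * mean a h"
  by (simp add: mean_def mult_scaleR_fun)

lemma mean_diff: "a \<in> vecs G \<Longrightarrow> h \<in> vecs G \<Longrightarrow> h' \<in> vecs G \<Longrightarrow> mean a (h - h') = mean a h - mean a h'"
  by (simp add: mean_def right_diff_distrib)

lemma mean_one [simp]: "a \<in> vecs G \<Longrightarrow> mean a one = 1"
  using Z_\<theta>[of a] by (simp add: mean_def mult_one Z_def)

lemma score_mem [simp]: "h \<in> vecs G \<Longrightarrow> score a h \<in> vecs G"
  by (auto simp: score_def)

lemma score_add: "a \<in> vecs G \<Longrightarrow> h \<in> vecs G \<Longrightarrow> h' \<in> vecs G \<Longrightarrow> score a (h + h') = score a h + score a h'"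
  by (simp add: score_def mean_add algebra_simps)

lemma score_diff: "a \<in> vecs G \<Longrightarrow> h \<in> vecs G \<Longrightarrow> h' \<in> vecs G \<Longrightarrow> score a (h - h') = score a h - score a h'"
  by (simp add: score_def mean_diff algebra_simps)

lemma score_scale: "score a (c *\<^sub>R h) = c *\<^sub>R score a h"
  by (simp add: score_def mean_scale algebra_simps)

lemma score_one [simp]: "a \<in> vecs G \<Longrightarrow> score a one = 0"
  by (simp add: score_def)

lemma mean_score [simp]: "a \<in> vecs G \<Longrightarrow> h \<in> vecs G \<Longrightarrow> mean a (score a h) = 0"
  by (simp add: score_def mean_diff mean_scale)

lemma score_centre [simp]: "a \<in> vecs G \<Longrightarrow> h \<in> vecs G \<Longrightarrow> score a (centre h) = score a h"
  by (simp add: centre_def score_diff score_scale)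

lemma centre_add: "h \<in> vecs G \<Longrightarrow> h' \<in> vecs G \<Longrightarrow> centre (h + h') = centre h + centre h'"
  by (simp add: centre_def algebra_simps)

lemma centre_diff: "h \<in> vecs G \<Longrightarrow> h' \<in> vecs G \<Longrightarrow> centre (h - h') = centre h - centre h'"
  by (simp add: centre_def algebra_simps)

lemma centre_scale: "centre (c *\<^sub>R h) = c *\<^sub>R centre h"
  by (simp add: centre_def algebra_simps)

lemma centre_score: "h \<in> vecs G \<Longrightarrow> centre (score a h) = centre h"
  using centre_shift[of h "- mean a h"] by (simp add: score_def)

lemma metric_sym: "metric a u v = metric a v u"
  by (simp add: metric_def mult.commute)

lemma integral_Pt: "a \<in> vecs G \<Longrightarrow> h \<in> vecs G \<Longrightarrow> integral\<^sup>L (Pt a) h = mean a h"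
  unfolding Pt_def mean_def by (rule integral_exp_measure) (auto intro: measurable_mem)

lemma tangent_N_eq:
  assumes "a \<in> vecs G"
  shows "tangent_N k \<mu> (Pt a) = tangent a ` vecs G0"
proof
  have sp: "signed_density (Pt a) u (space \<mu>) = mean a u" if "u \<in> vecs G" for u
    using signed_density_space[of "\<theta> a" u] integral_Pt[OF assms that] assms that by (simp add: Pt_def)
  show "tangent a ` vecs G0 \<subseteq> tangent_N k \<mu> (Pt a)"
    using sp assms GG0_mem by (auto simp: tangent_N_def tangent_M_def tangent_def)
  show "tangent_N k \<mu> (Pt a) \<subseteq> tangent a ` vecs G0"
  proof
    fix U assume "U \<in> tangent_N k \<mu> (Pt a)"
    then obtain u where u: "u \<in> vecs G" "U = signed_density (Pt a) u" "mean a u = 0"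
      using sp by (auto simp: tangent_N_def tangent_M_def)
    have s: "score a u = u" using u(3) by (simp add: score_def)
    have "U = tangent a (centre u)" unfolding tangent_def score_centre[OF assms u(1)] s by (rule u(2))
    then show "U \<in> tangent a ` vecs G0" using u(1) by (intro image_eqI[of _ _ "centre u"]) auto
  qed
qed

lemma tangent_add:
  "a \<in> vecs G \<Longrightarrow> u \<in> vecs G \<Longrightarrow> v \<in> vecs G \<Longrightarrow> tangent a (u + v) = tangent a u + tangent a v"
  unfolding tangent_def Pt_def by (simp add: score_add signed_density_add)

lemma tangent_scale: "tangent a (c *\<^sub>R u) = c *\<^sub>R tangent a u"
  by (simp add: tangent_def score_scale signed_density_scale)

lemma tangent_diff:
  "a \<in> vecs G \<Longrightarrow> u \<in> vecs G \<Longrightarrow> v \<in> vecs G \<Longrightarrow> tangent a (u - v) = tangent a u - tangent a v"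
  using tangent_add[of a u "(-1) *\<^sub>R v"] tangent_scale[of a "-1" v] by simp

lemma tangent_density_tangent [simp]:
  "a \<in> vecs G \<Longrightarrow> u \<in> vecs G \<Longrightarrow> tangent_density k \<mu> (Pt a) (tangent a u) = score a u"
  unfolding tangent_def Pt_def by simp

lemma fisher_rao_tangent:
  assumes "a \<in> vecs G" "u \<in> vecs G" "v \<in> vecs G"
  shows "fisher_rao k \<mu> (Pt a) (tangent a u) (tangent a v) = metric a u v"
proof -
  have "(\<lambda>x. score a u x * score a v x) = score a u * score a v" by auto
  then show ?thesis
    using integral_Pt[OF assms(1), of "score a u * score a v"] assms by (simp add: fisher_rao_def metric_def)
qed

subsection \<open>Derivatives of functions of the coordinate\<close>

text \<open>
  Derivatives have to vanish off the carrier. This is built in here, so that the rules below compose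
  derivatives given by plain formulas.
\<close>

definition hasD :: "(('a \<Rightarrow> real) \<Rightarrow> 'a \<Rightarrow> real) \<Rightarrow> (('a \<Rightarrow> real) \<Rightarrow> 'a \<Rightarrow> real) \<Rightarrow> ('a \<Rightarrow> real) \<Rightarrow> bool"
  where "hasD f A a \<longleftrightarrow> has_fderiv G0 G (vecs G0) f (\<lambda>h. if h \<in> vecs G0 then A h else 0) a"

lemma hasD_has_fderiv: "has_fderiv G0 G (vecs G0) f A a \<Longrightarrow> hasD f A a"
proof -
  assume *: "has_fderiv G0 G (vecs G0) f A a"
  have "(\<lambda>h. if h \<in> vecs G0 then A h else 0) = A"
    using bounded_linD(4)[OF has_fderivD(1)[OF *]] by auto
  then show ?thesis using * by (simp add: hasD_def)
qed

lemma hasD_has_fderiv_GG0: "has_fderiv G0 G0 (vecs G0) f A a \<Longrightarrow> hasD f A a"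
proof -
  assume *: "has_fderiv G0 G0 (vecs G0) f A a"
  have "A \<in> bounded_lin G0 G"
    using has_fderivD(1)[OF *] unfolding bounded_lin_def by (auto dest: GG0_mem)
  then have "has_fderiv G0 G (vecs G0) f A a" using * unfolding has_fderiv_def by simp
  then show ?thesis by (rule hasD_has_fderiv)
qed

lemma hasD_cong:
  assumes "a \<in> vecs G0" "\<And>y. y \<in> vecs G0 \<Longrightarrow> f y = g y" "\<And>h. h \<in> vecs G0 \<Longrightarrow> A h = A' h"
  shows "hasD f A a \<longleftrightarrow> hasD g A' a"
proof -
  have "(\<lambda>h. if h \<in> vecs G0 then A h else 0) = (\<lambda>h. if h \<in> vecs G0 then A' h else 0)"
    using assms(3) by auto
  then show ?thesis unfolding hasD_def using has_fderiv_cong[of "vecs G0" f g a, OF assms(2,1)] by simp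
qed

lemma hasD_mem: "hasD f A a \<Longrightarrow> h \<in> vecs G0 \<Longrightarrow> A h \<in> vecs G"
  using bounded_linD(1)[OF has_fderivD(1), of G0 G "vecs G0" f "\<lambda>h. if h \<in> vecs G0 then A h else 0" a h]
  by (simp add: hasD_def)

lemma hasD_unique:
  assumes "a \<in> vecs G0" "\<And>y. y \<in> vecs G0 \<Longrightarrow> f y \<in> vecs G" "hasD f A a" "hasD f A' a" "h \<in> vecs G0"
  shows "A h = A' h"
  using fun_cong[OF has_fderiv_unique[OF normed_GG0 normed_G inner_point_vecs[OF normed_GG0 assms(1)] assms(2)
      assms(3,4)[unfolded hasD_def]], of h] assms(5) by simp

lemma hasD_const: "a \<in> vecs G0 \<Longrightarrow> hasD (\<lambda>_. c) (\<lambda>_. 0) a"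
  by (intro hasD_has_fderiv has_fderiv_const normed_GG0 normed_G) auto

lemma hasD_id: "a \<in> vecs G0 \<Longrightarrow> hasD (\<lambda>y. y) (\<lambda>h. h) a"
proof -
  assume a: "a \<in> vecs G0"
  let ?I = "\<lambda>h. if h \<in> vecs G0 then h else 0"
  have "?I \<in> bounded_lin G0 G"
    by (rule bounded_linI[where C = 1]) (auto dest: GG0_mem)
  then have "has_fderiv G0 G (vecs G0) ?I ?I a"
    using a by (intro has_fderiv_bounded_lin normed_GG0 normed_G) auto
  then have "hasD ?I ?I a" by (rule hasD_has_fderiv)
  then show ?thesis using hasD_cong[OF a, of ?I "\<lambda>y. y" ?I "\<lambda>h. h"] by simp
qed

lemma hasD_add:
  assumes "a \<in> vecs G0" "\<And>y. y \<in> vecs G0 \<Longrightarrow> f y \<in> vecs G" "\<And>y. y \<in> vecs G0 \<Longrightarrow> g y \<in> vecs G"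
    and "hasD f A a" "hasD g B a"
  shows "hasD (\<lambda>y. f y + g y) (\<lambda>h. A h + B h) a"
proof -
  have "has_fderiv G0 G (vecs G0) (\<lambda>y. f y + g y)
    (\<lambda>h. (if h \<in> vecs G0 then A h else 0) + (if h \<in> vecs G0 then B h else 0)) a"
    using assms unfolding hasD_def by (intro has_fderiv_add normed_GG0 normed_G) auto
  from hasD_has_fderiv[OF this] show ?thesis
    by (rule hasD_cong[OF assms(1), THEN iffD1, rotated 2]) auto
qed

lemma hasD_chain:
  assumes "a \<in> vecs G0" "\<And>y. y \<in> vecs G0 \<Longrightarrow> f y \<in> vecs G" "\<And>y. y \<in> vecs G \<Longrightarrow> g y \<in> vecs G"
    and f: "hasD f A a" and g: "has_fderiv G G (vecs G) g (\<lambda>h. if h \<in> vecs G then B h else 0) (f a)"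
  shows "hasD (\<lambda>y. g (f y)) (\<lambda>h. B (A h)) a"
proof -
  let ?A = "\<lambda>h. if h \<in> vecs G0 then A h else 0" and ?B = "\<lambda>h. if h \<in> vecs G then B h else 0"
  have "has_fderiv G0 G (vecs G0) (\<lambda>y. g (f y)) (\<lambda>h. ?B (?A h)) a"
    using assms(2,3) by (intro has_fderiv_chain[where f = f and g = g and A = ?A and B = ?B,
        OF normed_GG0 normed_G normed_G subset_refl assms(1) subset_refl _ _ f[unfolded hasD_def] g])
  from hasD_has_fderiv[OF this] show ?thesis
    by (rule hasD_cong[OF assms(1), THEN iffD1, rotated 2]) (use hasD_mem[OF f] in auto)
qed

lemma hasD_bounded_lin:
  assumes "a \<in> vecs G0" "\<And>y. y \<in> vecs G0 \<Longrightarrow> f y \<in> vecs G" "hasD f A a"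
    and "(\<lambda>h. if h \<in> vecs G then T h else 0) \<in> bounded_lin G G"
  shows "hasD (\<lambda>y. T (f y)) (\<lambda>h. T (A h)) a"
proof -
  let ?T = "\<lambda>h. if h \<in> vecs G then T h else 0"
  have "has_fderiv G G (vecs G) ?T ?T (f a)"
    using assms by (intro has_fderiv_bounded_lin normed_G) auto
  moreover have "has_fderiv G G (vecs G) ?T ?T (f a) = has_fderiv G G (vecs G) T ?T (f a)"
    using assms(1,2) by (intro has_fderiv_cong) auto
  moreover have "T y \<in> vecs G" if "y \<in> vecs G" for y using bounded_linD(1)[OF assms(4) that] that by simp
  ultimately show ?thesis
    using assms(1-3) by (intro hasD_chain[where g = T and B = T and f = f and A = A]) auto
qed

lemma hasD_scale:
  assumes "a \<in> vecs G0" "\<And>y. y \<in> vecs G0 \<Longrightarrow> f y \<in> vecs G" "hasD f A a"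
  shows "hasD (\<lambda>y. c *\<^sub>R f y) (\<lambda>h. c *\<^sub>R A h) a"
proof (rule hasD_bounded_lin[OF assms, where T = "\<lambda>h. c *\<^sub>R h"])
  show "(\<lambda>h. if h \<in> vecs G then c *\<^sub>R h else 0) \<in> bounded_lin G G"
    by (rule bounded_linI[where C = "\<bar>c\<bar>"]) (auto simp: scaleR_add_right G.nrm_scale mult.commute)
qed

lemma hasD_diff:
  assumes "a \<in> vecs G0" "\<And>y. y \<in> vecs G0 \<Longrightarrow> f y \<in> vecs G" "\<And>y. y \<in> vecs G0 \<Longrightarrow> g y \<in> vecs G"
    and "hasD f A a" "hasD g B a"
  shows "hasD (\<lambda>y. f y - g y) (\<lambda>h. A h - B h) a"
  using hasD_add[OF assms(1,2) _ assms(4) hasD_scale[OF assms(1,3,5), of "-1"]] assms(3) by simp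

lemma hasD_integral:
  assumes "a \<in> vecs G0" "\<And>y. y \<in> vecs G0 \<Longrightarrow> f y \<in> vecs G" "hasD f A a"
  shows "hasD (\<lambda>y. integral\<^sup>L \<mu> (f y) *\<^sub>R one) (\<lambda>h. integral\<^sup>L \<mu> (A h) *\<^sub>R one) a"
proof (rule hasD_bounded_lin[OF assms, where T = "\<lambda>h. integral\<^sup>L \<mu> h *\<^sub>R one"])
  show "(\<lambda>h. if h \<in> vecs G then integral\<^sup>L \<mu> h *\<^sub>R one else 0) \<in> bounded_lin G G"
  proof (rule bounded_linI[where C = "nrm G one"])
    show "nrm G (if h \<in> vecs G then integral\<^sup>L \<mu> h *\<^sub>R one else 0) \<le> nrm G one * nrm G h" if "h \<in> vecs G" for h
      using mult_right_mono[OF integral_le_nrm[OF that], of "nrm G one"] that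
      by (simp add: G.nrm_scale mult.commute)
  qed (auto simp: scaleR_add_left)
qed

lemma hasD_centre:
  assumes "a \<in> vecs G0" "\<And>y. y \<in> vecs G0 \<Longrightarrow> f y \<in> vecs G" "hasD f A a"
  shows "hasD (\<lambda>y. centre (f y)) (\<lambda>h. centre (A h)) a"
  unfolding centre_def using assms by (intro hasD_diff hasD_integral) auto

lemma hasD_mult:
  assumes "a \<in> vecs G0" "\<And>y. y \<in> vecs G0 \<Longrightarrow> f y \<in> vecs G" "\<And>y. y \<in> vecs G0 \<Longrightarrow> g y \<in> vecs G"
    and "hasD f A a" "hasD g B a"
  shows "hasD (\<lambda>y. f y * g y) (\<lambda>h. A h * g a + f a * B h) a"
proof -
  have "has_fderiv G0 G (vecs G0) (\<lambda>y. f y * g y)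
    (\<lambda>h. (if h \<in> vecs G0 then A h else 0) * g a + f a * (if h \<in> vecs G0 then B h else 0)) a"
    using assms nrm_mult_le unfolding hasD_def
    by (intro has_fderiv_bilinear[where p = "(*)" and F = G and G = G and K = "real (Suc k) * 2 ^ k"] normed_GG0 normed_G)
      (auto simp: distrib_left distrib_right mult_scaleR_fun)
  from hasD_has_fderiv[OF this] show ?thesis
    by (rule hasD_cong[OF assms(1), THEN iffD1, rotated 2]) auto
qed

lemma hasD_exp:
  assumes "a \<in> vecs G0" "\<And>y. y \<in> vecs G0 \<Longrightarrow> f y \<in> vecs G" "hasD f A a"
  shows "hasD (\<lambda>y. exp_on (space \<mu>) (f y)) (\<lambda>h. exp_on (space \<mu>) (f a) * A h) a"
  using assms has_fderiv_exp_on[of "f a"]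
  by (intro hasD_chain[where g = "exp_on (space \<mu>)" and f = f and A = A]) auto

text \<open>
  The integral is a bounded functional that is constant along \<open>f\<close>.
\<close>

lemma hasD_GG0:
  assumes "a \<in> vecs G0" "\<And>y. y \<in> vecs G0 \<Longrightarrow> f y \<in> vecs G0" "hasD f A a" "h \<in> vecs G0"
  shows "A h \<in> vecs G0"
proof -
  have "hasD (\<lambda>y. integral\<^sup>L \<mu> (f y) *\<^sub>R one) (\<lambda>h. integral\<^sup>L \<mu> (A h) *\<^sub>R one) a"
    using assms GG0_mem by (intro hasD_integral) auto
  moreover have "hasD (\<lambda>y. integral\<^sup>L \<mu> (f y) *\<^sub>R one) (\<lambda>h. 0) a"
    using hasD_const[OF assms(1), of 0] assms(1,2)
    by (subst hasD_cong[where g = "\<lambda>_. 0" and A' = "\<lambda>_. 0"]) (auto simp: vecs_GG0)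
  ultimately have "integral\<^sup>L \<mu> (A h) *\<^sub>R one = 0"
    by (rule hasD_unique[rotated 2]) (use assms in auto)
  then have "integral\<^sup>L \<mu> (integral\<^sup>L \<mu> (A h) *\<^sub>R one) = integral\<^sup>L \<mu> (0 :: 'a \<Rightarrow> real)" by (rule arg_cong)
  then have "integral\<^sup>L \<mu> (A h) = 0" unfolding integral_scaleR_fun integral_one integral_zero_fun by simp
  then show ?thesis using hasD_mem[OF assms(3,4)] by (simp add: vecs_GG0)
qed

text \<open>The logarithmic derivative of the normalising constant is the mean.\<close>

lemma hasD_\<theta>:
  assumes a: "a \<in> vecs G0"
  shows "hasD \<theta> (score a) a"
proof -
  have aG: "a \<in> vecs G" using a by (rule GG0_mem)
  let ?R = "type_space :: real nspace"
  note R = normed_carrier_type_space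
  let ?res = "\<lambda>A h. if h \<in> vecs G0 then A h else 0"
  let ?e = "exp_on (space \<mu>)"
  let ?I = "\<lambda>h. if h \<in> vecs G then integral\<^sup>L \<mu> h else 0"
  have e: "has_fderiv G0 G (vecs G0) ?e (?res (\<lambda>h. ?e a * h)) a"
    using hasD_exp[OF a GG0_mem hasD_id[OF a]] by (simp add: hasD_def)
  have I: "?I \<in> bounded_lin G ?R"
    by (rule bounded_linI[where C = 1]) (use integral_le_nrm in auto)
  have "has_fderiv G0 ?R (vecs G0) (\<lambda>y. ?I (?e y)) (\<lambda>h. ?I (?res (\<lambda>h. ?e a * h) h)) a"
    using a by (intro has_fderiv_chain[OF normed_GG0 normed_G R subset_refl a subset_refl _ _ e]
        has_fderiv_bounded_lin normed_G R I) (auto dest: GG0_mem)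
  moreover have "?I (?e y) = Z y" if "y \<in> vecs G0" for y using GG0_mem[OF that] by (simp add: Z_def)
  ultimately have Z: "has_fderiv G0 ?R (vecs G0) Z (\<lambda>h. ?I (?res (\<lambda>h. ?e a * h) h)) a"
    using has_fderiv_cong[of "vecs G0" "\<lambda>y. ?I (?e y)" Z a] a by simp
  have "(ln has_derivative (\<lambda>h. h / Z a)) (at (Z a) within {0<..})"
  proof -
    have "(\<lambda>h. h / Z a) = (*) (1 / Z a)" by auto
    then show ?thesis
      using DERIV_ln_divide[OF Z_pos[OF aG]] by (simp add: has_field_derivative_def has_derivative_at_withinI)
  qed
  then have l: "has_fderiv ?R ?R {0<..} ln (\<lambda>h. h / Z a) (Z a)" by (simp add: has_fderiv_type_space)
  have lnZ: "has_fderiv G0 ?R (vecs G0) (\<lambda>y. ln (Z y)) (\<lambda>h. ?I (?res (\<lambda>h. ?e a * h) h) / Z a) a"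
    by (rule has_fderiv_chain[where f = Z and g = ln, OF normed_GG0 R R subset_refl a _ _ _ Z l])
      (auto intro: Z_pos dest: GG0_mem)
  have o: "(\<lambda>r. r *\<^sub>R one) \<in> bounded_lin ?R G"
    by (rule bounded_linI[where C = "nrm G one"]) (auto simp: scaleR_add_left G.nrm_scale mult.commute)
  have "has_fderiv G0 G (vecs G0) (\<lambda>y. ln (Z y) *\<^sub>R one) (\<lambda>h. (?I (?res (\<lambda>h. ?e a * h) h) / Z a) *\<^sub>R one) a"
    by (rule has_fderiv_chain[where g = "\<lambda>r. r *\<^sub>R one" and f = "\<lambda>y. ln (Z y)",
          OF normed_GG0 R normed_G subset_refl a subset_refl _ _ lnZ
        has_fderiv_bounded_lin[OF R normed_G subset_refl _ o]]) (simp, rule G.scale_mem, simp_all)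
  from hasD_has_fderiv[OF this] have "hasD (\<lambda>y. ln (Z y) *\<^sub>R one) (\<lambda>h. mean a h *\<^sub>R one) a"
    by (rule hasD_cong[OF a, THEN iffD1, rotated 2])
      (use aG in \<open>auto simp: mean_def exp_on_\<theta> mult_scaleR_fun dest: GG0_mem\<close>)
  then have "hasD (\<lambda>y. y - ln (Z y) *\<^sub>R one) (\<lambda>h. h - mean a h *\<^sub>R one) a"
    using a by (intro hasD_diff hasD_id) (auto dest: GG0_mem)
  then show ?thesis by (simp add: \<theta>_def[abs_def] score_def[abs_def])
qed

text \<open>
  The derivative of the mean under \<open>Pt a\<close> of a fixed function \<open>v\<close> is the covariance of \<open>v\<close> with the direction, because
  scores have mean zero.
\<close>

lemma hasD_score:
  assumes a: "a \<in> vecs G0" and v: "\<And>y. y \<in> vecs G0 \<Longrightarrow> v y \<in> vecs G" and V: "hasD v V a"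
  shows "hasD (\<lambda>y. score y (v y)) (\<lambda>h. score a (V h) - metric a h (v a) *\<^sub>R one) a"
proof -
  let ?e = "exp_on (space \<mu>)"
  have aG: "a \<in> vecs G" using a by (rule GG0_mem)
  have \<theta>: "\<theta> y \<in> vecs G" if "y \<in> vecs G0" for y using GG0_mem[OF that] by simp
  have "hasD (\<lambda>y. ?e (\<theta> y) * v y) (\<lambda>h. ?e (\<theta> a) * score a h * v a + ?e (\<theta> a) * V h) a"
    using a v V \<theta> by (intro hasD_mult hasD_exp hasD_\<theta>) auto
  then have "hasD (\<lambda>y. v y - integral\<^sup>L \<mu> (?e (\<theta> y) * v y) *\<^sub>R one)
    (\<lambda>h. V h - integral\<^sup>L \<mu> (?e (\<theta> a) * score a h * v a + ?e (\<theta> a) * V h) *\<^sub>R one) a"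
    using a v V \<theta> by (intro hasD_diff hasD_integral) auto
  then show ?thesis
  proof (rule hasD_cong[OF a, THEN iffD1, rotated 2])
    show "v y - integral\<^sup>L \<mu> (?e (\<theta> y) * v y) *\<^sub>R one = score y (v y)" for y
      by (simp add: score_def mean_def)
    fix h assume h: "h \<in> vecs G0"
    have hG: "h \<in> vecs G" using h by (rule GG0_mem)
    have va: "v a \<in> vecs G" using v a by simp
    have Vh: "V h \<in> vecs G" using hasD_mem[OF V h] .
    have "metric a h (v a) = mean a (score a h * v a - mean a (v a) *\<^sub>R score a h)"
      using mult_one[of "score a h"] hG
      by (simp add: metric_def score_def[of a "v a"] right_diff_distrib mult_scaleR_fun)
    also have "\<dots> = mean a (score a h * v a)"
      using aG hG va by (simp add: mean_diff mean_scale)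
    finally have "integral\<^sup>L \<mu> (?e (\<theta> a) * score a h * v a + ?e (\<theta> a) * V h) = metric a h (v a) + mean a (V h)"
      using aG hG va Vh by (simp add: mean_def mult.assoc)
    then show "V h - integral\<^sup>L \<mu> (?e (\<theta> a) * score a h * v a + ?e (\<theta> a) * V h) *\<^sub>R one
      = score a (V h) - metric a h (v a) *\<^sub>R one"
      by (simp add: score_def algebra_simps)
  qed
qed

subsection \<open>The derivations of the manifolds in coordinates\<close>

text \<open>
  Normalising shifts \<open>\<phi>\<^sub>1\<close> by a constant, which centring removes; hence \<open>\<phi>\<^sub>e \<circ> \<nu>\<close> is linear in the chart \<open>\<phi>\<^sub>1\<close>.
\<close>

lemma coord_e_exp_measure:
  assumes b: "b \<in> vecs G" and u: "u \<in> vecs G"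
  shows "coord_e k \<mu> (exp_measure \<mu> b) (signed_density (exp_measure \<mu> b) u) = centre u"
proof -
  let ?C = "\<lambda>h. if h \<in> vecs G then centre h else 0"
  let ?f = "(chart_e k \<mu> \<circ> normalise \<mu>) \<circ> inv_into (manifold_M k \<mu>) (chart_1 k \<mu>)"
  have C: "?C \<in> bounded_lin G G0"
  proof (rule bounded_linI[where C = "1 + nrm G one"])
    fix h assume h: "h \<in> vecs G"
    have "nrm G (centre h) \<le> nrm G h + \<bar>integral\<^sup>L \<mu> h\<bar> * nrm G one"
      unfolding centre_def using G.nrm_triangle_diff[of h "integral\<^sup>L \<mu> h *\<^sub>R one"] h by (simp add: G.nrm_scale)
    also have "\<dots> \<le> nrm G h + nrm G h * nrm G one"
      using integral_le_nrm[OF h] by (intro add_left_mono mult_right_mono) auto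
    finally show "nrm G0 (?C h) \<le> (1 + nrm G one) * nrm G h" using h by (simp add: algebra_simps)
  qed (auto simp: centre_add centre_scale)
  have f: "?f y = ?C y" if "y \<in> vecs G" for y
    using that by (simp add: normalise_exp_measure chart_e_exp_measure)
  have "has_fderiv G G0 (vecs G) ?C ?C b"
    by (rule has_fderiv_bounded_lin[OF normed_G normed_GG0 subset_refl b C])
  then have "has_fderiv G G0 (vecs G) ?f ?C b"
    using has_fderiv_cong[of "vecs G" ?f ?C b, OF f b] by simp
  then have "fderiv G G0 (vecs G) ?f b = ?C"
    using f by (intro fderiv_eq normed_G normed_GG0 inner_point_vecs b) auto
  then show ?thesis using assms by (simp add: coord_e_def deriv_M_def)
qed

lemma coord_e_Pt: "a \<in> vecs G \<Longrightarrow> u \<in> vecs G \<Longrightarrow> coord_e k \<mu> (Pt a) (signed_density (Pt a) u) = centre u"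
  unfolding Pt_def by (simp add: coord_e_exp_measure)

lemma coord_e_tangent [simp]:
  "a \<in> vecs G \<Longrightarrow> u \<in> vecs G0 \<Longrightarrow> coord_e k \<mu> (Pt a) (tangent a u) = u"
  using GG0_mem[of u] by (simp add: tangent_def coord_e_Pt centre_score)

lemma T_normalise_Pt:
  assumes "a \<in> vecs G" "w \<in> vecs G"
  shows "T_normalise k \<mu> (Pt a) (signed_density (Pt a) w) = tangent a (centre w)"
  unfolding T_normalise_def normalise_Pt[OF assms(1)] coord_e_Pt[OF assms] tangent_N_eq[OF assms(1)]
  using assms by (intro the_equality) auto

lemma deriv_N_eq:
  assumes a: "a \<in> vecs G0" and f: "\<And>y. y \<in> vecs G0 \<Longrightarrow> f (Pt y) = \<phi> y" "\<And>y. y \<in> vecs G0 \<Longrightarrow> \<phi> y \<in> vecs G"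
    and D: "hasD \<phi> A a" and h: "h \<in> vecs G0"
  shows "deriv_N k \<mu> G f (Pt a) (tangent a h) = A h"
proof -
  let ?f = "f \<circ> inv_into (manifold_N k \<mu>) (chart_e k \<mu>)"
  have e: "?f y = \<phi> y" if "y \<in> vecs G0" for y using that f(1) by simp
  have "has_fderiv G0 G (vecs G0) ?f (\<lambda>h. if h \<in> vecs G0 then A h else 0) a"
    using has_fderiv_cong[of "vecs G0" ?f \<phi> a, OF e a] D by (simp add: hasD_def)
  then have "fderiv G0 G (vecs G0) ?f a = (\<lambda>h. if h \<in> vecs G0 then A h else 0)"
    using e f(2) by (intro fderiv_eq normed_G normed_GG0 inner_point_vecs a) auto
  then show ?thesis using a h GG0_mem[OF a] by (simp add: deriv_N_def)
qed

lemma has_fderiv_chart: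
  assumes b: "b \<in> vecs G"
  shows "has_fderiv G G (vecs G) (\<lambda>y. chart k \<mu> \<alpha> (exp_measure \<mu> y))
    (\<lambda>u. if u \<in> vecs G then exp_on (space \<mu>) (((1 - \<alpha>) / 2) *\<^sub>R b) * u else 0) b"
proof (cases "\<alpha> = 1")
  case True
  let ?I = "\<lambda>h. if h \<in> vecs G then h else 0"
  have "?I \<in> bounded_lin G G" by (rule bounded_linI[where C = 1]) auto
  then have "has_fderiv G G (vecs G) ?I ?I b" by (intro has_fderiv_bounded_lin normed_G b) auto
  moreover have "chart k \<mu> \<alpha> (exp_measure \<mu> y) = ?I y" if "y \<in> vecs G" for y using that True by (simp add: chart_def)
  moreover have "exp_on (space \<mu>) (((1 - \<alpha>) / 2) *\<^sub>R b) * u = u" if "u \<in> vecs G" for u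
    using True memD(1)[OF that] by (auto simp: fun_eq_iff exp_on_def)
  then have "(\<lambda>u. if u \<in> vecs G then exp_on (space \<mu>) (((1 - \<alpha>) / 2) *\<^sub>R b) * u else 0) = ?I" by auto
  ultimately show ?thesis
    using has_fderiv_cong[of "vecs G" "\<lambda>y. chart k \<mu> \<alpha> (exp_measure \<mu> y)" ?I b G G ?I] b by simp
next
  case False
  define c where "c = (1 - \<alpha>) / 2"
  have c: "c \<noteq> 0" "2 / (1 - \<alpha>) = 1 / c" using False by (auto simp: c_def)
  have S: "(\<lambda>h. if h \<in> vecs G then c *\<^sub>R h else 0) \<in> bounded_lin G G" for c
    by (rule bounded_linI[where C = "\<bar>c\<bar>"]) (auto simp: scaleR_add_right G.nrm_scale mult.commute)
  have S': "has_fderiv G G (vecs G) (\<lambda>h. if h \<in> vecs G then c *\<^sub>R h else 0) (\<lambda>h. if h \<in> vecs G then c *\<^sub>R h else 0) y"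
    if "y \<in> vecs G" for y c
    by (intro has_fderiv_bounded_lin normed_G S that subset_refl)
  let ?s = "\<lambda>c h. if h \<in> vecs G then c *\<^sub>R h else (0 :: 'a \<Rightarrow> real)"
  let ?e = "exp_on (space \<mu>)"
  let ?E = "\<lambda>h. if h \<in> vecs G then ?e (c *\<^sub>R b) * h else 0"
  have 1: "has_fderiv G G (vecs G) (\<lambda>y. ?e (?s c y)) (\<lambda>h. ?E (?s c h)) b"
    using b has_fderiv_exp_on[of "c *\<^sub>R b"]
    by (intro has_fderiv_chain[OF normed_G normed_G normed_G subset_refl b subset_refl _ _ S'[OF b]]) auto
  have 2: "has_fderiv G G (vecs G) (\<lambda>y. ?e (?s c y) + - one) (\<lambda>h. ?E (?s c h) + 0) b"
    using b by (intro has_fderiv_add[OF normed_G normed_G subset_refl b _ _ 1] has_fderiv_const normed_G) auto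
  have 3: "has_fderiv G G (vecs G) (\<lambda>y. ?s (1 / c) (?e (?s c y) + - one)) (\<lambda>h. ?s (1 / c) (?E (?s c h) + 0)) b"
  proof (rule has_fderiv_chain[where g = "?s (1 / c)" and B = "?s (1 / c)",
        OF normed_G normed_G normed_G subset_refl b subset_refl _ _ 2 S'])
    show "?e (?s c y) + - one \<in> vecs G" if "y \<in> vecs G" for y
      using that by (simp only: if_True) (intro G.add_mem G.uminus_mem exp_mem G.scale_mem one_mem)
    then show "?e (?s c b) + - one \<in> vecs G" using b by blast
    show "?s (1 / c) y \<in> vecs G" if "y \<in> vecs G" for y
      using that by (simp only: if_True) (intro G.scale_mem)
  qed
  have "?s (1 / c) (?E (?s c h) + 0) = ?E h" for h
  proof (cases "h \<in> vecs G")
    case True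
    then have "?e (c *\<^sub>R b) * c *\<^sub>R h \<in> vecs G" using b by (intro mult_mem' exp_mem G.scale_mem)
    then show ?thesis using True c(1) by (simp add: mult_scaleR_fun)
  qed simp
  then have "(\<lambda>h. ?s (1 / c) (?E (?s c h) + 0)) = ?E" by (rule ext)
  moreover have "chart k \<mu> \<alpha> (exp_measure \<mu> y) = ?s (1 / c) (?e (?s c y) + - one)" if "y \<in> vecs G" for y
    using that False c(2) by (simp add: chart_def flip: c_def)
  ultimately show ?thesis unfolding c_def[symmetric]
    using 3 has_fderiv_cong[of "vecs G" "\<lambda>y. chart k \<mu> \<alpha> (exp_measure \<mu> y)" "\<lambda>y. ?s (1 / c) (?e (?s c y) + - one)" b G G ?E] b
    by simp
qed

lemma chart_mem: "b \<in> vecs G \<Longrightarrow> chart k \<mu> \<alpha> (exp_measure \<mu> b) \<in> vecs G"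
  by (auto simp: chart_def)

lemma deriv_M_chart:
  assumes "b \<in> vecs G" "u \<in> vecs G"
  shows "deriv_M k \<mu> G (chart k \<mu> \<alpha>) (exp_measure \<mu> b) (signed_density (exp_measure \<mu> b) u)
    = exp_on (space \<mu>) (((1 - \<alpha>) / 2) *\<^sub>R b) * u"
proof -
  let ?f = "chart k \<mu> \<alpha> \<circ> inv_into (manifold_M k \<mu>) (chart_1 k \<mu>)"
  let ?E = "\<lambda>h. if h \<in> vecs G then exp_on (space \<mu>) (((1 - \<alpha>) / 2) *\<^sub>R b) * h else 0"
  have e: "?f y = chart k \<mu> \<alpha> (exp_measure \<mu> y)" if "y \<in> vecs G" for y using that by simp
  have "has_fderiv G G (vecs G) ?f ?E b"
    using has_fderiv_cong[of "vecs G" ?f "\<lambda>y. chart k \<mu> \<alpha> (exp_measure \<mu> y)" b, OF e assms(1)]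
      has_fderiv_chart[OF assms(1)] by simp
  then have "fderiv G G (vecs G) ?f b = ?E"
    using chart_mem by (intro fderiv_eq normed_G inner_point_vecs assms) auto
  then show ?thesis using assms by (simp add: deriv_M_def)
qed

lemma hasD_chart:
  assumes a: "a \<in> vecs G0"
  shows "hasD (\<lambda>y. chart k \<mu> \<alpha> (Pt y)) (\<lambda>h. exp_on (space \<mu>) (((1 - \<alpha>) / 2) *\<^sub>R \<theta> a) * score a h) a"
  unfolding Pt_def using GG0_mem[OF a] chart_mem GG0_mem
  by (intro hasD_chain[OF a _ _ hasD_\<theta>[OF a] has_fderiv_chart]) auto

lemma deriv_N_chart:
  assumes "a \<in> vecs G0" "h \<in> vecs G0"
  shows "deriv_N k \<mu> G (chart k \<mu> \<alpha>) (Pt a) (tangent a h) = exp_on (space \<mu>) (((1 - \<alpha>) / 2) *\<^sub>R \<theta> a) * score a h"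
  by (rule deriv_N_eq[OF assms(1) refl _ hasD_chart[OF assms(1)] assms(2)])
    (auto simp: Pt_def intro!: chart_mem dest: GG0_mem)

text \<open>
  In the derivative of \<open>exp (c \<theta>) * score (v)\<close> the exponential factors out, and it is cancelled by the derivative of
  \<open>\<phi>\<^sub>\<alpha>\<close>. The metric enters through the derivative of the score, as a constant function, which \<open>T\<nu>\<close> removes.
\<close>

lemma nabla_tangent:
  assumes a: "a \<in> vecs G0" and u: "u \<in> vecs G0" "U (Pt a) = tangent a u"
    and V: "\<And>y. y \<in> vecs G0 \<Longrightarrow> V (Pt y) = tangent y (v y)"
    and v: "\<And>y. y \<in> vecs G0 \<Longrightarrow> v y \<in> vecs G0" and D: "hasD v A a"
  shows "nabla k \<mu> \<alpha> U V (Pt a) = tangent a (A u + ((1 - \<alpha>) / 2) *\<^sub>R centre (score a u * score a (v a)))"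
proof -
  define c where "c = (1 - \<alpha>) / 2"
  let ?q = "\<lambda>y. exp_on (space \<mu>) (c *\<^sub>R \<theta> y)"
  have aG: "a \<in> vecs G" and uG: "u \<in> vecs G" and va: "v a \<in> vecs G" using a u v GG0_mem by auto
  have Au: "A u \<in> vecs G0" by (rule hasD_GG0[OF a v D u(1)])
  note AuG = GG0_mem[OF Au]
  have \<theta>: "\<theta> y \<in> vecs G" if "y \<in> vecs G0" for y using GG0_mem[OF that] by simp
  have vG: "v y \<in> vecs G" if "y \<in> vecs G0" for y using GG0_mem v that by blast
  have Dq: "hasD (\<lambda>y. ?q y * score y (v y))
    (\<lambda>h. (?q a * c *\<^sub>R score a h) * score a (v a) + ?q a * (score a (A h) - metric a h (v a) *\<^sub>R one)) a"
    using a D \<theta> vG by (intro hasD_mult hasD_exp hasD_scale hasD_\<theta> hasD_score) auto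
  have pt: "deriv_N k \<mu> G (chart k \<mu> \<alpha>) (Pt y) (V (Pt y)) = ?q y * score y (v y)" if y: "y \<in> vecs G0" for y
    using V[OF y] deriv_N_chart[OF y v[OF y]] by (simp add: c_def)
  have mem: "?q y * score y (v y) \<in> vecs G" if "y \<in> vecs G0" for y using \<theta>[OF that] vG[OF that] by simp
  have dd: "deriv_N k \<mu> G (\<lambda>Q. deriv_N k \<mu> G (chart k \<mu> \<alpha>) Q (V Q)) (Pt a) (U (Pt a)) =
    (?q a * c *\<^sub>R score a u) * score a (v a) + ?q a * (score a (A u) - metric a u (v a) *\<^sub>R one)"
    unfolding u(2) by (rule deriv_N_eq[OF a pt mem Dq u(1)])
  define w where "w = c *\<^sub>R (score a u * score a (v a)) + (score a (A u) - metric a u (v a) *\<^sub>R one)"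
  have wG: "w \<in> vecs G" using uG va AuG unfolding w_def by auto
  have dd': "deriv_N k \<mu> G (\<lambda>Q. deriv_N k \<mu> G (chart k \<mu> \<alpha>) Q (V Q)) (Pt a) (U (Pt a)) = ?q a * w"
    unfolding dd w_def by (simp add: distrib_left mult_scaleR_fun mult.assoc)
  have cancel: "x = y" if "x \<in> vecs G" "y \<in> vecs G" "?q a * x = ?q a * y" for x y
  proof
    fix z show "x z = y z"
      using fun_cong[OF that(3), of z] memD(1)[OF that(1), of z] memD(1)[OF that(2), of z] exp_on_pos[of z "c *\<^sub>R \<theta> a"]
      by (cases "z \<in> space \<mu>") auto
  qed
  have "(THE W. W \<in> tangent_M k \<mu> (Pt a) \<and> deriv_M k \<mu> G (chart k \<mu> \<alpha>) (Pt a) W = ?q a * w) = signed_density (Pt a) w"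
  proof (rule the_equality)
    show "signed_density (Pt a) w \<in> tangent_M k \<mu> (Pt a) \<and>
        deriv_M k \<mu> G (chart k \<mu> \<alpha>) (Pt a) (signed_density (Pt a) w) = ?q a * w"
      using wG aG by (auto simp: tangent_M_def Pt_def deriv_M_chart c_def)
    fix W assume W: "W \<in> tangent_M k \<mu> (Pt a) \<and> deriv_M k \<mu> G (chart k \<mu> \<alpha>) (Pt a) W = ?q a * w"
    then obtain x where x: "x \<in> vecs G" "W = signed_density (Pt a) x" by (auto simp: tangent_M_def)
    then have "?q a * x = ?q a * w" using W aG by (simp add: Pt_def deriv_M_chart c_def)
    then show "W = signed_density (Pt a) w" using cancel[OF x(1) wG] x(2) by simp
  qed
  then have nab: "nabla k \<mu> \<alpha> U V (Pt a) = tangent a (centre w)"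
    unfolding nabla_def GG_eq dd' using T_normalise_Pt[OF aG wG] by simp
  have "centre w = A u + c *\<^sub>R centre (score a u * score a (v a))"
  proof -
    have "centre (metric a u (v a) *\<^sub>R one) = 0" by (simp add: centre_def)
    then show ?thesis using uG va AuG Au
      by (simp add: w_def centre_add centre_diff centre_scale centre_score)
  qed
  with nab show ?thesis unfolding c_def by (rule trans[OF _ arg_cong])
qed

end

section \<open>Curvature\<close>

context stat_manifold
begin

definition coordinate :: "('a measure \<Rightarrow> 'a set \<Rightarrow> real) \<Rightarrow> ('a \<Rightarrow> real) \<Rightarrow> 'a \<Rightarrow> real"
  where "coordinate V y = coord_e k \<mu> (Pt y) (V (Pt y))"

abbreviation D1 :: "('a measure \<Rightarrow> 'a set \<Rightarrow> real) \<Rightarrow> ('a \<Rightarrow> real) \<Rightarrow> ('a \<Rightarrow> real) \<Rightarrow> 'a \<Rightarrow> real"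
  where "D1 V \<equiv> twice_differentiable.d1 G0 G0 (coordinate V)"

abbreviation D2 :: "('a measure \<Rightarrow> 'a set \<Rightarrow> real) \<Rightarrow> ('a \<Rightarrow> real) \<Rightarrow> ('a \<Rightarrow> real) \<Rightarrow> ('a \<Rightarrow> real) \<Rightarrow> 'a \<Rightarrow> real"
  where "D2 V \<equiv> twice_differentiable.d2 G0 G0 (coordinate V)"

lemma Pt_mem_N: "a \<in> vecs G0 \<Longrightarrow> Pt a \<in> manifold_N k \<mu>"
  by (simp add: manifold_N_eq)

lemma
  assumes V: "V \<in> vector_fields k \<mu>" and y: "y \<in> vecs G0"
  shows coordinate_mem: "coordinate V y \<in> vecs G0"
    and field_eq_tangent: "V (Pt y) = tangent y (coordinate V y)"
proof -
  have "V (Pt y) \<in> tangent_N k \<mu> (Pt y)" using V Pt_mem_N[OF y] by (simp add: vector_fields_def)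
  then obtain h where h: "h \<in> vecs G0" "V (Pt y) = tangent y h"
    using tangent_N_eq[OF GG0_mem[OF y]] by auto
  then have "coordinate V y = h" using GG0_mem[OF y] by (simp add: coordinate_def)
  then show "coordinate V y \<in> vecs G0" "V (Pt y) = tangent y (coordinate V y)" using h by auto
qed

lemma smooth_N_iff: "smooth_N k \<mu> F f \<longleftrightarrow> smooth_nspace G0 F (vecs G0) (\<lambda>y. f (Pt y))"
  unfolding smooth_N_def by (rule smooth_nspace_cong) simp

lemma field_twice_differentiable:
  assumes "V \<in> vector_fields k \<mu>"
  shows "twice_differentiable_fun G0 G0 (coordinate V)"
proof -
  have "smooth_nspace G0 G0 (vecs G0) (coordinate V)"
    using assms by (simp add: vector_fields_def smooth_N_iff coordinate_def[abs_def])
  then show ?thesis using eval_le GG0_mem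
    by unfold_locales (auto simp: smooth_nspace_def)
qed

lemma hasD_coordinate:
  assumes "V \<in> vector_fields k \<mu>" "a \<in> vecs G0"
  shows "hasD (coordinate V) (D1 V a) a"
proof -
  interpret v: twice_differentiable_fun G0 G0 "coordinate V" by (rule field_twice_differentiable[OF assms(1)])
  show ?thesis using v.has_fderiv_d1[OF assms(2)] by (rule hasD_has_fderiv_GG0)
qed

lemma D1_mem: "V \<in> vector_fields k \<mu> \<Longrightarrow> a \<in> vecs G0 \<Longrightarrow> h \<in> vecs G0 \<Longrightarrow> D1 V a h \<in> vecs G0"
  using field_twice_differentiable[of V]
  unfolding twice_differentiable_fun_def by (blast intro: twice_differentiable.d1_mem)

lemma D2_mem:
  "V \<in> vector_fields k \<mu> \<Longrightarrow> a \<in> vecs G0 \<Longrightarrow> h \<in> vecs G0 \<Longrightarrow> h' \<in> vecs G0 \<Longrightarrow> D2 V a h h' \<in> vecs G0"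
  using field_twice_differentiable[of V]
  unfolding twice_differentiable_fun_def by (blast intro: twice_differentiable.d2_mem)

lemma D1_diff:
  assumes "V \<in> vector_fields k \<mu>" "a \<in> vecs G0" "h \<in> vecs G0" "h' \<in> vecs G0"
  shows "D1 V a (h - h') = D1 V a h - D1 V a h'"
proof -
  interpret v: twice_differentiable_fun G0 G0 "coordinate V" by (rule field_twice_differentiable[OF assms(1)])
  show ?thesis
    using bounded_lin_diff[OF normed_GG0 has_fderivD(1)[OF v.has_fderiv_d1[OF assms(2)]] assms(3,4)] .
qed

text \<open>
  Mixed second derivatives commute, so only first derivatives survive in the commutator. The chart
  \<open>\<phi>\<^sub>e\<close> as a test map determines the bracket.
\<close>

lemma lie_bracket_Pt:
  assumes U: "U \<in> vector_fields k \<mu>" and V: "V \<in> vector_fields k \<mu>" and a: "a \<in> vecs G0"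
  shows "lie_bracket k \<mu> U V (Pt a) = tangent a (D1 V a (coordinate U a) - D1 U a (coordinate V a))"
proof -
  define z where "z = D1 V a (coordinate U a) - D1 U a (coordinate V a)"
  have aG: "a \<in> vecs G" using a by (rule GG0_mem)
  note u = coordinate_mem[OF U a] and v = coordinate_mem[OF V a]
  have z: "z \<in> vecs G0" using D1_mem U V a u v unfolding z_def by auto
  interpret U: twice_differentiable_fun G0 G0 "coordinate U" by (rule field_twice_differentiable[OF U])
  interpret V: twice_differentiable_fun G0 G0 "coordinate V" by (rule field_twice_differentiable[OF V])
  have comm: "deriv_N k \<mu> G f (Pt a) (tangent a z) =
      deriv_N k \<mu> G (\<lambda>Q. deriv_N k \<mu> G f Q (V Q)) (Pt a) (U (Pt a)) -
      deriv_N k \<mu> G (\<lambda>Q. deriv_N k \<mu> G f Q (U Q)) (Pt a) (V (Pt a))"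
    if f: "smooth_N k \<mu> G f" for f
  proof -
    interpret f: twice_differentiable_fun G0 G "\<lambda>y. f (Pt y)"
      using f eval_le normed_G by unfold_locales (auto simp: smooth_N_iff smooth_nspace_def)
    have D: "hasD (\<lambda>y. f (Pt y)) (f.d1 y) y" if "y \<in> vecs G0" for y
      using f.has_fderiv_d1[OF that] by (rule hasD_has_fderiv)
    have d: "deriv_N k \<mu> G f (Pt y) (tangent y h) = f.d1 y h" if "y \<in> vecs G0" "h \<in> vecs G0" for y h
      by (rule deriv_N_eq[OF that(1) refl f.f_mem D[OF that(1)] that(2)])
    have dd: "deriv_N k \<mu> G (\<lambda>Q. deriv_N k \<mu> G f Q (X Q)) (Pt a) (tangent a h)
        = f.d2 a h (coordinate X a) + f.d1 a (D1 X a h)"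
      if X: "X \<in> vector_fields k \<mu>" and h: "h \<in> vecs G0" for X h
    proof (rule deriv_N_eq[OF a _ _ _ h])
      interpret X: twice_differentiable_fun G0 G0 "coordinate X" by (rule field_twice_differentiable[OF X])
      show "deriv_N k \<mu> G f (Pt y) (X (Pt y)) = f.d1 y (coordinate X y)" if "y \<in> vecs G0" for y
        using field_eq_tangent[OF X that] d[OF that coordinate_mem[OF X that]] by simp
      show "f.d1 y (coordinate X y) \<in> vecs G" if "y \<in> vecs G0" for y
        using f.d1_mem[OF that coordinate_mem[OF X that]] .
      show "hasD (\<lambda>y. f.d1 y (coordinate X y)) (\<lambda>h. f.d2 a h (coordinate X a) + f.d1 a (D1 X a h)) a"
        by (rule hasD_has_fderiv[OF f.has_fderiv_d1_apply[OF a coordinate_mem[OF X] X.has_fderiv_d1[OF a]]])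
    qed
    have "f.d1 a z = f.d1 a (D1 V a (coordinate U a)) - f.d1 a (D1 U a (coordinate V a))"
      unfolding z_def
      by (rule bounded_lin_diff[OF normed_GG0 has_fderivD(1)[OF f.has_fderiv_d1[OF a]] D1_mem[OF V a u] D1_mem[OF U a v]])
    then show ?thesis
      unfolding field_eq_tangent[OF U a] field_eq_tangent[OF V a] dd[OF V u] dd[OF U v] d[OF a z]
      using f.d2_symmetric[OF a u v] by simp
  qed
  have chart: "smooth_N k \<mu> G (chart_e k \<mu>)"
  proof -
    let ?I = "\<lambda>h. if h \<in> vecs G0 then h else 0"
    have "?I \<in> bounded_lin G0 G"
      by (rule bounded_linI[where C = 1]) (auto dest: GG0_mem)
    then have "smooth_nspace G0 G (vecs G0) (\<lambda>x. 0 + ?I x)"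
      by (intro smooth_affine normed_GG0 normed_G) auto
    then show ?thesis unfolding smooth_N_iff
      using smooth_nspace_cong[of "vecs G0" "\<lambda>x. 0 + ?I x" "\<lambda>y. chart_e k \<mu> (Pt y)" G0 G] by simp
  qed
  have dc: "deriv_N k \<mu> G (chart_e k \<mu>) (Pt a) (tangent a h) = h" if "h \<in> vecs G0" for h
    by (rule deriv_N_eq[OF a chart_e_Pt GG0_mem hasD_id[OF a] that])
  have "lie_bracket k \<mu> U V (Pt a) = tangent a z"
    unfolding lie_bracket_def GG_eq
  proof (rule the_equality)
    show "tangent a z \<in> tangent_N k \<mu> (Pt a) \<and> (\<forall>f. smooth_N k \<mu> G f \<longrightarrow>
      deriv_N k \<mu> G f (Pt a) (tangent a z) =
      deriv_N k \<mu> G (\<lambda>Q. deriv_N k \<mu> G f Q (V Q)) (Pt a) (U (Pt a)) -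
      deriv_N k \<mu> G (\<lambda>Q. deriv_N k \<mu> G f Q (U Q)) (Pt a) (V (Pt a)))"
      using z comm tangent_N_eq[OF aG] by blast
    fix Y assume Y: "Y \<in> tangent_N k \<mu> (Pt a) \<and> (\<forall>f. smooth_N k \<mu> G f \<longrightarrow>
      deriv_N k \<mu> G f (Pt a) Y =
      deriv_N k \<mu> G (\<lambda>Q. deriv_N k \<mu> G f Q (V Q)) (Pt a) (U (Pt a)) -
      deriv_N k \<mu> G (\<lambda>Q. deriv_N k \<mu> G f Q (U Q)) (Pt a) (V (Pt a)))"
    then obtain h where h: "h \<in> vecs G0" "Y = tangent a h" using tangent_N_eq[OF aG] by blast
    have "deriv_N k \<mu> G (chart_e k \<mu>) (Pt a) Y = deriv_N k \<mu> G (chart_e k \<mu>) (Pt a) (tangent a z)"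
      unfolding comm[OF chart] using Y chart by blast
    then have "h = z" unfolding h(2) dc[OF h(1)] dc[OF z] .
    then show "Y = tangent a z" using h(2) by simp
  qed
  then show ?thesis by (simp add: z_def)
qed

text \<open>The Christoffel symbol of \<open>\<nabla>\<^sup>\<alpha>\<close> in the chart \<open>\<phi>\<^sub>e\<close> is \<open>c *\<^sub>R centre (score a u * score a v)\<close>, \<open>c = (1 - \<alpha>) / 2\<close>.\<close>

lemma nabla_field:
  assumes "U \<in> vector_fields k \<mu>" "V \<in> vector_fields k \<mu>" "y \<in> vecs G0"
  shows "nabla k \<mu> \<alpha> U V (Pt y) = tangent y (D1 V y (coordinate U y) +
    ((1 - \<alpha>) / 2) *\<^sub>R centre (score y (coordinate U y) * score y (coordinate V y)))"
  using assms by (intro nabla_tangent field_eq_tangent coordinate_mem hasD_coordinate)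

text \<open>
  The terms with \<open>metric a u v\<close> and \<open>metric a u w\<close> come from the derivatives of the two scores in the Christoffel
  term, the one with \<open>metric a v w\<close> from the mean of the product of these scores, which the outer score subtracts.
\<close>

lemma nabla_nabla:
  fixes \<alpha> :: real
  assumes U: "U \<in> vector_fields k \<mu>" and V: "V \<in> vector_fields k \<mu>" and W: "W \<in> vector_fields k \<mu>"
    and a: "a \<in> vecs G0"
  defines "c \<equiv> (1 - \<alpha>) / 2"
    and "u \<equiv> coordinate U a" and "v \<equiv> coordinate V a" and "w \<equiv> coordinate W a"
  shows "nabla k \<mu> \<alpha> U (nabla k \<mu> \<alpha> V W) (Pt a) = tangent a (D2 W a u v + D1 W a (D1 V a u) +
    c *\<^sub>R centre (score a (D1 V a u) * score a w + score a v * score a (D1 W a u) + score a u * score a (D1 W a v)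
      + c *\<^sub>R (score a u * score a v * score a w)
      - (metric a u v *\<^sub>R score a w + metric a u w *\<^sub>R score a v + (c * metric a v w) *\<^sub>R score a u)))"
proof -
  have aG: "a \<in> vecs G" using a by (rule GG0_mem)
  have u: "u \<in> vecs G0" and v: "v \<in> vecs G0" and w: "w \<in> vecs G0"
    unfolding u_def v_def w_def using coordinate_mem U V W a by auto
  interpret W: twice_differentiable_fun G0 G0 "coordinate W" by (rule field_twice_differentiable[OF W])
  interpret V: twice_differentiable_fun G0 G0 "coordinate V" by (rule field_twice_differentiable[OF V])
  define n where "n y = D1 W y (coordinate V y) + c *\<^sub>R centre (score y (coordinate V y) * score y (coordinate W y))" for y
  have n: "n y \<in> vecs G0" if "y \<in> vecs G0" for y
    using D1_mem[OF W that coordinate_mem[OF V that]] coordinate_mem[OF V that] coordinate_mem[OF W that] GG0_mem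
    unfolding n_def by auto
  have cG: "coordinate V y \<in> vecs G" "coordinate W y \<in> vecs G" "D1 W y (coordinate V y) \<in> vecs G" if "y \<in> vecs G0" for y
    using D1_mem[OF W that coordinate_mem[OF V that]] coordinate_mem[OF V that] coordinate_mem[OF W that] GG0_mem by auto
  have Dn: "hasD n (\<lambda>h. (D2 W a h (coordinate V a) + D1 W a (D1 V a h)) + c *\<^sub>R centre
      ((score a (D1 V a h) - metric a h (coordinate V a) *\<^sub>R one) * score a (coordinate W a)
       + score a (coordinate V a) * (score a (D1 W a h) - metric a h (coordinate W a) *\<^sub>R one))) a"
    unfolding n_def
    using a cG hasD_coordinate[OF V a] hasD_coordinate[OF W a]
      hasD_has_fderiv_GG0[OF W.has_fderiv_d1_apply[OF a coordinate_mem[OF V] V.has_fderiv_d1[OF a]]]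
    by (intro hasD_add hasD_scale hasD_centre hasD_mult hasD_score) auto
  have nab: "nabla k \<mu> \<alpha> V W (Pt y) = tangent y (n y)" if "y \<in> vecs G0" for y
    using nabla_field[OF V W that] by (simp add: n_def c_def)
  let ?p = "score a u" and ?q = "score a v" and ?r = "score a w"
  let ?A = "score a (D1 V a u)" and ?C = "score a (D1 W a u)" and ?D = "score a (D1 W a v)"
  note mem = GG0_mem[OF u] GG0_mem[OF v] GG0_mem[OF w] GG0_mem[OF D1_mem[OF V a u]]
    GG0_mem[OF D1_mem[OF W a u]] GG0_mem[OF D1_mem[OF W a v]]
  have sn: "score a (n a) = ?D + c *\<^sub>R (?q * ?r - metric a v w *\<^sub>R one)"
  proof -
    have "score a (n a) = ?D + c *\<^sub>R score a (?q * ?r)"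
      unfolding n_def v_def[symmetric] w_def[symmetric] using aG mem by (simp add: score_add score_scale)
    then show ?thesis by (simp add: score_def[of a "?q * ?r"] metric_def)
  qed
  have "nabla k \<mu> \<alpha> U (nabla k \<mu> \<alpha> V W) (Pt a) = tangent a ((D2 W a u v + D1 W a (D1 V a u)) + c *\<^sub>R centre
      ((?A - metric a u v *\<^sub>R one) * ?r + ?q * (?C - metric a u w *\<^sub>R one)) + c *\<^sub>R centre (?p * score a (n a)))"
    unfolding v_def w_def c_def
    by (rule nabla_tangent[where a = a and U = U and v = n, OF a u field_eq_tangent[OF U a, folded u_def] _ _ Dn[unfolded c_def]])
      (use nab n in auto)
  also have "(D2 W a u v + D1 W a (D1 V a u)) + c *\<^sub>R centre
      ((?A - metric a u v *\<^sub>R one) * ?r + ?q * (?C - metric a u w *\<^sub>R one)) + c *\<^sub>R centre (?p * score a (n a))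
    = (D2 W a u v + D1 W a (D1 V a u)) + c *\<^sub>R centre
      ((?A - metric a u v *\<^sub>R one) * ?r + ?q * (?C - metric a u w *\<^sub>R one) + ?p * score a (n a))"
    unfolding sn using mem by (subst centre_add) (auto simp: scaleR_add_right)
  also have "(?A - metric a u v *\<^sub>R one) * ?r + ?q * (?C - metric a u w *\<^sub>R one) + ?p * score a (n a)
    = ?A * ?r + ?q * ?C + ?p * ?D + c *\<^sub>R (?p * ?q * ?r)
      - (metric a u v *\<^sub>R ?r + metric a u w *\<^sub>R ?q + (c * metric a v w) *\<^sub>R ?p)"
  proof -
    have "one * ?r = ?r" "?q * one = ?q" "?p * one = ?p"
      using mult_one mem by (auto simp: mult.commute[of one])
    then show ?thesis unfolding sn
      by (simp add: left_diff_distrib right_diff_distrib distrib_left mult_scaleR_fun scaleR_diff_right mult.assoc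
          algebra_simps)
  qed
  finally show ?thesis .
qed

text \<open>
  Exchanging \<open>u\<close> and \<open>v\<close> leaves the second derivative of \<open>w\<close>, the products with its first derivatives and the
  triple product unchanged, and the bracket term accounts for \<open>D1 V a u\<close> and
  \<open>D1 U a v\<close>. Only multiples of scores with metric coefficients remain.
\<close>

theorem curvature_Pt:
  assumes U: "U \<in> vector_fields k \<mu>" and V: "V \<in> vector_fields k \<mu>" and W: "W \<in> vector_fields k \<mu>"
    and a: "a \<in> vecs G0"
  shows "nabla k \<mu> \<alpha> U (nabla k \<mu> \<alpha> V W) (Pt a) - nabla k \<mu> \<alpha> V (nabla k \<mu> \<alpha> U W) (Pt a)
      - nabla k \<mu> \<alpha> (lie_bracket k \<mu> U V) W (Pt a)
    = ((1 - \<alpha>\<^sup>2) / 4) *\<^sub>R (fisher_rao k \<mu> (Pt a) (V (Pt a)) (W (Pt a)) *\<^sub>R U (Pt a)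
      - fisher_rao k \<mu> (Pt a) (U (Pt a)) (W (Pt a)) *\<^sub>R V (Pt a))"
proof -
  define c where "c = (1 - \<alpha>) / 2"
  define u v w where "u = coordinate U a" and "v = coordinate V a" and "w = coordinate W a"
  define z where "z = D1 V a u - D1 U a v"
  have aG: "a \<in> vecs G" using a by (rule GG0_mem)
  have u: "u \<in> vecs G0" and v: "v \<in> vecs G0" and w: "w \<in> vecs G0"
    unfolding u_def v_def w_def using coordinate_mem U V W a by auto
  interpret W: twice_differentiable_fun G0 G0 "coordinate W" by (rule field_twice_differentiable[OF W])
  have vu: "D1 V a u \<in> vecs G0" and uv: "D1 U a v \<in> vecs G0" using D1_mem U V a u v by auto
  have z: "z \<in> vecs G0" using vu uv by (auto simp: z_def)
  let ?p = "score a u" and ?q = "score a v" and ?r = "score a w"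
  let ?A = "score a (D1 V a u)" and ?B = "score a (D1 U a v)" and ?C = "score a (D1 W a u)" and ?D = "score a (D1 W a v)"
  let ?S1 = "?A * ?r + ?q * ?C + ?p * ?D + c *\<^sub>R (?p * ?q * ?r)
      - (metric a u v *\<^sub>R ?r + metric a u w *\<^sub>R ?q + (c * metric a v w) *\<^sub>R ?p)"
  let ?S2 = "?B * ?r + ?p * ?D + ?q * ?C + c *\<^sub>R (?q * ?p * ?r)
      - (metric a v u *\<^sub>R ?r + metric a v w *\<^sub>R ?p + (c * metric a u w) *\<^sub>R ?q)"
  let ?S3 = "score a z * ?r"
  let ?X1 = "D2 W a u v + D1 W a (D1 V a u) + c *\<^sub>R centre ?S1"
  let ?X2 = "D2 W a v u + D1 W a (D1 U a v) + c *\<^sub>R centre ?S2"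
  let ?X3 = "D1 W a z + c *\<^sub>R centre ?S3"
  have 1: "nabla k \<mu> \<alpha> U (nabla k \<mu> \<alpha> V W) (Pt a) = tangent a ?X1"
    using nabla_nabla[OF U V W a, of \<alpha>] by (simp only: u_def v_def w_def c_def)
  have 2: "nabla k \<mu> \<alpha> V (nabla k \<mu> \<alpha> U W) (Pt a) = tangent a ?X2"
    using nabla_nabla[OF V U W a, of \<alpha>] by (simp only: u_def v_def w_def c_def)
  have lie: "lie_bracket k \<mu> U V (Pt a) = tangent a z"
    unfolding z_def u_def v_def by (rule lie_bracket_Pt[OF U V a])
  have 3: "nabla k \<mu> \<alpha> (lie_bracket k \<mu> U V) W (Pt a) = tangent a ?X3"
    unfolding w_def c_def
    by (intro nabla_tangent[where a = a and U = "lie_bracket k \<mu> U V", OF a z lie] field_eq_tangent[OF W] coordinate_mem[OF W] hasD_coordinate[OF W a])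
  note mem = GG0_mem[OF u] GG0_mem[OF v] GG0_mem[OF w] GG0_mem[OF z] GG0_mem[OF vu] GG0_mem[OF uv]
    GG0_mem[OF D1_mem[OF W a u]] GG0_mem[OF D1_mem[OF W a v]] GG0_mem[OF D1_mem[OF W a vu]]
    GG0_mem[OF D1_mem[OF W a uv]] GG0_mem[OF D1_mem[OF W a z]] GG0_mem[OF D2_mem[OF W a u v]]
    GG0_mem[OF D2_mem[OF W a v u]]
  have S1: "?S1 \<in> vecs G" and S2: "?S2 \<in> vecs G" and S3: "?S3 \<in> vecs G"
    by (intro G.diff_mem G.add_mem G.scale_mem mult_mem score_mem mem)+
  note S = S1 S2 S3
  have X1: "?X1 \<in> vecs G" and X2: "?X2 \<in> vecs G" and X3: "?X3 \<in> vecs G"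
    by (intro G.add_mem G.scale_mem centre_mem mem S)+
  note X = X1 X2 X3
  have sz: "score a z = ?A - ?B" unfolding z_def using aG mem by (intro score_diff) auto
  have "?S1 - ?S2 - ?S3 = (1 - c) *\<^sub>R (metric a v w *\<^sub>R ?p - metric a u w *\<^sub>R ?q)"
    unfolding sz metric_sym[of a v u] by (rule ext) (simp add: algebra_simps)
  then have "centre ?S1 - centre ?S2 - centre ?S3 = centre ((1 - c) *\<^sub>R (metric a v w *\<^sub>R ?p - metric a u w *\<^sub>R ?q))"
    using S by (simp only: centre_diff[symmetric] G.diff_mem)
  also have "\<dots> = (1 - c) *\<^sub>R (metric a v w *\<^sub>R u - metric a u w *\<^sub>R v)"
    using mem u v by (simp add: centre_scale centre_diff centre_score)
  finally have cS: "centre ?S1 - centre ?S2 - centre ?S3 = (1 - c) *\<^sub>R (metric a v w *\<^sub>R u - metric a u w *\<^sub>R v)" .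
  have dec: "?X1 - ?X2 - ?X3 = (D2 W a u v - D2 W a v u) + (D1 W a (D1 V a u) - D1 W a (D1 U a v) - D1 W a z)
      + c *\<^sub>R (centre ?S1 - centre ?S2 - centre ?S3)"
    by (simp add: algebra_simps)
  have e1: "D2 W a u v - D2 W a v u = 0" using W.d2_symmetric[OF a u v] by simp
  have e2: "D1 W a (D1 V a u) - D1 W a (D1 U a v) - D1 W a z = 0"
    unfolding z_def using D1_diff[OF W a vu uv] by simp
  have "c * (1 - c) = (1 - \<alpha>\<^sup>2) / 4" by (simp add: c_def power2_eq_square field_simps)
  then have key: "?X1 - ?X2 - ?X3 = ((1 - \<alpha>\<^sup>2) / 4) *\<^sub>R (metric a v w *\<^sub>R u - metric a u w *\<^sub>R v)"
    unfolding dec e1 e2 cS by simp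
  have "tangent a ?X1 - tangent a ?X2 - tangent a ?X3 = tangent a (?X1 - ?X2 - ?X3)"
    using aG X by (simp only: tangent_diff G.diff_mem)
  also have "\<dots> = ((1 - \<alpha>\<^sup>2) / 4) *\<^sub>R (metric a v w *\<^sub>R tangent a u - metric a u w *\<^sub>R tangent a v)"
    unfolding key using aG mem by (simp only: tangent_scale tangent_diff G.scale_mem)
  finally show ?thesis
    unfolding 1 2 3
    using field_eq_tangent[OF U a] field_eq_tangent[OF V a] field_eq_tangent[OF W a] fisher_rao_tangent[OF aG] mem
    by (simp add: u_def v_def w_def)
qed

text \<open>
  The coordinate function can be taken constant.
\<close>

lemma ex_field_through:
  assumes a: "a \<in> vecs G0" and U: "U \<in> tangent_N k \<mu> (Pt a)"
  obtains U' where "U' \<in> vector_fields k \<mu>" "U' (Pt a) = U"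
proof -
  obtain u where u: "u \<in> vecs G0" "U = tangent a u" using U tangent_N_eq[OF GG0_mem[OF a]] by blast
  define U' where "U' P = tangent (chart_e k \<mu> P) u" for P
  have U': "U' (Pt y) = tangent y u" if "y \<in> vecs G0" for y using that by (simp add: U'_def)
  have "smooth_nspace G0 G0 (vecs G0) (\<lambda>y. u + (\<lambda>_. 0) y)"
  proof (rule smooth_affine[OF normed_GG0 normed_GG0 _ u(1)])
    show "(\<lambda>_. 0) \<in> bounded_lin G0 G0" by (rule bounded_linI[where C = 0]) auto
  qed
  moreover have "coord_e k \<mu> (Pt y) (U' (Pt y)) = u + (\<lambda>_. 0) y" if "y \<in> vecs G0" for y
    using U'[OF that] u(1) GG0_mem[OF that] by simp
  ultimately have "smooth_N k \<mu> G0 (\<lambda>P. coord_e k \<mu> P (U' P))"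
    unfolding smooth_N_iff
    using smooth_nspace_cong[of "vecs G0" "\<lambda>y. coord_e k \<mu> (Pt y) (U' (Pt y))" "\<lambda>y. u + (\<lambda>_. 0) y" G0 G0] by blast
  moreover have "U' P \<in> tangent_N k \<mu> P" if "P \<in> manifold_N k \<mu>" for P
    using that u(1) U' tangent_N_eq GG0_mem unfolding manifold_N_eq by auto
  ultimately have "U' \<in> vector_fields k \<mu>" by (simp add: vector_fields_def)
  then show thesis using that U'[OF a] u(2) by simp
qed

lemma metric_scale_left: "metric a (c *\<^sub>R u) x = c * metric a u x"
  by (simp add: metric_def score_scale mult_scaleR_fun mean_scale)

lemma metric_diff_left:
  "a \<in> vecs G \<Longrightarrow> u \<in> vecs G \<Longrightarrow> v \<in> vecs G \<Longrightarrow> x \<in> vecs G \<Longrightarrow> metric a (u - v) x = metric a u x - metric a v x"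
  by (simp add: metric_def score_diff left_diff_distrib mean_diff)

lemma curvature_tensor_Pt:
  assumes a: "a \<in> vecs G0" and "U \<in> tangent_N k \<mu> (Pt a)" "V \<in> tangent_N k \<mu> (Pt a)"
    "W \<in> tangent_N k \<mu> (Pt a)" "X \<in> tangent_N k \<mu> (Pt a)"
  shows "curvature_tensor k \<mu> \<alpha> (Pt a) U V W X = ((1 - \<alpha>\<^sup>2) / 4) *
    (fisher_rao k \<mu> (Pt a) V W * fisher_rao k \<mu> (Pt a) U X - fisher_rao k \<mu> (Pt a) U W * fisher_rao k \<mu> (Pt a) V X)"
proof -
  have aG: "a \<in> vecs G" using a by (rule GG0_mem)
  obtain u v w x where t: "u \<in> vecs G0" "v \<in> vecs G0" "w \<in> vecs G0" "x \<in> vecs G0"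
    "U = tangent a u" "V = tangent a v" "W = tangent a w" "X = tangent a x"
    using assms(2-5) unfolding tangent_N_eq[OF aG] by (elim imageE) blast
  note g = GG0_mem[OF t(1)] GG0_mem[OF t(2)] GG0_mem[OF t(3)] GG0_mem[OF t(4)]
  have val: "fisher_rao k \<mu> (Pt a) (curvature_op k \<mu> \<alpha> U' V' W' (Pt a)) X = ((1 - \<alpha>\<^sup>2) / 4) *
    (fisher_rao k \<mu> (Pt a) V W * fisher_rao k \<mu> (Pt a) U X - fisher_rao k \<mu> (Pt a) U W * fisher_rao k \<mu> (Pt a) V X)"
    if "U' \<in> vector_fields k \<mu>" "V' \<in> vector_fields k \<mu>" "W' \<in> vector_fields k \<mu>"
      "U' (Pt a) = U" "V' (Pt a) = V" "W' (Pt a) = W" for U' V' W'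
  proof -
    have "curvature_op k \<mu> \<alpha> U' V' W' (Pt a) =
      ((1 - \<alpha>\<^sup>2) / 4) *\<^sub>R (metric a v w *\<^sub>R tangent a u - metric a u w *\<^sub>R tangent a v)"
      unfolding curvature_op_def curvature_Pt[OF that(1-3) a] that(4-6) t(5-8)
      using fisher_rao_tangent[OF aG] g by simp
    also have "\<dots> = tangent a (((1 - \<alpha>\<^sup>2) / 4) *\<^sub>R (metric a v w *\<^sub>R u - metric a u w *\<^sub>R v))"
      using aG g by (simp only: tangent_scale tangent_diff G.scale_mem)
    finally show ?thesis
      using fisher_rao_tangent[OF aG] g aG by (simp add: t(5-8) metric_scale_left metric_diff_left)
  qed
  obtain U' where U': "U' \<in> vector_fields k \<mu>" "U' (Pt a) = U" by (rule ex_field_through[OF a assms(2)])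
  obtain V' where V': "V' \<in> vector_fields k \<mu>" "V' (Pt a) = V" by (rule ex_field_through[OF a assms(3)])
  obtain W' where W': "W' \<in> vector_fields k \<mu>" "W' (Pt a) = W" by (rule ex_field_through[OF a assms(4)])
  show ?thesis unfolding curvature_tensor_def
  proof (rule the_equality)
    fix r
    assume "\<forall>U'\<in>vector_fields k \<mu>. \<forall>V'\<in>vector_fields k \<mu>. \<forall>W'\<in>vector_fields k \<mu>.
      U' (Pt a) = U \<and> V' (Pt a) = V \<and> W' (Pt a) = W \<longrightarrow> r = fisher_rao k \<mu> (Pt a) (curvature_op k \<mu> \<alpha> U' V' W' (Pt a)) X"
    then have "r = fisher_rao k \<mu> (Pt a) (curvature_op k \<mu> \<alpha> U' V' W' (Pt a)) X" using U' V' W' by blast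
    then show "r = ((1 - \<alpha>\<^sup>2) / 4) * (fisher_rao k \<mu> (Pt a) V W * fisher_rao k \<mu> (Pt a) U X
      - fisher_rao k \<mu> (Pt a) U W * fisher_rao k \<mu> (Pt a) V X)"
      using val[OF U'(1) V'(1) W'(1) U'(2) V'(2) W'(2)] by simp
  qed (use val in simp)
qed

text \<open>
  The metric is definite, since a continuous density with vanishing second moment is zero. Hence
  linearly independent tangent vectors have a non-zero Gram determinant.
\<close>

lemma ex_curved_plane:
  assumes "(UNIV :: 'a set) \<noteq> {0}"
  obtains U V where "U \<in> tangent_N k \<mu> (Pt 0)" "V \<in> tangent_N k \<mu> (Pt 0)"
    "fisher_rao k \<mu> (Pt 0) V V * fisher_rao k \<mu> (Pt 0) U U - fisher_rao k \<mu> (Pt 0) U V * fisher_rao k \<mu> (Pt 0) V U \<noteq> 0"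
proof -
  obtain f g where f: "f \<in> vecs G" and g: "g \<in> vecs G"
    and ind: "\<And>p q r. (\<And>x. x \<in> space \<mu> \<Longrightarrow> p * f x + q * g x + r = 0) \<Longrightarrow> p = 0 \<and> q = 0"
    using ex_independent_mod_constants[OF assms] by blast
  let ?u = "centre f" and ?v = "centre g"
  let ?g = "metric 0"
  have z: "(0 :: 'a \<Rightarrow> real) \<in> vecs G" "(0 :: 'a \<Rightarrow> real) \<in> vecs G0" by auto
  have pos: "x = 0" if x: "x \<in> vecs G0" "?g x x = 0" for x
  proof -
    have xG: "x \<in> vecs G" using x(1) by (rule GG0_mem)
    let ?h = "exp_on (space \<mu>) (\<theta> 0) * (score 0 x * score 0 x)"
    have hG: "?h \<in> vecs G" using z xG by (intro mult_mem exp_mem \<theta>_mem score_mem)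
    have "AE y in \<mu>. ?h y = 0"
      using x(2) integral_nonneg_eq_0_iff_AE[OF integrable_mem[OF hG]] by (simp add: metric_def mean_def)
    then have h0: "?h = 0" by (rule AE_zero_imp_zero[OF hG])
    have "score 0 x y = 0" for y
      using fun_cong[OF h0, of y] exp_on_pos[of y "\<theta> 0"] memD(1)[OF score_mem[OF xG], of y 0]
      by (cases "y \<in> space \<mu>") auto
    then have "score 0 x = 0" by auto
    then have "centre (score 0 x) = 0" by (simp add: centre_def)
    then show ?thesis using centre_score[OF xG] x(1) by simp
  qed
  have lin: "p = 0 \<and> q = 0" if "p *\<^sub>R ?u + q *\<^sub>R ?v = 0" for p q
  proof (rule ind)
    fix x assume "x \<in> space \<mu>"
    then show "p * f x + q * g x + (- p * integral\<^sup>L \<mu> f - q * integral\<^sup>L \<mu> g) = 0"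
      using fun_cong[OF that, of x] by (simp add: centre_def algebra_simps)
  qed
  have uG: "?u \<in> vecs G" "?v \<in> vecs G" "?u \<in> vecs G0" "?v \<in> vecs G0" using f g by auto
  have "?g ?v ?v * ?g ?u ?u - ?g ?u ?v * ?g ?v ?u \<noteq> 0"
  proof
    assume det: "?g ?v ?v * ?g ?u ?u - ?g ?u ?v * ?g ?v ?u = 0"
    let ?y = "?g ?u ?u *\<^sub>R ?v - ?g ?u ?v *\<^sub>R ?u"
    have "?g ?y x = ?g ?u ?u * ?g ?v x - ?g ?u ?v * ?g ?u x" if "x \<in> vecs G" for x
      using uG z that by (simp add: metric_diff_left metric_scale_left)
    moreover have "?g x ?y = ?g ?y x" for x by (rule metric_sym)
    ultimately have "?g ?y ?y = ?g ?u ?u * (?g ?u ?u * ?g ?v ?v - ?g ?u ?v * ?g ?u ?v)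
        - ?g ?u ?v * (?g ?u ?u * ?g ?v ?u - ?g ?u ?v * ?g ?u ?u)"
      using uG by (metis metric_sym G.diff_mem G.scale_mem)
    also have "\<dots> = 0" using det metric_sym[of 0 ?v ?u] by (simp add: algebra_simps)
    finally have "?y = 0" using uG by (intro pos) auto
    then have "(- ?g ?u ?v) *\<^sub>R ?u + ?g ?u ?u *\<^sub>R ?v = 0" by simp
    then have "?g ?u ?u = 0" using lin by blast
    then have "?u = 0" using pos uG by blast
    then have "1 *\<^sub>R ?u + 0 *\<^sub>R ?v = 0" by simp
    then show False using lin[of 1 0] by simp
  qed
  then show thesis
    using that[of "tangent 0 ?u" "tangent 0 ?v"] fisher_rao_tangent[OF z(1)] uG tangent_N_eq[OF z(1)] by simp
qed

end

theorem mainTheorem4: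
  fixes B :: "'a::banach set" and \<mu> :: "'a measure" and k :: nat and \<alpha> :: real
  assumes "(UNIV :: 'a set) \<noteq> {0}"
    and "open B"
    and "sets \<mu> = sets (restrict_space borel B)"
    and "prob_space \<mu>"
    and "\<And>A. open A \<Longrightarrow> A \<subseteq> B \<Longrightarrow> A \<noteq> {} \<Longrightarrow> emeasure \<mu> A > 0"
  shows
    "(\<forall>U\<in>vector_fields k \<mu>. \<forall>V\<in>vector_fields k \<mu>. \<forall>W\<in>vector_fields k \<mu>. \<forall>P\<in>manifold_N k \<mu>.
        nabla k \<mu> \<alpha> U (nabla k \<mu> \<alpha> V W) P - nabla k \<mu> \<alpha> V (nabla k \<mu> \<alpha> U W) P
          - nabla k \<mu> \<alpha> (lie_bracket k \<mu> U V) W P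
        = ((1 - \<alpha>\<^sup>2) / 4) *\<^sub>R
            (fisher_rao k \<mu> P (V P) (W P) *\<^sub>R U P - fisher_rao k \<mu> P (U P) (W P) *\<^sub>R V P)) \<and>
     (\<forall>P\<in>manifold_N k \<mu>. \<forall>U\<in>tangent_N k \<mu> P. \<forall>V\<in>tangent_N k \<mu> P.
        \<forall>W\<in>tangent_N k \<mu> P. \<forall>X\<in>tangent_N k \<mu> P.
        curvature_tensor k \<mu> \<alpha> P U V W X
        = ((1 - \<alpha>\<^sup>2) / 4) *
            (fisher_rao k \<mu> P V W * fisher_rao k \<mu> P U X
              - fisher_rao k \<mu> P U W * fisher_rao k \<mu> P V X)) \<and>
     (\<forall>P\<in>manifold_N k \<mu>. \<forall>U\<in>tangent_N k \<mu> P. \<forall>V\<in>tangent_N k \<mu> P.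
        \<forall>W\<in>tangent_N k \<mu> P. \<forall>X\<in>tangent_N k \<mu> P.
        curvature_tensor k \<mu> \<alpha> P U V W X = curvature_tensor k \<mu> (- \<alpha>) P U V W X) \<and>
     ((\<forall>P\<in>manifold_N k \<mu>. \<forall>U\<in>tangent_N k \<mu> P. \<forall>V\<in>tangent_N k \<mu> P.
        \<forall>W\<in>tangent_N k \<mu> P. \<forall>X\<in>tangent_N k \<mu> P. curvature_tensor k \<mu> \<alpha> P U V W X = 0)
       \<longleftrightarrow> \<alpha> = 1 \<or> \<alpha> = - 1)"
proof -
  have sp: "space \<mu> = B" using sets_eq_imp_space_eq[OF assms(3)] by (simp add: space_restrict_space)
  interpret stat_manifold k \<mu>
    using assms(2-5) by (intro stat_manifold.intro) (simp_all add: sp)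
  have tensor: "curvature_tensor k \<mu> \<beta> P U V W X = ((1 - \<beta>\<^sup>2) / 4) *
    (fisher_rao k \<mu> P V W * fisher_rao k \<mu> P U X - fisher_rao k \<mu> P U W * fisher_rao k \<mu> P V X)"
    if "P \<in> manifold_N k \<mu>" "U \<in> tangent_N k \<mu> P" "V \<in> tangent_N k \<mu> P"
      "W \<in> tangent_N k \<mu> P" "X \<in> tangent_N k \<mu> P" for \<beta> P U V W X
    using that curvature_tensor_Pt unfolding manifold_N_eq by blast
  have flat: "\<alpha> = 1 \<or> \<alpha> = - 1"
    if "\<forall>P\<in>manifold_N k \<mu>. \<forall>U\<in>tangent_N k \<mu> P. \<forall>V\<in>tangent_N k \<mu> P.
        \<forall>W\<in>tangent_N k \<mu> P. \<forall>X\<in>tangent_N k \<mu> P. curvature_tensor k \<mu> \<alpha> P U V W X = 0"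
  proof -
    obtain U V where UV: "U \<in> tangent_N k \<mu> (Pt 0)" "V \<in> tangent_N k \<mu> (Pt 0)"
      "fisher_rao k \<mu> (Pt 0) V V * fisher_rao k \<mu> (Pt 0) U U - fisher_rao k \<mu> (Pt 0) U V * fisher_rao k \<mu> (Pt 0) V U \<noteq> 0"
      using ex_curved_plane[OF assms(1)] by blast
    have P: "Pt 0 \<in> manifold_N k \<mu>" by (rule Pt_mem_N) simp
    have "((1 - \<alpha>\<^sup>2) / 4) * (fisher_rao k \<mu> (Pt 0) V V * fisher_rao k \<mu> (Pt 0) U U
      - fisher_rao k \<mu> (Pt 0) U V * fisher_rao k \<mu> (Pt 0) V U) = 0"
      using tensor[OF P UV(1) UV(2) UV(2) UV(1), of \<alpha>] that P UV(1,2) by simp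
    then have "\<alpha>\<^sup>2 = 1" using UV(3) by simp
    then show ?thesis by (simp add: power2_eq_1_iff)
  qed
  show ?thesis
  proof (intro conjI ballI)
    show "nabla k \<mu> \<alpha> U (nabla k \<mu> \<alpha> V W) P - nabla k \<mu> \<alpha> V (nabla k \<mu> \<alpha> U W) P
          - nabla k \<mu> \<alpha> (lie_bracket k \<mu> U V) W P
        = ((1 - \<alpha>\<^sup>2) / 4) *\<^sub>R
            (fisher_rao k \<mu> P (V P) (W P) *\<^sub>R U P - fisher_rao k \<mu> P (U P) (W P) *\<^sub>R V P)"
      if "U \<in> vector_fields k \<mu>" "V \<in> vector_fields k \<mu>" "W \<in> vector_fields k \<mu>" "P \<in> manifold_N k \<mu>" for U V W P
      using that curvature_Pt unfolding manifold_N_eq by blast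
    show "(\<forall>P\<in>manifold_N k \<mu>. \<forall>U\<in>tangent_N k \<mu> P. \<forall>V\<in>tangent_N k \<mu> P.
        \<forall>W\<in>tangent_N k \<mu> P. \<forall>X\<in>tangent_N k \<mu> P. curvature_tensor k \<mu> \<alpha> P U V W X = 0)
       \<longleftrightarrow> \<alpha> = 1 \<or> \<alpha> = - 1"
    proof
      assume "\<alpha> = 1 \<or> \<alpha> = - 1"
      then have "(1 - \<alpha>\<^sup>2) / 4 = 0" by auto
      then show "\<forall>P\<in>manifold_N k \<mu>. \<forall>U\<in>tangent_N k \<mu> P. \<forall>V\<in>tangent_N k \<mu> P.
        \<forall>W\<in>tangent_N k \<mu> P. \<forall>X\<in>tangent_N k \<mu> P. curvature_tensor k \<mu> \<alpha> P U V W X = 0"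
        using tensor[of _ _ _ _ _ \<alpha>] by (metis mult_zero_left)
    qed (rule flat)
  qed (simp_all add: tensor)
qed

end
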